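(* There exists a positive integer $d_0$ such that the following holds for all integers $d \geq d_0$. Let $n \geq d+1$ be an even integer, and let $G$ be an $(n,d,\lambda)$-graph on vertex set $[n]=\{1,\dots,n\}$ with $\lambda \leq \frac{d}{12}$. Then $G$ admits a decomposition into at most $\log_2 d + 36$ regular bipartite spanning subgraphs.
   Context: All graphs are simple and finite. For a graph $G$ on $n$ vertices with adjacency matrix $A$ and eigenvalues $\lambda_1\geq\lambda_2\geq\dots\geq\lambda_n$, set $\lambda(G):=\max\{|\lambda_2|,|\lambda_n|\}$. An $(n,d,\lambda)$-graph is a $d$-regular graph $G$ on $n$ vertices with $\lambda(G)\leq\lambda$. A decomposition of a graph $G$ is a collection of pairwise edge-disjoint subgraphs of $G$ whose edge sets together cover $E(G)$. A spanning subgraph has vertex set $V(G)$; a regular bipartite spanning subgraph is a spanning subgraph that is regular (every vertex has the same degree) and bipartite. *)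

theory Defs
  imports Complex_Main "Jordan_Normal_Form.Char_Poly" "HOL-Library.Multiset"
begin

definition simple_graph :: "nat \<Rightarrow> nat set set \<Rightarrow> bool" where
  "simple_graph n E \<longleftrightarrow>
     (\<forall>e\<in>E. \<exists>u v. u \<noteq> v \<and> u \<in> {1..n} \<and> v \<in> {1..n} \<and> e = {u, v})"

definition degree :: "nat set set \<Rightarrow> nat \<Rightarrow> nat" where
  "degree E v = card {e\<in>E. v \<in> e}"

definition regular :: "nat \<Rightarrow> nat set set \<Rightarrow> nat \<Rightarrow> bool" where
  "regular n E d \<longleftrightarrow> (\<forall>v\<in>{1..n}. degree E v = d)"

definition adj_matrix :: "nat \<Rightarrow> nat set set \<Rightarrow> real mat" where
  "adj_matrix n E = mat n n (\<lambda>(i, j). if {i + 1, j + 1} \<in> E then 1 else 0)"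

definition eigenvalues_desc :: "real mat \<Rightarrow> real list" where
  "eigenvalues_desc A = rev (sorted_list_of_multiset (proots (char_poly A)))"

definition second_eig :: "nat \<Rightarrow> nat set set \<Rightarrow> real" where
  "second_eig n E = (let ev = eigenvalues_desc (adj_matrix n E)
                     in max \<bar>ev ! 1\<bar> \<bar>last ev\<bar>)"

definition ndlambda_graph :: "nat \<Rightarrow> nat \<Rightarrow> real \<Rightarrow> nat set set \<Rightarrow> bool" where
  "ndlambda_graph n d lam E \<longleftrightarrow>
     simple_graph n E \<and> regular n E d \<and> second_eig n E \<le> lam"

definition bipartite :: "nat \<Rightarrow> nat set set \<Rightarrow> bool" where
  "bipartite n H \<longleftrightarrow> (\<exists>A \<subseteq> {1..n}. \<forall>e\<in>H. card (e \<inter> A) = 1 \<and> card (e - A) = 1)"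

definition regular_bipartite_spanning :: "nat \<Rightarrow> nat set set \<Rightarrow> nat set set \<Rightarrow> bool" where
  "regular_bipartite_spanning n E H \<longleftrightarrow>
     H \<subseteq> E \<and> (\<exists>k. regular n H k) \<and> bipartite n H"

definition is_decomposition :: "nat set set \<Rightarrow> nat set set list \<Rightarrow> bool" where
  "is_decomposition E Hs \<longleftrightarrow>
     (\<forall>i<length Hs. \<forall>j<length Hs. i \<noteq> j \<longrightarrow> Hs ! i \<inter> Hs ! j = {}) \<and>
     (\<Union>H\<in>set Hs. H) = E"

end

theory Submission
  imports Defs "HOL-Analysis.Function_Topology" "HOL-Real_Asymp.Real_Asymp"
begin

text \<open>
Fix a balanced bipartition \<open>(A, B)\<close> with every vertex having about \<open>d/2\<close> neighbours on each side.
It suffices to cover the edges inside \<open>A\<close> and inside \<open>B\<close> by about \<open>log\<^sub>2 d\<close> edge-disjoint bipartite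
graphs, each containing equally many edges inside \<open>A\<close> and inside \<open>B\<close>, and to make each of them regular
by adding few edges between \<open>A\<close> and \<open>B\<close>: what is then left of the edges between \<open>A\<close> and \<open>B\<close>
is regular and bipartite.

The bipartite graphs come from colouring the vertices by bit strings and assigning an inner edge to a bit
in which its ends differ. In a first round of about \<open>(log\<^sub>2 d)/4\<close> bits an edge goes to the first
such bit; concentration makes these graphs almost regular, and dropping few edges balances the two sides.
The remaining sparse graph is coloured properly with a constant times its degree many colours, and
Hall's theorem pairs its edges inside \<open>A\<close> with its edges inside \<open>B\<close> such that paired edges
can be given to a common bit. The colourings exist by a counting form of the local lemma.
The regularisation is a bipartite degree-constrained factor problem; its cut condition follows from the
expander mixing lemma, because all prescribed degrees differ by a factor of at most \<open>11/10\<close>.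
\<close>

section \<open>Degree-constrained bipartite factors and Hall's theorem\<close>

text \<open>The number \<open>n\<close> of vertices is not bounded in terms of \<open>d\<close>, so
  a union bound over the vertices is out of reach; each single choice may only interact with a
  number of constraints bounded in terms of \<open>d\<close>. One round with about
  \<open>log 2 d\<close> bits would not do: after so many halvings the degrees are bounded and no
  longer concentrate. The first round stops at degrees of order \<open>d powr (3/4)\<close>, still
  above the deviation \<open>d powr (2/3)\<close>. The second round needs a large constant times the
  remaining degree many colours, and that degree is about \<open>d\<close> divided by twice the
  number of colours of the first round. Hence the two rounds together use \<open>log 2 d\<close>
  bits up to a constant. Equally many inner edges on both sides are required by a degree count:
  edges between \<open>A\<close> and \<open>B\<close> that cross \<open>S\<close> join
  \<open>A \<inter> S\<close> to \<open>B - S\<close> or \<open>A - S\<close> to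
  \<open>B \<inter> S\<close>, so the missing degrees must have the same sum on the two parts so
  joined. The factor 11/10 is arranged through the target: if the degrees lie in a window of width
  \<open>w\<close>, a target \<open>11 * w\<close> above its lower end leaves between
  \<open>10 * w\<close> and \<open>11 * w\<close> to be added.\<close>

text \<open>
Induction on the number of edges: an edge can be deleted unless it lies in a tight pair \<open>(X', Y')\<close>, and it can be
put into the factor unless some tight pair avoids both its ends; uncrossing two such pairs gives a contradiction.
Non-negativity of \<open>f\<close> and \<open>g\<close> is implied by the cut condition.
\<close>

lemma bipartite_factor:
  fixes f :: "'a \<Rightarrow> int" and g :: "'b \<Rightarrow> int"
  assumes "finite W" "finite X" "finite Y" "W \<subseteq> X \<times> Y"
    and "\<And>X' Y'. X' \<subseteq> X \<Longrightarrow> Y' \<subseteq> Y \<Longrightarrow> sum f X' \<le> int (card (W \<inter> X' \<times> Y')) + sum g (Y - Y')"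
    and "sum f X = sum g Y"
  shows "\<exists>F\<subseteq>W. (\<forall>x\<in>X. int (card {y. (x, y) \<in> F}) = f x) \<and> (\<forall>y\<in>Y. int (card {x. (x, y) \<in> F}) = g y)"
  using assms(1,4-)
proof (induction W arbitrary: f g rule: finite_induct)
  case empty
  have fle: "sum f X' \<le> sum g (Y - Y')" if "X' \<subseteq> X" "Y' \<subseteq> Y" for X' Y'
    using empty.prems(2)[OF that] by simp
  have "f x = 0" if "x \<in> X" for x
  proof -
    have "f x \<le> 0" using fle[of "{x}" Y] that by simp
    moreover have "f x \<ge> 0"
      using fle[of "X - {x}" "{}"] that empty.prems(3) sum_diff1[OF assms(2), of f x] by auto
    ultimately show ?thesis by simp
  qed
  moreover have "g y = 0" if "y \<in> Y" for y
  proof -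
    have "Y - (Y - {y}) = {y}" using that by auto
    then have "g y \<ge> 0" using fle[of "{}" "Y - {y}"] that by simp
    moreover have "g y \<le> 0"
      using fle[of X "{y}"] that empty.prems(3) sum_diff1[OF assms(3), of g y] by auto
    ultimately show ?thesis by simp
  qed
  ultimately show ?case by auto
next
  case (insert e W)
  obtain x y where e: "e = (x, y)" by (cases e)
  have xy: "x \<in> X" "y \<in> Y" and WXY: "W \<subseteq> X \<times> Y" using insert.prems(1) e by auto
  have ce: "card (insert e W \<inter> X' \<times> Y') = card (W \<inter> X' \<times> Y') + (if x \<in> X' \<and> y \<in> Y' then 1 else 0)" for X' Y'
  proof (cases "x \<in> X' \<and> y \<in> Y'")
    case True
    then have "insert e W \<inter> X' \<times> Y' = insert e (W \<inter> X' \<times> Y')" using e by auto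
    then show ?thesis using True insert.hyps by simp
  next
    case False
    then have "insert e W \<inter> X' \<times> Y' = W \<inter> X' \<times> Y'" using e by auto
    then show ?thesis using False by simp
  qed
  show ?case
  proof (cases "\<forall>X'\<subseteq>X. \<forall>Y'\<subseteq>Y. sum f X' \<le> int (card (W \<inter> X' \<times> Y')) + sum g (Y - Y')")
    case True
    then obtain F where "F \<subseteq> W" "(\<forall>x\<in>X. int (card {y. (x, y) \<in> F}) = f x) \<and> (\<forall>y\<in>Y. int (card {x. (x, y) \<in> F}) = g y)"
      using insert.IH[OF WXY _ insert.prems(3)] by blast
    then show ?thesis by blast
  next
    case False
    then obtain X1 Y1 where T1: "X1 \<subseteq> X" "Y1 \<subseteq> Y" "sum f X1 > int (card (W \<inter> X1 \<times> Y1)) + sum g (Y - Y1)"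
      by (auto simp: not_le)
    \<comment> \<open>Only inequalities whose rectangle contains \<open>e\<close> lose anything when
      \<open>e\<close> is deleted, and they lose 1. So the violated pair contains both ends of
      \<open>e\<close>.\<close>
    have in1: "x \<in> X1" "y \<in> Y1"
      using insert.prems(2)[OF T1(1,2)] T1(3) unfolding ce by (auto split: if_splits)
    define f' where "f' = (\<lambda>u. f u - (if u = x then 1 else 0))"
    define g' where "g' = (\<lambda>u. g u - (if u = y then 1 else 0))"
    have sf: "sum f' Z = sum f Z - (if x \<in> Z then 1 else 0)" if "Z \<subseteq> X" for Z
      using finite_subset[OF that assms(2)] by (simp add: f'_def sum_subtractf)
    have sg: "sum g' Z = sum g Z - (if y \<in> Z then 1 else 0)" if "Z \<subseteq> Y" for Z
      using finite_subset[OF that assms(3)] by (simp add: g'_def sum_subtractf)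
    have cond: "sum f' X2 \<le> int (card (W \<inter> X2 \<times> Y2)) + sum g' (Y - Y2)" if s2: "X2 \<subseteq> X" "Y2 \<subseteq> Y" for X2 Y2
    proof (cases "x \<notin> X2 \<and> y \<notin> Y2")
      case False
      then show ?thesis
        using insert.prems(2)[OF s2] sf[OF s2(1)] sg[of "Y - Y2"] xy unfolding ce by (auto split: if_splits)
    next
      \<comment> \<open>Here only the right side drops, by 1. Neither uncrossed rectangle contains
        \<open>e\<close>, so both inequalities hold with \<open>W\<close> in place of
        \<open>insert e W\<close>, and the strict violation at \<open>(X1, Y1)\<close> supplies the
        missing 1.\<close>
      case out: True
      have fin: "finite (W \<inter> Z)" for Z using insert.hyps by simp
      have "card (W \<inter> (X1 \<inter> X2) \<times> (Y1 \<union> Y2)) + card (W \<inter> (X1 \<union> X2) \<times> (Y1 \<inter> Y2))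
          = card ((W \<inter> (X1 \<inter> X2) \<times> (Y1 \<union> Y2)) \<union> (W \<inter> (X1 \<union> X2) \<times> (Y1 \<inter> Y2)))
            + card ((W \<inter> (X1 \<inter> X2) \<times> (Y1 \<union> Y2)) \<inter> (W \<inter> (X1 \<union> X2) \<times> (Y1 \<inter> Y2)))"
        by (rule card_Un_Int[OF fin fin])
      also have "\<dots> \<le> card ((W \<inter> X1 \<times> Y1) \<union> (W \<inter> X2 \<times> Y2)) + card ((W \<inter> X1 \<times> Y1) \<inter> (W \<inter> X2 \<times> Y2))"
        by (intro add_mono card_mono) (auto simp: fin)
      also have "\<dots> = card (W \<inter> X1 \<times> Y1) + card (W \<inter> X2 \<times> Y2)"
        by (rule card_Un_Int[OF fin fin, symmetric])
      finally have cW: "card (W \<inter> (X1 \<inter> X2) \<times> (Y1 \<union> Y2)) + card (W \<inter> (X1 \<union> X2) \<times> (Y1 \<inter> Y2))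
          \<le> card (W \<inter> X1 \<times> Y1) + card (W \<inter> X2 \<times> Y2)" .
      have M: "sum f (X1 \<inter> X2) \<le> int (card (W \<inter> (X1 \<inter> X2) \<times> (Y1 \<union> Y2))) + sum g (Y - (Y1 \<union> Y2))"
        using insert.prems(2)[of "X1 \<inter> X2" "Y1 \<union> Y2"] T1(1,2) s2 out unfolding ce by auto
      have N: "sum f (X1 \<union> X2) \<le> int (card (W \<inter> (X1 \<union> X2) \<times> (Y1 \<inter> Y2))) + sum g (Y - (Y1 \<inter> Y2))"
        using insert.prems(2)[of "X1 \<union> X2" "Y1 \<inter> Y2"] T1(1,2) s2 out unfolding ce by auto
      have "sum f (X1 \<union> X2) + sum f (X1 \<inter> X2) = sum f X1 + sum f X2"
        using T1(1) s2(1) assms(2) by (intro sum.union_inter) (auto dest: finite_subset)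
      moreover have "sum g (Y - (Y1 \<inter> Y2)) + sum g (Y - (Y1 \<union> Y2)) = sum g (Y - Y1) + sum g (Y - Y2)"
      proof -
        have "Y - (Y1 \<inter> Y2) = (Y - Y1) \<union> (Y - Y2)" "Y - (Y1 \<union> Y2) = (Y - Y1) \<inter> (Y - Y2)" by auto
        then show ?thesis using assms(3) sum.union_inter[of "Y - Y1" "Y - Y2" g] by simp
      qed
      ultimately show ?thesis
        using M N cW T1(3) sf[OF s2(1)] sg[of "Y - Y2"] out xy by simp
    qed
    have "sum f' X = sum g' Y" using sf[of X] sg[of Y] xy insert.prems(3) by simp
    then obtain F where F: "F \<subseteq> W" "\<forall>x\<in>X. int (card {y. (x, y) \<in> F}) = f' x" "\<forall>y\<in>Y. int (card {x. (x, y) \<in> F}) = g' y"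
      using insert.IH[OF WXY cond] by blast
    have finF: "finite F" using F(1) insert.hyps finite_subset by auto
    have eF: "(x, y) \<notin> F" using F(1) insert.hyps e by auto
    have f1: "finite {v. (u, v) \<in> F}" for u
      by (rule finite_subset[of _ "snd ` F"]) (use finF in force)+
    have f2: "finite {u. (u, v) \<in> F}" for v
      by (rule finite_subset[of _ "fst ` F"]) (use finF in force)+
    have d1: "int (card {v. (u, v) \<in> insert e F}) = f u" if "u \<in> X" for u
    proof (cases "u = x")
      case True
      then have "{v. (u, v) \<in> insert e F} = insert y {v. (u, v) \<in> F}" using e by auto
      then show ?thesis using True eF f1 F(2) that by (simp add: f'_def)
    next
      case False
      then show ?thesis using F(2) that e by (simp add: f'_def)
    qed
    have d2: "int (card {u. (u, v) \<in> insert e F}) = g v" if "v \<in> Y" for v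
    proof (cases "v = y")
      case True
      then have "{u. (u, v) \<in> insert e F} = insert x {u. (u, v) \<in> F}" using e by auto
      then show ?thesis using True eF f2 F(3) that by (simp add: g'_def)
    next
      case False
      then show ?thesis using F(3) that e by (simp add: g'_def)
    qed
    show ?thesis
      by (rule exI[of _ "insert e F"]) (use F(1) d1 d2 in auto)
  qed
qed

text \<open>The factor theorem with all prescribed degrees equal to 1: a neighbour of
  \<open>X'\<close> is either the end of an edge into \<open>Y'\<close> or lies in
  \<open>Y - Y'\<close>, so Hall's condition implies the cut condition.\<close>

lemma hall_bijection:
  assumes fin: "finite X" "finite Y" and card_eq: "card X = card Y"
    and hall: "\<And>X'. X' \<subseteq> X \<Longrightarrow> card X' \<le> card {y\<in>Y. \<exists>x\<in>X'. r x y}"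
  shows "\<exists>\<phi>. bij_betw \<phi> X Y \<and> (\<forall>x\<in>X. r x (\<phi> x))"
proof -
  define W where "W = {(x, y). x \<in> X \<and> y \<in> Y \<and> r x y}"
  have finW: "finite W" by (rule finite_subset[of _ "X \<times> Y"]) (auto simp: W_def fin)
  have "\<exists>F\<subseteq>W. (\<forall>x\<in>X. int (card {y. (x, y) \<in> F}) = 1) \<and> (\<forall>y\<in>Y. int (card {x. (x, y) \<in> F}) = 1)"
  proof (rule bipartite_factor)
    show "(\<Sum>x\<in>X'. 1) \<le> int (card (W \<inter> X' \<times> Y')) + (\<Sum>y\<in>Y - Y'. 1)" if "X' \<subseteq> X" "Y' \<subseteq> Y" for X' Y'
    proof -
      have "card X' \<le> card {y\<in>Y. \<exists>x\<in>X'. r x y}" by (rule hall[OF that(1)])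
      also have "\<dots> \<le> card (snd ` (W \<inter> X' \<times> Y') \<union> (Y - Y'))"
      proof (rule card_mono)
        show "{y\<in>Y. \<exists>x\<in>X'. r x y} \<subseteq> snd ` (W \<inter> X' \<times> Y') \<union> (Y - Y')"
          using that by (force simp: W_def image_iff)
      qed (use finW fin in auto)
      also have "\<dots> \<le> card (snd ` (W \<inter> X' \<times> Y')) + card (Y - Y')" by (rule card_Un_le)
      also have "\<dots> \<le> card (W \<inter> X' \<times> Y') + card (Y - Y')" using finW by (intro add_right_mono card_image_le) auto
      finally show ?thesis by simp
    qed
  qed (use fin finW card_eq in \<open>auto simp: W_def\<close>)
  then obtain F where F: "F \<subseteq> W" "\<And>x. x \<in> X \<Longrightarrow> card {y. (x, y) \<in> F} = 1" "\<And>y. y \<in> Y \<Longrightarrow> card {x. (x, y) \<in> F} = 1"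
    by auto
  define \<phi> where "\<phi> x = (THE y. (x, y) \<in> F)" for x
  have \<phi>: "(x, y) \<in> F \<longleftrightarrow> y = \<phi> x" if x: "x \<in> X" for x y
  proof -
    obtain y0 where "{y. (x, y) \<in> F} = {y0}" using F(2)[OF x] card_1_singletonE by blast
    then have "(x, y) \<in> F \<longleftrightarrow> y = y0" for y by blast
    then show ?thesis by (simp add: \<phi>_def)
  qed
  have "bij_betw \<phi> X Y"
  proof (rule bij_betw_imageI)
    show "inj_on \<phi> X"
    proof (rule inj_onI)
      fix x x' assume x: "x \<in> X" "x' \<in> X" "\<phi> x = \<phi> x'"
      then have "(x, \<phi> x) \<in> F" "(x', \<phi> x) \<in> F" using \<phi> by auto
      moreover have "\<phi> x \<in> Y" using calculation F(1) by (auto simp: W_def)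
      then obtain z where z: "{u. (u, \<phi> x) \<in> F} = {z}" using F(3) card_1_singletonE by blast
      ultimately have "x \<in> {z}" "x' \<in> {z}" unfolding z[symmetric] by auto
      then show "x = x'" by simp
    qed
    show "\<phi> ` X = Y"
    proof
      have "(x, \<phi> x) \<in> F" if "x \<in> X" for x using \<phi>[OF that] by simp
      then show "\<phi> ` X \<subseteq> Y" using F(1) by (fastforce simp: W_def)
      show "Y \<subseteq> \<phi> ` X"
      proof
        fix y assume "y \<in> Y"
        then obtain z where "{u. (u, y) \<in> F} = {z}" using F(3) card_1_singletonE by blast
        then have z: "(z, y) \<in> F" by blast
        then have "z \<in> X" using F(1) by (auto simp: W_def)
        then show "y \<in> \<phi> ` X" using \<phi> z by auto
      qed
    qed
  qed
  moreover have "r x (\<phi> x)" if "x \<in> X" for x using \<phi>[OF that] F(1) by (auto simp: W_def)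
  ultimately show ?thesis by blast
qed

section \<open>Colourings by counting\<close>

text \<open>
Rosenfeld's counting argument: adding one element to the coloured set multiplies the number of good colourings by
at least \<open>(1 - \<delta>) |C|\<close>, because an extension violating constraint \<open>i\<close> is determined by a bad pattern on \<open>N i\<close>
and a good colouring of the rest.
\<close>

lemma exists_good_coloring:
  fixes P :: "'i \<Rightarrow> real" and Bad :: "'i \<Rightarrow> ('a \<Rightarrow> 'b) set"
  assumes finX: "finite X" and finC: "finite C" "C \<noteq> {}" and finI: "finite I"
    and N: "\<And>i. i \<in> I \<Longrightarrow> N i \<subseteq> X" "\<And>i. i \<in> I \<Longrightarrow> N i \<noteq> {}"
    and card_Bad: "\<And>i. i \<in> I \<Longrightarrow> real (card (Bad i)) \<le> P i * real (card C) ^ card (N i)"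
    and Bad: "\<And>i. i \<in> I \<Longrightarrow> Bad i \<subseteq> PiE (N i) (\<lambda>_. C)"
    and \<delta>: "0 \<le> \<delta>" "\<delta> < 1"
    and local: "\<And>x. x \<in> X \<Longrightarrow> (\<Sum>i\<in>{i\<in>I. x \<in> N i}. P i / (1 - \<delta>) ^ card (N i)) \<le> \<delta>"
  shows "\<exists>c\<in>PiE X (\<lambda>_. C). \<forall>i\<in>I. restrict c (N i) \<notin> Bad i"
proof -
  define Q where "Q = real (card C)"
  define q where "q = Q * (1 - \<delta>)"
  have Q0: "Q > 0" using finC by (auto simp: Q_def card_gt_0_iff)
  have q0: "q > 0" using Q0 \<delta> by (simp add: q_def)
  have P0: "P i \<ge> 0" if "i \<in> I" for i
  proof -
    have "0 \<le> P i * Q ^ card (N i)" using card_Bad[OF that] of_nat_0_le_iff order_trans unfolding Q_def by blast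
    moreover have "Q ^ card (N i) > 0" using Q0 by simp
    ultimately show ?thesis by (simp add: zero_le_mult_iff)
  qed
  define good where "good Y = {c \<in> PiE Y (\<lambda>_. C). \<forall>i\<in>I. N i \<subseteq> Y \<longrightarrow> restrict c (N i) \<notin> Bad i}" for Y
  have fin_good: "finite (good Y)" if "Y \<subseteq> X" for Y
    unfolding good_def using finite_PiE[OF finite_subset[OF that finX], of "\<lambda>_. C"] finC by simp
  have good_restrict: "restrict c Z \<in> good Z" if "c \<in> good Y" "Z \<subseteq> Y" for c Y Z
  proof -
    have "restrict (restrict c Z) (N i) = restrict c (N i)" if "N i \<subseteq> Z" for i
      using that by (auto simp: restrict_def fun_eq_iff)
    then show ?thesis using that unfolding good_def by (auto simp: PiE_iff)
  qed
  have step: "real (card (good (insert x Y))) \<ge> q * real (card (good Y))"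
    if Y: "Y \<subseteq> X" and x: "x \<in> X" "x \<notin> Y"
      and IH: "\<And>Z. Z \<subseteq> Y \<Longrightarrow> real (card (good Y)) \<ge> q ^ card (Y - Z) * real (card (good Z))" for x Y
  proof -
    define ext where "ext = {c \<in> PiE (insert x Y) (\<lambda>_. C). restrict c Y \<in> good Y}"
    have finY: "finite Y" using finite_subset[OF Y finX] .
    have fin_ext: "finite ext"
      unfolding ext_def using finite_PiE[of "insert x Y" "\<lambda>_. C"] finY finC by simp
    have "card (C \<times> good Y) \<le> card ext"
    proof (rule card_inj_on_le[where f = "\<lambda>(\<gamma>, c). c(x := \<gamma>)"])
      show "inj_on (\<lambda>(\<gamma>, c). c(x := \<gamma>)) (C \<times> good Y)"
      proof (rule inj_onI, clarsimp)
        fix a c a' c' assume *: "c \<in> good Y" "c' \<in> good Y" "c(x := a) = c'(x := a')"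
        have "c x = undefined" "c' x = undefined" using * x(2) by (auto simp: good_def PiE_iff extensional_def)
        have "a = a'" using fun_cong[OF *(3), of x] by simp
        moreover have "c u = c' u" for u using fun_cong[OF *(3), of u] \<open>c x = undefined\<close> \<open>c' x = undefined\<close>
          by (cases "u = x") auto
        ultimately show "a = a' \<and> c = c'" by auto
      qed
      show "(\<lambda>(\<gamma>, c). c(x := \<gamma>)) ` (C \<times> good Y) \<subseteq> ext"
      proof clarsimp
        fix a c assume a: "a \<in> C" and c: "c \<in> good Y"
        have "restrict (c(x := a)) Y = c"
          using c x(2) by (auto simp: good_def PiE_iff extensional_def restrict_def fun_eq_iff)
        moreover have "c(x := a) \<in> PiE (insert x Y) (\<lambda>_. C)"
          using a c by (auto simp: good_def PiE_iff extensional_def)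
        ultimately show "c(x := a) \<in> ext" using c by (simp add: ext_def)
      qed
    qed (rule fin_ext)
    then have ext_ge: "Q * real (card (good Y)) \<le> real (card ext)"
      by (simp add: card_cartesian_product Q_def flip: of_nat_mult)
    \<comment> \<open>Constraints supported in \<open>Y\<close> hold throughout \<open>ext\<close>;
      only those completed by \<open>x\<close> can fail.\<close>
    define J where "J = {i\<in>I. x \<in> N i \<and> N i \<subseteq> insert x Y}"
    define B where "B i = {c \<in> ext. restrict c (N i) \<in> Bad i}" for i
    have "ext \<subseteq> good (insert x Y) \<union> (\<Union>i\<in>J. B i)"
    proof
      fix c assume c: "c \<in> ext"
      show "c \<in> good (insert x Y) \<union> (\<Union>i\<in>J. B i)"
      proof (cases "c \<in> (\<Union>i\<in>J. B i)")
        case False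
        have "restrict c (N i) \<notin> Bad i" if i: "i \<in> I" "N i \<subseteq> insert x Y" for i
        proof (cases "x \<in> N i")
          case True
          then show ?thesis using False i c by (auto simp: J_def B_def)
        next
          case xN: False
          then have "N i \<subseteq> Y" using i by auto
          then have "restrict (restrict c Y) (N i) = restrict c (N i)" by (auto simp: restrict_def fun_eq_iff)
          moreover have "restrict (restrict c Y) (N i) \<notin> Bad i"
            using c \<open>N i \<subseteq> Y\<close> i(1) by (auto simp: ext_def good_def)
          ultimately show ?thesis by simp
        qed
        then show ?thesis using c unfolding ext_def good_def by auto
      qed simp
    qed
    then have "card ext \<le> card (good (insert x Y) \<union> (\<Union>i\<in>J. B i))"
      using fin_good[of "insert x Y"] Y x finI fin_ext by (intro card_mono) (auto simp: B_def J_def)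
    also have "\<dots> \<le> card (good (insert x Y)) + card (\<Union>i\<in>J. B i)" by (rule card_Un_le)
    also have "card (\<Union>i\<in>J. B i) \<le> (\<Sum>i\<in>J. card (B i))"
      by (rule card_UN_le) (use finI in \<open>simp add: J_def\<close>)
    finally have "card ext \<le> card (good (insert x Y)) + (\<Sum>i\<in>J. card (B i))" by simp
    then have "real (card ext) \<le> real (card (good (insert x Y))) + (\<Sum>i\<in>J. real (card (B i)))"
      by (simp flip: of_nat_sum of_nat_add)
    moreover have "real (card (B i)) \<le> Q * real (card (good Y)) * (P i / (1 - \<delta>) ^ card (N i))" if i: "i \<in> J" for i
    proof -
      have iI: "i \<in> I" and xN: "x \<in> N i" and NY: "N i \<subseteq> insert x Y" using i by (auto simp: J_def)
      have finN: "finite (N i)" using finite_subset[OF NY] finY by simp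
      have "card (B i) \<le> card (Bad i \<times> good (Y - N i))"
      proof (rule card_inj_on_le[where f = "\<lambda>c. (restrict c (N i), restrict c (Y - N i))"])
        show "inj_on (\<lambda>c. (restrict c (N i), restrict c (Y - N i))) (B i)"
        proof (rule inj_onI)
          fix c c' assume *: "c \<in> B i" "c' \<in> B i"
            "(restrict c (N i), restrict c (Y - N i)) = (restrict c' (N i), restrict c' (Y - N i))"
          show "c = c'"
          proof
            fix u
            consider "u \<in> N i" | "u \<in> Y - N i" | "u \<notin> insert x Y" using xN by auto
            then show "c u = c' u"
            proof cases
              case 1 then show ?thesis using *(3) by (metis Pair_inject restrict_apply')
            next
              case 2 then show ?thesis using *(3) by (metis Pair_inject restrict_apply')
            next
              case 3 then show ?thesis using *(1,2) by (auto simp: B_def ext_def PiE_iff extensional_def)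
            qed
          qed
        qed
        show "(\<lambda>c. (restrict c (N i), restrict c (Y - N i))) ` B i \<subseteq> Bad i \<times> good (Y - N i)"
        proof clarsimp
          fix c assume "c \<in> B i"
          then have 1: "restrict c Y \<in> good Y" "restrict c (N i) \<in> Bad i" by (auto simp: B_def ext_def)
          have "restrict (restrict c Y) (Y - N i) = restrict c (Y - N i)" by (auto simp: restrict_def fun_eq_iff)
          then show "restrict c (N i) \<in> Bad i \<and> restrict c (Y - N i) \<in> good (Y - N i)"
            using good_restrict[OF 1(1), of "Y - N i"] 1(2) by auto
        qed
        show "finite (Bad i \<times> good (Y - N i))"
          using fin_good[of "Y - N i"] Y finite_subset[OF Bad[OF iI]] finite_PiE[OF finN, of "\<lambda>_. C"] finC by auto
      qed
      then have "real (card (B i)) \<le> real (card (Bad i)) * real (card (good (Y - N i)))"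
        by (simp add: card_cartesian_product flip: of_nat_mult)
      also have "\<dots> \<le> (P i * Q ^ card (N i)) * real (card (good (Y - N i)))"
        using card_Bad[OF iI] by (intro mult_right_mono) (auto simp: Q_def)
      also have "\<dots> = P i * (Q / (1 - \<delta>) ^ (card (N i) - 1)) * (q ^ (card (N i) - 1) * real (card (good (Y - N i))))"
      proof -
        have "card (N i) > 0" using finN N(2)[OF iI] by (simp add: card_gt_0_iff)
        then have "Q ^ card (N i) = Q * Q ^ (card (N i) - 1)" by (simp add: power_eq_if)
        then show ?thesis using \<delta> by (simp add: q_def power_mult_distrib)
      qed
      also have "\<dots> \<le> P i * (Q / (1 - \<delta>) ^ card (N i)) * real (card (good Y))"
      proof (intro mult_mono)
        \<comment> \<open>\<open>x\<close> is not in \<open>Y\<close>, so the induction hypothesis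
          gives only \<open>card (N i) - 1\<close> factors \<open>q\<close>. Raising the exponent of
          \<open>1 - \<delta>\<close> by one weakens the bound and brings it into the form of the
          local hypothesis.\<close>
        have "(Y - (Y - N i)) = N i - {x}" using NY x xN by auto
        then have "card (Y - (Y - N i)) = card (N i) - 1" using xN finN by simp
        then show "q ^ (card (N i) - 1) * real (card (good (Y - N i))) \<le> real (card (good Y))"
          using IH[of "Y - N i"] by auto
        have "(1 - \<delta>) ^ card (N i) \<le> (1 - \<delta>) ^ (card (N i) - 1)"
          using \<delta> by (intro power_decreasing) auto
        then show "Q / (1 - \<delta>) ^ (card (N i) - 1) \<le> Q / (1 - \<delta>) ^ card (N i)"
          using Q0 \<delta> by (intro divide_left_mono) auto
      qed (use P0[OF iI] Q0 q0 \<delta> in auto)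
      finally show ?thesis by (simp add: field_simps)
    qed
    ultimately have "real (card ext) \<le> real (card (good (insert x Y)))
        + (\<Sum>i\<in>J. Q * real (card (good Y)) * (P i / (1 - \<delta>) ^ card (N i)))"
      by (meson add_left_mono order_trans sum_mono)
    also have "(\<Sum>i\<in>J. Q * real (card (good Y)) * (P i / (1 - \<delta>) ^ card (N i)))
        = Q * real (card (good Y)) * (\<Sum>i\<in>J. (P i / (1 - \<delta>) ^ card (N i)))"
      by (simp add: sum_distrib_left)
    also have "\<dots> \<le> Q * real (card (good Y)) * \<delta>"
    proof (intro mult_left_mono)
      have "(\<Sum>i\<in>J. (P i / (1 - \<delta>) ^ card (N i))) \<le> (\<Sum>i\<in>{i\<in>I. x \<in> N i}. P i / (1 - \<delta>) ^ card (N i))"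
        using P0 \<delta> finI by (intro sum_mono2) (auto simp: J_def)
      then show "(\<Sum>i\<in>J. (P i / (1 - \<delta>) ^ card (N i))) \<le> \<delta>" using local[OF x(1)] by linarith
    qed (use Q0 in auto)
    finally show ?thesis using ext_ge by (simp add: q_def algebra_simps)
  qed
  \<comment> \<open>Stated for all subsets \<open>Z\<close> and not only for \<open>Y\<close> minus
    a point, because the step compares \<open>good Y\<close> with
    \<open>good (Y - N i)\<close>.\<close>
  have main: "\<forall>Z\<subseteq>Y. real (card (good Y)) \<ge> q ^ card (Y - Z) * real (card (good Z))" if "Y \<subseteq> X" for Y
    using finite_subset[OF that finX] that
  proof (induction Y rule: finite_psubset_induct)
    case (psubset Y)
    show ?case
    proof (intro allI impI)
      fix Z assume Z: "Z \<subseteq> Y"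
      show "real (card (good Y)) \<ge> q ^ card (Y - Z) * real (card (good Z))"
      proof (cases "Z = Y")
        case False
        then obtain x where x: "x \<in> Y" "x \<notin> Z" using Z by auto
        have sub: "Y - {x} \<subset> Y" using x by auto
        have IH: "\<forall>Z\<subseteq>Y - {x}. real (card (good (Y - {x}))) \<ge> q ^ card (Y - {x} - Z) * real (card (good Z))"
          using psubset.IH[OF sub] psubset.prems by auto
        have "q * real (card (good (Y - {x}))) \<le> real (card (good (insert x (Y - {x}))))"
          using IH psubset.prems x by (intro step) auto
        then have "q * real (card (good (Y - {x}))) \<le> real (card (good Y))" using x by (simp add: insert_absorb)
        moreover have "q ^ card (Y - {x} - Z) * real (card (good Z)) \<le> real (card (good (Y - {x})))"
          using IH Z x by blast
        moreover have "card (Y - Z) = Suc (card (Y - {x} - Z))"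
        proof -
          have "Y - Z = insert x (Y - {x} - Z)" using x by auto
          then show ?thesis using psubset.hyps by simp
        qed
        moreover have "q * (q ^ card (Y - {x} - Z) * real (card (good Z))) \<le> q * real (card (good (Y - {x})))"
          using calculation(2) q0 by (intro mult_left_mono) auto
        ultimately show ?thesis by (simp add: mult.assoc)
      qed simp
    qed
  qed
  have "good {} = {\<lambda>_. undefined}" using N(2) by (auto simp: good_def)
  then have "real (card (good X)) \<ge> q ^ card (X - {})" using main[of X] by (metis card.empty One_nat_def card.insert finite.emptyI empty_iff empty_subsetI mult.right_neutral of_nat_1 order_refl)
  then have "card (good X) > 0" using q0 by (metis of_nat_0_less_iff order_less_le_trans zero_less_power)
  then obtain c where "c \<in> good X" by (metis card_gt_0_iff ex_in_conv)
  then show ?thesis using N(1) unfolding good_def by blast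
qed

section \<open>Exponential moments and concentration of colour counts\<close>

lemma exp_le_quadratic: "exp y \<le> 1 + y + y\<^sup>2" if "\<bar>y\<bar> \<le> 1" for y :: real
proof (cases "y \<ge> 0")
  case True
  then show ?thesis using exp_bound that by auto
next
  case False
  \<comment> \<open>For negative \<open>y\<close> the bound is inverted: the quadratic Taylor
    polynomial below \<open>exp (- y)\<close> has product at least 1 with
    \<open>1 + y + y\<^sup>2\<close>.\<close>
  have "exp (- y) \<ge> 1 - y + y\<^sup>2 / 2" using exp_lower_Taylor_quadratic[of "-y"] False by simp
  moreover have "(1 - y + y\<^sup>2 / 2) * (1 + y + y\<^sup>2) \<ge> 1"
  proof -
    have "(1 - y + y\<^sup>2 / 2) * (1 + y + y\<^sup>2) = 1 + y\<^sup>2 / 2 * ((1 - y) + y\<^sup>2)" by (simp add: field_simps power2_eq_square)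
    moreover have "y\<^sup>2 / 2 * ((1 - y) + y\<^sup>2) \<ge> 0" using False by simp
    ultimately show ?thesis by linarith
  qed
  moreover have pos: "1 + y + y\<^sup>2 > 0" using that False by (simp add: add_nonneg_pos)
  ultimately have "1 \<le> exp (- y) * (1 + y + y\<^sup>2)"
    using mult_right_mono[of "1 - y + y\<^sup>2 / 2" "exp (- y)" "1 + y + y\<^sup>2"] by linarith
  then show ?thesis by (simp add: exp_minus field_simps)
qed

text \<open>A Chernoff bound by counting: the sum of the exponential weights over all colourings
  factorises over \<open>N\<close>. The parameter \<open>s = t / (2 * M)\<close> minimises
  \<open>s\<^sup>2 * M - s * t\<close>, which is the exponent obtained, and
  \<open>t \<le> 2 * M\<close> keeps \<open>s \<le> 1\<close>, the range of the quadratic bound.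
  With \<open>M\<close> in place of \<open>card N\<close> the estimate serves neighbourhoods of
  varying size.\<close>

lemma card_coloring_deviation_le:
  fixes M t :: real
  assumes fin: "finite N" "finite C" "C \<noteq> {}" and G: "G \<subseteq> C" and M: "real (card N) \<le> M" "M > 0"
    and t: "0 \<le> t" "t \<le> 2 * M"
  shows "real (card {c \<in> PiE N (\<lambda>_. C). real (card {x\<in>N. c x \<in> G}) > real (card G) / real (card C) * real (card N) + t})
      \<le> exp (- t\<^sup>2 / (4 * M)) * real (card C) ^ card N"
proof -
  define s where "s = t / (2 * M)"
  define p where "p = real (card G) / real (card C)"
  define y where "y \<gamma> = s * ((if \<gamma> \<in> G then 1 else 0) - p)" for \<gamma>
  have Q0: "real (card C) > 0" using fin by (simp add: card_gt_0_iff)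
  have s: "0 \<le> s" "s \<le> 1" using t M by (auto simp: s_def)
  have p: "0 \<le> p" "p \<le> 1" using card_mono[OF fin(2) G] Q0 by (auto simp: p_def)
  have y1: "\<bar>y \<gamma>\<bar> \<le> s" for \<gamma>
  proof -
    have "\<bar>(if \<gamma> \<in> G then 1 else 0) - p\<bar> \<le> 1" using p by auto
    then show ?thesis using s by (simp add: y_def abs_mult mult_left_le)
  qed
  have sumy: "sum y C = 0"
  proof -
    have "(\<Sum>\<gamma>\<in>C. (if \<gamma> \<in> G then 1 else 0::real)) = real (card G)"
      using G fin by (simp add: sum.If_cases Int_absorb1 Int_commute)
    then show ?thesis using Q0 by (simp add: y_def sum_subtractf p_def flip: sum_distrib_left)
  qed
  define bad where "bad = {c \<in> PiE N (\<lambda>_. C). real (card {x\<in>N. c x \<in> G}) > p * real (card N) + t}"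
  have mgf: "(\<Sum>\<gamma>\<in>C. exp (y \<gamma>)) \<le> real (card C) * exp (s\<^sup>2)"
  proof -
    have "(\<Sum>\<gamma>\<in>C. exp (y \<gamma>)) \<le> (\<Sum>\<gamma>\<in>C. 1 + y \<gamma> + s\<^sup>2)"
    proof (intro sum_mono)
      fix \<gamma>
      have "(y \<gamma>)\<^sup>2 \<le> s\<^sup>2" using y1[of \<gamma>] s by (metis abs_le_square_iff abs_of_nonneg)
      moreover have "exp (y \<gamma>) \<le> 1 + y \<gamma> + (y \<gamma>)\<^sup>2" using y1[of \<gamma>] s by (intro exp_le_quadratic) linarith
      ultimately show "exp (y \<gamma>) \<le> 1 + y \<gamma> + s\<^sup>2" by linarith
    qed
    also have "\<dots> = real (card C) * (1 + s\<^sup>2)" by (simp add: sum.distrib sumy algebra_simps)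
    also have "\<dots> \<le> real (card C) * exp (s\<^sup>2)" using Q0 by (intro mult_left_mono) auto
    finally show ?thesis .
  qed
  have w: "(\<Prod>x\<in>N. exp (y (c x))) = exp (s * (real (card {x\<in>N. c x \<in> G}) - p * real (card N)))" for c
  proof -
    have "(\<Sum>x\<in>N. (if c x \<in> G then 1 else 0::real)) = real (card {x\<in>N. c x \<in> G})"
      using fin by (simp add: sum.If_cases Int_def)
    then show ?thesis using fin by (simp add: y_def sum_subtractf flip: exp_sum sum_distrib_left)
  qed
  have finP: "finite (PiE N (\<lambda>_. C))" using fin by (intro finite_PiE)
  have "real (card bad) * exp (s * t) = (\<Sum>c\<in>bad. exp (s * t))" by simp
  also have "\<dots> \<le> (\<Sum>c\<in>bad. \<Prod>x\<in>N. exp (y (c x)))"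
    unfolding w using s by (intro sum_mono) (auto simp: bad_def mult_left_mono)
  also have "\<dots> \<le> (\<Sum>c\<in>PiE N (\<lambda>_. C). \<Prod>x\<in>N. exp (y (c x)))"
    using finP by (intro sum_mono2) (auto simp: bad_def prod_nonneg)
  also have "\<dots> = (\<Prod>x\<in>N. \<Sum>\<gamma>\<in>C. exp (y \<gamma>))"
    using fin by (subst prod_sum_PiE) auto
  also have "\<dots> \<le> (real (card C) * exp (s\<^sup>2)) ^ card N"
    using mgf by (simp add: power_mono sum_nonneg)
  also have "\<dots> = real (card C) ^ card N * exp (s\<^sup>2 * real (card N))"
    by (simp add: power_mult_distrib mult.commute flip: exp_of_nat_mult)
  also have "\<dots> \<le> real (card C) ^ card N * exp (s\<^sup>2 * M)"
    using M by (intro mult_left_mono) (auto intro: mult_left_mono)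
  finally have "real (card bad) \<le> real (card C) ^ card N * exp (s\<^sup>2 * M) * exp (- (s * t))"
    by (simp add: exp_minus field_simps)
  also have "\<dots> = real (card C) ^ card N * exp (s\<^sup>2 * M - s * t)"
    by (simp add: exp_diff exp_minus field_simps)
  also have "s\<^sup>2 * M - s * t = - t\<^sup>2 / (4 * M)"
    using M by (simp add: s_def power2_eq_square field_simps)
  finally show ?thesis unfolding bad_def p_def by (simp add: mult.commute)
qed

text \<open>Two kinds of constraints enter one application of the counting argument: upper
  deviations on the sets \<open>N i\<close>, and distinct colours on the edges in \<open>R\<close>,
  where a fraction \<open>1 / card C\<close> of the patterns is bad. Lower deviations can be had by
  adding the complement of \<open>G i\<close> as a further constraint.\<close>

lemma exists_balanced_proper_coloring:
  fixes X :: "'a set" and C :: "'b set" and I :: "'i set" and \<delta> p :: real and t M :: "'i \<Rightarrow> real"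
  assumes finX: "finite X" and finC: "finite C" "C \<noteq> {}" and finI: "finite I"
    and NG: "\<And>i. i \<in> I \<Longrightarrow> N i \<subseteq> X \<and> G i \<subseteq> C"
    and M: "\<And>i. i \<in> I \<Longrightarrow> real (card (N i)) \<le> M i \<and> 0 < M i \<and> 0 \<le> t i \<and> t i \<le> 2 * M i"
    and p: "\<And>i. i \<in> I \<Longrightarrow> exp (- (t i)\<^sup>2 / (4 * M i)) / (1 - \<delta>) ^ card (N i) \<le> p"
    and K: "\<And>x. x \<in> X \<Longrightarrow> card {i\<in>I. x \<in> N i} \<le> K"
    and R: "\<And>e. e \<in> R \<Longrightarrow> e \<subseteq> X \<and> card e = 2"
    and L: "\<And>x. x \<in> X \<Longrightarrow> card {e\<in>R. x \<in> e} \<le> L"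
    and \<delta>: "0 \<le> \<delta>" "\<delta> < 1"
    and sum_le: "real K * p + real L / (real (card C) * (1 - \<delta>)\<^sup>2) \<le> \<delta>" and p0: "p \<ge> 0"
  shows "\<exists>c\<in>PiE X (\<lambda>_. C).
      (\<forall>i\<in>I. real (card {x\<in>N i. c x \<in> G i}) \<le> real (card (G i)) / real (card C) * real (card (N i)) + t i) \<and>
      (\<forall>x y. {x, y} \<in> R \<longrightarrow> c x \<noteq> c y)"
proof -
  \<comment> \<open>The counting argument asks for non-empty supports; a constraint on an empty set
    holds trivially.\<close>
  define I' where "I' = {i\<in>I. N i \<noteq> {}}"
  define J where "J = Inl ` I' \<union> Inr ` R"
  define N' where "N' = case_sum N (\<lambda>e. e)"
  define Bad where "Bad = case_sum
    (\<lambda>i. {c \<in> PiE (N i) (\<lambda>_. C). real (card {x\<in>N i. c x \<in> G i}) > real (card (G i)) / real (card C) * real (card (N i)) + t i})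
    (\<lambda>e. (\<lambda>\<gamma>. restrict (\<lambda>_. \<gamma>) e) ` C)"
  define P where "P = case_sum (\<lambda>i. exp (- (t i)\<^sup>2 / (4 * M i))) (\<lambda>_::'a set. 1 / real (card C))"
  have Q0: "real (card C) > 0" using finC by (simp add: card_gt_0_iff)
  have finR: "finite R" using R finX by (meson Pow_iff finite_Pow_iff finite_subset subsetI)
  have finI': "finite I'" using finI by (simp add: I'_def)
  have "\<exists>c\<in>PiE X (\<lambda>_. C). \<forall>i\<in>J. restrict c (N' i) \<notin> Bad i"
  proof (rule exists_good_coloring[OF finX finC, where P = P and \<delta> = \<delta>])
    show "finite J" using finI' finR by (simp add: J_def)
    show "N' j \<subseteq> X" "N' j \<noteq> {}" if "j \<in> J" for j
      using that NG R[of "{}"] R[THEN conjunct1] by (auto simp: J_def N'_def I'_def) blast+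
    show "Bad j \<subseteq> PiE (N' j) (\<lambda>_. C)" if "j \<in> J" for j
      using that by (auto simp: J_def N'_def Bad_def)
    show "real (card (Bad j)) \<le> P j * real (card C) ^ card (N' j)" if j: "j \<in> J" for j
    proof -
      consider i where "j = Inl i" "i \<in> I" | e where "j = Inr e" "e \<in> R" using j by (auto simp: J_def I'_def)
      then show ?thesis
      proof cases
        case 1
        have "finite (N i)" using NG[OF 1(2)] finX finite_subset by blast
        then show ?thesis
          using card_coloring_deviation_le[of "N i" C "G i" "M i" "t i"] finC NG[OF 1(2)] M[OF 1(2)] 1
          by (simp add: Bad_def P_def N'_def)
      next
        case 2
        have "card (Bad j) \<le> card C" using 2 finC by (simp add: Bad_def card_image_le)
        moreover have "P j * real (card C) ^ card (N' j) = real (card C)"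
          using 2 R[OF 2(2)] Q0 by (simp add: P_def N'_def power2_eq_square)
        ultimately show ?thesis by simp
      qed
    qed
    show "(\<Sum>j\<in>{j\<in>J. x \<in> N' j}. P j / (1 - \<delta>) ^ card (N' j)) \<le> \<delta>" if x: "x \<in> X" for x
    proof -
      have eq: "{j\<in>J. x \<in> N' j} = Inl ` {i\<in>I'. x \<in> N i} \<union> Inr ` {e\<in>R. x \<in> e}"
        by (auto simp: J_def N'_def)
      have "(\<Sum>j\<in>{j\<in>J. x \<in> N' j}. P j / (1 - \<delta>) ^ card (N' j))
          = (\<Sum>i\<in>{i\<in>I'. x \<in> N i}. exp (- (t i)\<^sup>2 / (4 * M i)) / (1 - \<delta>) ^ card (N i))
          + (\<Sum>e\<in>{e\<in>R. x \<in> e}. (1 / real (card C)) / (1 - \<delta>) ^ card e)"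
        unfolding eq using finI' finR
        by (subst sum.union_disjoint) (auto simp: sum.reindex P_def N'_def)
      also have "\<dots> \<le> (\<Sum>i\<in>{i\<in>I'. x \<in> N i}. p) + (\<Sum>e\<in>{e\<in>R. x \<in> e}. 1 / (real (card C) * (1 - \<delta>)\<^sup>2))"
        using p R by (intro add_mono sum_mono) (auto simp: I'_def)
      also have "\<dots> \<le> real K * p + real L / (real (card C) * (1 - \<delta>)\<^sup>2)"
      proof (intro add_mono)
        have "card {i\<in>I'. x \<in> N i} \<le> card {i\<in>I. x \<in> N i}"
          using finI by (intro card_mono) (auto simp: I'_def)
        then have "real (card {i\<in>I'. x \<in> N i}) \<le> real K" using K[OF x] by linarith
        then show "(\<Sum>i\<in>{i\<in>I'. x \<in> N i}. p) \<le> real K * p"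
          using p0 by (simp add: mult_right_mono)
        have "real (card {e\<in>R. x \<in> e}) \<le> real L" using L[OF x] by simp
        then show "(\<Sum>e\<in>{e\<in>R. x \<in> e}. 1 / (real (card C) * (1 - \<delta>)\<^sup>2)) \<le> real L / (real (card C) * (1 - \<delta>)\<^sup>2)"
          using Q0 \<delta> by (simp add: divide_right_mono)
      qed
      finally show ?thesis using sum_le by linarith
    qed
  qed (use \<delta> in auto)
  then obtain c where c: "c \<in> PiE X (\<lambda>_. C)" and good: "\<And>j. j \<in> J \<Longrightarrow> restrict c (N' j) \<notin> Bad j" by blast
  have "real (card {x\<in>N i. c x \<in> G i}) \<le> real (card (G i)) / real (card C) * real (card (N i)) + t i" if i: "i \<in> I" for i
  proof (cases "N i = {}")
    case True
    then show ?thesis using M[OF i] by simp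
  next
    case False
    have "restrict c (N i) \<in> PiE (N i) (\<lambda>_. C)" using c NG[OF i] by (auto simp: PiE_iff)
    moreover have "restrict c (N i) \<notin> Bad (Inl i)"
      using good[of "Inl i"] i False by (simp add: J_def I'_def N'_def)
    moreover have "{x\<in>N i. restrict c (N i) x \<in> G i} = {x\<in>N i. c x \<in> G i}" by auto
    ultimately show ?thesis by (simp add: Bad_def)
  qed
  moreover have "c x \<noteq> c y" if e: "{x, y} \<in> R" for x y
  proof
    assume "c x = c y"
    then have "restrict c {x, y} = restrict (\<lambda>_. c x) {x, y}" by (auto simp: restrict_def fun_eq_iff)
    moreover have "c x \<in> C" using c R[OF e] by (auto simp: PiE_iff)
    ultimately have "restrict c {x, y} \<in> Bad (Inr {x, y})" by (auto simp: Bad_def)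
    then show False using good[of "Inr {x, y}"] e by (simp add: J_def N'_def)
  qed
  ultimately show ?thesis using c by blast
qed

section \<open>Degrees in simple graphs\<close>

lemma simple_graph_subset: "simple_graph n E \<Longrightarrow> F \<subseteq> E \<Longrightarrow> simple_graph n F"
  unfolding simple_graph_def by blast

lemma simple_graph_finite: "simple_graph n E \<Longrightarrow> finite E"
  by (rule finite_subset[of _ "Pow {1..n}"]) (auto simp: simple_graph_def)

lemma simple_graph_edge:
  assumes "simple_graph n E" "e \<in> E"
  shows "e \<subseteq> {1..n}" "card e = 2" "finite e" "e \<noteq> {}"
  using assms unfolding simple_graph_def by fastforce+

lemma degree_eq_card_neighbours:
  assumes "simple_graph n F"
  shows "degree F v = card {u. {u, v} \<in> F}"
proof -
  have "bij_betw (\<lambda>u. {u, v}) {u. {u, v} \<in> F} {e\<in>F. v \<in> e}"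
  proof (rule bij_betw_imageI)
    show "inj_on (\<lambda>u. {u, v}) {u. {u, v} \<in> F}" by (auto simp: inj_on_def doubleton_eq_iff)
    show "(\<lambda>u. {u, v}) ` {u. {u, v} \<in> F} = {e\<in>F. v \<in> e}"
    proof
      show "{e\<in>F. v \<in> e} \<subseteq> (\<lambda>u. {u, v}) ` {u. {u, v} \<in> F}"
      proof
        fix e assume e: "e \<in> {e\<in>F. v \<in> e}"
        then obtain u w where "e = {u, w}" using assms unfolding simple_graph_def by blast
        then have "e = {u, v} \<or> e = {w, v}" using e by auto
        then show "e \<in> (\<lambda>u. {u, v}) ` {u. {u, v} \<in> F}" using e by blast
      qed
    qed auto
  qed
  then show ?thesis by (simp add: degree_def bij_betw_same_card)
qed

lemma degree_Un_disjoint: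
  assumes "finite P" "finite F" "P \<inter> F = {}"
  shows "degree (P \<union> F) v = degree P v + degree F v"
proof -
  have "{e \<in> P \<union> F. v \<in> e} = {e\<in>P. v \<in> e} \<union> {e\<in>F. v \<in> e}" by auto
  then show ?thesis unfolding degree_def using assms by (simp add: card_Un_disjoint disjoint_iff)
qed

lemma degree_mono: "finite F \<Longrightarrow> P \<subseteq> F \<Longrightarrow> degree P v \<le> degree F v"
  unfolding degree_def by (intro card_mono) auto

lemma degree_Un_le: "degree (P \<union> F) v \<le> degree P v + degree F v"
proof -
  have "{e \<in> P \<union> F. v \<in> e} = {e\<in>P. v \<in> e} \<union> {e\<in>F. v \<in> e}" by auto
  then show ?thesis unfolding degree_def by (simp add: card_Un_le)
qed

lemma degree_UN_le: "finite I \<Longrightarrow> degree (\<Union>i\<in>I. H i) v \<le> (\<Sum>i\<in>I. degree (H i) v)"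
proof -
  assume "finite I"
  have "{e \<in> (\<Union>i\<in>I. H i). v \<in> e} = (\<Union>i\<in>I. {e \<in> H i. v \<in> e})" by auto
  then show ?thesis unfolding degree_def using card_UN_le[OF \<open>finite I\<close>, of "\<lambda>i. {e \<in> H i. v \<in> e}"] by simp
qed

section \<open>Spectral gap and mixing\<close>

text \<open>Tychonoff. Vectors are functions on all of \<open>nat\<close>, so compactness of the
  unit sphere needs the coordinates from \<open>n\<close> on to be confined to a point, inside such
  a box.\<close>

lemma compact_box_fun:
  fixes S :: "'a \<Rightarrow> real set"
  assumes "\<And>i. compact (S i)"
  shows "compact {x. \<forall>i. x i \<in> S i}"
proof -
  have "compactin (product_topology (\<lambda>i. euclidean) UNIV) (PiE UNIV S)"
    using assms by (simp add: compactin_PiE)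
  moreover have "PiE UNIV S = {x. \<forall>i. x i \<in> S i}" by (auto simp: PiE_iff)
  ultimately show ?thesis by (simp add: euclidean_product_topology)
qed

section \<open>Quadratic forms on zero-sum vectors\<close>

definition bilin :: "nat \<Rightarrow> (nat \<Rightarrow> nat \<Rightarrow> real) \<Rightarrow> (nat \<Rightarrow> real) \<Rightarrow> (nat \<Rightarrow> real) \<Rightarrow> real" where
  "bilin n a x z = (\<Sum>i<n. \<Sum>j<n. a i j * x i * z j)"

lemma bilin_add_left: "bilin n a (\<lambda>i. x i + y i) z = bilin n a x z + bilin n a y z"
  by (simp add: bilin_def algebra_simps sum.distrib)

lemma bilin_add_right: "bilin n a z (\<lambda>i. x i + y i) = bilin n a z x + bilin n a z y"
  by (simp add: bilin_def algebra_simps sum.distrib)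

lemma bilin_scale_left: "bilin n a (\<lambda>i. c * x i) z = c * bilin n a x z"
  by (simp add: bilin_def sum_distrib_left algebra_simps)

lemma bilin_scale_right: "bilin n a z (\<lambda>i. c * x i) = c * bilin n a z x"
  by (simp add: bilin_def sum_distrib_left algebra_simps)

lemma bilin_uminus: "bilin n (\<lambda>i j. - a i j) x z = - bilin n a x z"
  by (simp add: bilin_def sum_negf)

lemma bilin_sym:
  assumes "\<And>i j. i < n \<Longrightarrow> j < n \<Longrightarrow> a i j = a j i"
  shows "bilin n a x z = bilin n a z x"
proof -
  have "bilin n a x z = (\<Sum>j<n. \<Sum>i<n. a i j * x i * z j)" unfolding bilin_def by (rule sum.swap)
  also have "\<dots> = bilin n a z x" unfolding bilin_def using assms by (intro sum.cong refl) (simp add: algebra_simps)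
  finally show ?thesis .
qed

lemma bilin_eq_row: "bilin n a x z = (\<Sum>i<n. x i * (\<Sum>j<n. a i j * z j))"
  by (simp add: bilin_def sum_distrib_left algebra_simps)

text \<open>The first-order condition at a maximum: at
  \<open>t = \<beta> / (\<bar>\<gamma>\<bar> + 1)\<close> the linear term outweighs the quadratic
  one.\<close>

lemma linear_term_zero:
  fixes \<beta> \<gamma> :: real
  assumes "\<And>t. 2 * t * \<beta> + t\<^sup>2 * \<gamma> \<le> 0"
  shows "\<beta> = 0"
proof (rule ccontr)
  assume "\<beta> \<noteq> 0"
  define g where "g = \<bar>\<gamma>\<bar> + 1"
  have g: "g > 0" "2 * g + \<gamma> > 0" by (auto simp: g_def)
  have "2 * (\<beta> / g) * \<beta> + (\<beta> / g)\<^sup>2 * \<gamma> = \<beta>\<^sup>2 * (2 * g + \<gamma>) / g\<^sup>2"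
    using g by (simp add: field_simps power2_eq_square)
  moreover have "\<dots> > 0" using g \<open>\<beta> \<noteq> 0\<close> by simp
  ultimately show False using assms[of "\<beta> / g"] by simp
qed

text \<open>
The maximiser of the quadratic form on the unit sphere orthogonal to the constant vector is an eigenvector.
\<close>

lemma rayleigh_maximizer:
  assumes n: "n \<ge> 2" and sym: "\<And>i j. i < n \<Longrightarrow> j < n \<Longrightarrow> a i j = a j i"
    and row: "\<And>i. i < n \<Longrightarrow> (\<Sum>j<n. a i j) = d"
  shows "\<exists>\<mu> y. (\<forall>x. (\<Sum>i<n. x i) = 0 \<longrightarrow> bilin n a x x \<le> \<mu> * (\<Sum>i<n. (x i)\<^sup>2)) \<and> (\<Sum>i<n. y i) = 0
    \<and> (\<exists>i<n. y i \<noteq> 0) \<and> (\<forall>i<n. (\<Sum>j<n. a i j * y j) = \<mu> * y i)"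
proof -
  define K where "K = {x :: nat \<Rightarrow> real. \<forall>i. x i \<in> (if i < n then {-1..1} else {0})}
     \<inter> {x. (\<Sum>i<n. x i) = 0 \<and> (\<Sum>i<n. (x i)\<^sup>2) = 1}"
  have cont: "continuous_on UNIV (\<lambda>x :: nat \<Rightarrow> real. x i)" for i by simp
  have "closed {x :: nat \<Rightarrow> real. (\<Sum>i<n. x i) = 0 \<and> (\<Sum>i<n. (x i)\<^sup>2) = 1}"
    by (intro closed_Collect_conj closed_Collect_eq continuous_intros cont)
  then have "compact K" unfolding K_def
    by (intro compact_Int_closed compact_box_fun) auto
  moreover have "K \<noteq> {}"
  proof -
    define s where "s = 1 / sqrt (2::real)"
    have s2: "s\<^sup>2 = 1 / 2" "0 \<le> s" by (simp_all add: s_def power_divide)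
    then have s1: "s \<le> 1" by (intro power2_le_imp_le[of s 1]) simp_all
    define x where "x = (\<lambda>i::nat. if i = 0 then s else if i = 1 then - s else 0)"
    have "(\<Sum>i<n. x i) = (\<Sum>i\<in>{0,1}. x i)"
      by (rule sum.mono_neutral_right) (use n in \<open>auto simp: x_def\<close>)
    moreover have "(\<Sum>i<n. (x i)\<^sup>2) = (\<Sum>i\<in>{0,1}. (x i)\<^sup>2)"
      by (rule sum.mono_neutral_right) (use n in \<open>auto simp: x_def\<close>)
    moreover have "(\<Sum>i\<in>{0,1}. x i) = 0" "(\<Sum>i\<in>{0,1}. (x i)\<^sup>2) = 1" using s2 by (simp_all add: x_def)
    moreover have "x i \<in> (if i < n then {-1..1} else {0})" for i using s1 s2 n by (auto simp: x_def)
    ultimately have "x \<in> K" by (simp add: K_def)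
    then show ?thesis by blast
  qed
  moreover have "continuous_on K (\<lambda>x. bilin n a x x)"
    unfolding bilin_def by (intro continuous_intros continuous_on_subset[OF cont]) auto
  ultimately obtain y where y: "y \<in> K" "\<And>x. x \<in> K \<Longrightarrow> bilin n a x x \<le> bilin n a y y"
    using continuous_attains_sup[of K "\<lambda>x. bilin n a x x"] by blast
  define \<mu> where "\<mu> = bilin n a y y"
  have y0: "(\<Sum>i<n. y i) = 0" and y1: "(\<Sum>i<n. (y i)\<^sup>2) = 1" using y(1) by (auto simp: K_def)
  have ub: "bilin n a x x \<le> \<mu> * (\<Sum>i<n. (x i)\<^sup>2)" if x0: "(\<Sum>i<n. x i) = 0" for x
  proof (cases "(\<Sum>i<n. (x i)\<^sup>2) = 0")
    case True
    then have "x i = 0" if "i < n" for i using that by (simp add: sum_nonneg_eq_0_iff)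
    then show ?thesis using True by (simp add: bilin_def)
  next
    case False
    define r where "r = sqrt (\<Sum>i<n. (x i)\<^sup>2)"
    have r: "r > 0" "r\<^sup>2 = (\<Sum>i<n. (x i)\<^sup>2)" using False by (auto simp: r_def sum_nonneg order_less_le)
    define w where "w = (\<lambda>i. if i < n then (1 / r) * x i else 0)"
    have "(\<Sum>i<n. (w i)\<^sup>2) = (\<Sum>i<n. (x i)\<^sup>2) / r\<^sup>2"
      by (simp add: w_def power_mult_distrib power_divide flip: sum_divide_distrib)
    then have ssq: "(\<Sum>i<n. (w i)\<^sup>2) = 1" using r(2) False by simp
    have "\<bar>w i\<bar> \<le> 1" if "i < n" for i
    proof -
      have "(w i)\<^sup>2 \<le> (\<Sum>i<n. (w i)\<^sup>2)" using that by (intro member_le_sum) auto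
      then show ?thesis using ssq by (simp add: abs_square_le_1)
    qed
    then have "w i \<in> (if i < n then {-1..1} else {0})" for i
      by (cases "i < n") (auto simp: abs_le_iff minus_le_iff, simp add: w_def)
    moreover have "(\<Sum>i<n. w i) = 0" using x0 by (simp add: w_def flip: sum_divide_distrib)
    ultimately have "w \<in> K" using ssq by (simp add: K_def)
    then have "bilin n a w w \<le> \<mu>" using y(2) by (simp add: \<mu>_def)
    moreover have "bilin n a w w = bilin n a (\<lambda>i. (1 / r) * x i) (\<lambda>i. (1 / r) * x i)"
      unfolding bilin_def by (intro sum.cong refl) (simp add: w_def)
    moreover have "\<dots> = bilin n a x x / r\<^sup>2"
      unfolding bilin_scale_left bilin_scale_right by (simp add: power2_eq_square)
    ultimately have "bilin n a x x / r\<^sup>2 \<le> \<mu>" by simp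
    then have "bilin n a x x \<le> \<mu> * r\<^sup>2" using r(1) by (simp add: pos_divide_le_eq)
    then show ?thesis using r(2) by simp
  qed
  \<comment> \<open>\<open>w\<close> is the residual of the eigenvalue equation. Stationarity makes
    it orthogonal to all zero-sum vectors; by symmetry and constant row sums \<open>w\<close> is
    zero-sum itself, hence orthogonal to itself.\<close>
  define w where "w = (\<lambda>i. (\<Sum>j<n. a i j * y j) - \<mu> * y i)"
  have orth: "(\<Sum>i<n. z i * w i) = 0" if z0: "(\<Sum>i<n. z i) = 0" for z
  proof (rule linear_term_zero[where \<gamma> = "bilin n a z z - \<mu> * (\<Sum>i<n. (z i)\<^sup>2)"])
    fix t
    have zs: "(\<Sum>i<n. y i + t * z i) = 0" using y0 z0 by (simp add: sum.distrib flip: sum_distrib_left)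
    have eq1: "bilin n a (\<lambda>i. y i + t * z i) (\<lambda>i. y i + t * z i) = \<mu> + 2 * t * bilin n a z y + t\<^sup>2 * bilin n a z z"
      using bilin_sym[OF sym, where x = y and z = z]
      unfolding bilin_add_left bilin_add_right bilin_scale_left bilin_scale_right
      by (simp add: \<mu>_def power2_eq_square algebra_simps)
    have eq2: "(\<Sum>i<n. (y i + t * z i)\<^sup>2) = 1 + 2 * t * (\<Sum>i<n. z i * y i) + t\<^sup>2 * (\<Sum>i<n. (z i)\<^sup>2)"
    proof -
      have "(\<Sum>i<n. (y i + t * z i)\<^sup>2) = (\<Sum>i<n. (y i)\<^sup>2 + (2 * t) * (z i * y i) + t\<^sup>2 * (z i)\<^sup>2)"
        by (intro sum.cong refl) (simp add: power2_eq_square algebra_simps)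
      also have "\<dots> = (\<Sum>i<n. (y i)\<^sup>2) + (2 * t) * (\<Sum>i<n. z i * y i) + t\<^sup>2 * (\<Sum>i<n. (z i)\<^sup>2)"
        by (simp add: sum.distrib sum_distrib_left)
      finally show ?thesis using y1 by simp
    qed
    have eq3: "(\<Sum>i<n. z i * w i) = bilin n a z y - \<mu> * (\<Sum>i<n. z i * y i)"
      by (simp add: w_def bilin_eq_row right_diff_distrib sum_subtractf sum_distrib_left algebra_simps)
    show "2 * t * (\<Sum>i<n. z i * w i) + t\<^sup>2 * (bilin n a z z - \<mu> * (\<Sum>i<n. (z i)\<^sup>2)) \<le> 0"
      unfolding eq3 using ub[OF zs] unfolding eq1 eq2 by (simp add: algebra_simps)
  qed
  have "(\<Sum>i<n. w i) = (\<Sum>i<n. \<Sum>j<n. a i j * y j)"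
    using y0 by (simp add: w_def sum_subtractf flip: sum_distrib_left)
  also have "\<dots> = (\<Sum>j<n. \<Sum>i<n. a i j * y j)" by (rule sum.swap)
  also have "\<dots> = (\<Sum>j<n. (\<Sum>i<n. a j i) * y j)"
    unfolding sum_distrib_right using sym by (intro sum.cong refl) simp
  also have "\<dots> = d * (\<Sum>j<n. y j)" using row by (simp add: sum_distrib_left)
  finally have "(\<Sum>i<n. w i) = 0" using y0 by simp
  then have "(\<Sum>i<n. w i * w i) = 0" by (rule orth)
  then have "w i = 0" if "i < n" for i using that by (simp add: sum_nonneg_eq_0_iff)
  then have "\<forall>i<n. (\<Sum>j<n. a i j * y j) = \<mu> * y i" by (simp add: w_def)
  moreover have "\<exists>i<n. y i \<noteq> 0"
  proof (rule ccontr)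
    assume "\<not> ?thesis"
    then have "(\<Sum>i<n. (y i)\<^sup>2) = 0" by simp
    then show False using y1 by simp
  qed
  ultimately show ?thesis using ub y0 by blast
qed

section \<open>Spectra of matrices with constant row sums\<close>

lemma mat_times_mat: "mat n n f * mat n n g = mat n n (\<lambda>(i, j). \<Sum>k<n. f (i, k) * g (k, j) :: real)"
  by (rule eq_matI) (auto simp: scalar_prod_def atLeast0LessThan)

text \<open>
Conjugation by the basis \<open>1, e\<^sub>1, \<dots>, e\<^sub>m\<close> splits off the eigenvalue \<open>d\<close>, so that an eigenvector
orthogonal to the constants contributes a further root even if its eigenvalue is \<open>d\<close> again.
\<close>

lemma char_poly_constant_row_sum:
  fixes a :: "nat \<Rightarrow> nat \<Rightarrow> real"
  assumes row: "\<And>i. i < Suc m \<Longrightarrow> (\<Sum>j<Suc m. a i j) = d"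
  shows "char_poly (mat (Suc m) (Suc m) (\<lambda>(i, j). a i j))
    = [:- d, 1:] * char_poly (mat m m (\<lambda>(i, j). a (Suc i) (Suc j) - a 0 (Suc j)))"
proof -
  let ?n = "Suc m"
  let ?A = "mat ?n ?n (\<lambda>(i, j). a i j)"
  \<comment> \<open>The columns of \<open>p\<close> are the basis vectors, \<open>q\<close> is the
    inverse of \<open>p\<close>, and \<open>b\<close> is the matrix in the new basis.\<close>
  define p where "p = (\<lambda>(i::nat, j::nat). (if j = 0 then 1 else 0) + (if j = i \<and> i \<noteq> 0 then 1 else (0::real)))"
  define q where "q = (\<lambda>(i::nat, j::nat). (if j = i then 1 else 0) - (if j = 0 \<and> i \<noteq> 0 then 1 else (0::real)))"
  define b where "b = (\<lambda>(i::nat, j::nat). if j = 0 then (if i = 0 then d else 0)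
     else if i = 0 then a 0 j else a i j - a 0 j)"
  have p_sum: "(\<Sum>k<?n. p (i, k) * g k) = g 0 + (if i = 0 then 0 else g i)" if "i < ?n" for i g
    using that by (simp add: p_def distrib_right sum.distrib if_distrib[of "\<lambda>c. c * _"] sum.delta' cong: if_cong)
  have q_sum: "(\<Sum>k<?n. q (i, k) * g k) = g i - (if i = 0 then 0 else g 0)" if "i < ?n" for i g
    using that by (simp add: q_def left_diff_distrib sum_subtractf if_distrib[of "\<lambda>c. c * _"] sum.delta' cong: if_cong)
  have PQ: "mat ?n ?n p * mat ?n ?n q = 1\<^sub>m ?n"
    unfolding mat_times_mat by (rule eq_matI) (auto simp: p_sum simp del: sum.lessThan_Suc, auto simp: q_def)
  have QP: "mat ?n ?n q * mat ?n ?n p = 1\<^sub>m ?n"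
    unfolding mat_times_mat by (rule eq_matI) (auto simp: q_sum simp del: sum.lessThan_Suc, auto simp: p_def)
  have AP: "?A * mat ?n ?n p = mat ?n ?n p * mat ?n ?n b"
  proof -
    have "(\<Sum>k<?n. a i k * p (k, j)) = (if j = 0 then d else a i j)" if "i < ?n" "j < ?n" for i j
    proof (cases "j = 0")
      case True
      have "(\<Sum>k<?n. a i k * p (k, j)) = (\<Sum>k<?n. a i k)"
        using True by (intro sum.cong refl) (auto simp: p_def)
      then show ?thesis using True row[OF that(1)] by simp
    next
      case False
      have "(\<Sum>k<?n. a i k * p (k, j)) = (\<Sum>k<?n. if k = j then a i k else 0)"
        using False by (intro sum.cong refl) (auto simp: p_def)
      also have "\<dots> = a i j" using that by (simp del: sum.lessThan_Suc)
      finally show ?thesis using False by simp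
    qed
    moreover have "(\<Sum>k<?n. p (i, k) * b (k, j)) = (if j = 0 then d else a i j)" if "i < ?n" "j < ?n" for i j
      unfolding p_sum[OF that(1)] by (auto simp: b_def)
    ultimately show ?thesis unfolding mat_times_mat
      by (intro eq_matI) (auto simp del: sum.lessThan_Suc)
  qed
  have "?A = ?A * (mat ?n ?n p * mat ?n ?n q)" unfolding PQ by simp
  also have "\<dots> = ?A * mat ?n ?n p * mat ?n ?n q"
    by (rule assoc_mult_mat[symmetric, of _ ?n ?n _ ?n _ ?n]) auto
  also have "\<dots> = mat ?n ?n p * mat ?n ?n b * mat ?n ?n q" unfolding AP ..
  finally have A_eq: "?A = mat ?n ?n p * mat ?n ?n b * mat ?n ?n q" .
  have "similar_mat ?A (mat ?n ?n b)" by (rule similar_matI[OF _ PQ QP A_eq]) auto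
  then have "char_poly ?A = char_poly (mat ?n ?n b)" by (rule char_poly_similar)
  also have "mat ?n ?n b = four_block_mat (mat 1 1 (\<lambda>_. d)) (mat 1 m (\<lambda>(i, j). a 0 (Suc j))) (0\<^sub>m m 1)
      (mat m m (\<lambda>(i, j). a (Suc i) (Suc j) - a 0 (Suc j)))"
    by (rule eq_matI) (auto simp: b_def)
  also have "char_poly \<dots> = char_poly (mat 1 1 (\<lambda>_. d)) * char_poly (mat m m (\<lambda>(i, j). a (Suc i) (Suc j) - a 0 (Suc j)))"
    by (rule char_poly_four_block_zeros_col) auto
  also have "char_poly (mat 1 1 (\<lambda>_. d)) = [:- d, 1:]"
    by (subst char_poly_upper_triangular[of _ 1]) (auto simp: diag_mat_def upper_triangular_def)
  finally show ?thesis .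
qed

text \<open>In the basis containing the constant vector, the other coordinates of \<open>y\<close>
  are \<open>y (Suc i) - y 0\<close>, and they form an eigenvector of the remaining block. Were they
  all zero, \<open>y\<close> would be constant with sum zero.\<close>

lemma eigenvalues_constant_row_sum:
  fixes a :: "nat \<Rightarrow> nat \<Rightarrow> real"
  assumes row: "\<And>i. i < n \<Longrightarrow> (\<Sum>j<n. a i j) = d"
    and y0: "(\<Sum>i<n. y i) = 0" and y: "\<exists>i<n. y i \<noteq> 0" and ev: "\<And>i. i < n \<Longrightarrow> (\<Sum>j<n. a i j * y j) = \<mu> * y i"
  shows "{#d, \<mu>#} \<subseteq># proots (char_poly (mat n n (\<lambda>(i, j). a i j)))"
proof -
  obtain m where n: "n = Suc m" using y by (cases n) auto
  let ?A' = "mat m m (\<lambda>(i, j). a (Suc i) (Suc j) - a 0 (Suc j))"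
  define v where "v = vec m (\<lambda>i. y (Suc i) - y 0)"
  have "?A' *\<^sub>v v = \<mu> \<cdot>\<^sub>v v"
  proof (rule eq_vecI)
    fix i assume "i < dim_vec (\<mu> \<cdot>\<^sub>v v)"
    then have i: "i < m" by (simp add: v_def)
    have "(?A' *\<^sub>v v) $ i = (\<Sum>j<m. (a (Suc i) (Suc j) - a 0 (Suc j)) * (y (Suc j) - y 0))"
      using i by (simp add: v_def scalar_prod_def atLeast0LessThan)
    also have "\<dots> = (\<Sum>j<n. (a (Suc i) j - a 0 j) * (y j - y 0))"
      unfolding n sum.lessThan_Suc_shift by simp
    also have "\<dots> = ((\<Sum>j<n. a (Suc i) j * y j) - (\<Sum>j<n. a 0 j * y j)) - ((\<Sum>j<n. a (Suc i) j) - (\<Sum>j<n. a 0 j)) * y 0"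
      by (simp add: sum_subtractf sum.distrib algebra_simps sum_distrib_left sum_distrib_right)
    also have "\<dots> = \<mu> * (y (Suc i) - y 0)"
      using ev[of "Suc i"] ev[of 0] row[of "Suc i"] row[of 0] i n by (simp add: algebra_simps)
    finally show "(?A' *\<^sub>v v) $ i = (\<mu> \<cdot>\<^sub>v v) $ i" using i by (simp add: v_def)
  qed (simp add: v_def)
  moreover have "v \<noteq> 0\<^sub>v m"
  proof
    assume "v = 0\<^sub>v m"
    have "y (Suc i) = y 0" if i: "i < m" for i
    proof -
      have "v $ i = 0" using \<open>v = 0\<^sub>v m\<close> i by simp
      then show ?thesis using i by (simp add: v_def)
    qed
    then have const: "y i = y 0" if "i < n" for i using that n by (cases i) auto
    have "(\<Sum>i<n. y i) = (\<Sum>i<n. y 0)" by (rule sum.cong[OF refl], rule const) simp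
    then have "y 0 = 0" using y0 n by simp
    moreover obtain i where "i < n" "y i \<noteq> 0" using y by blast
    ultimately show False using const[OF \<open>i < n\<close>] by simp
  qed
  ultimately have "eigenvalue ?A' \<mu>"
    unfolding eigenvalue_def eigenvector_def by (intro exI[of _ v]) (simp add: v_def)
  then have "poly (char_poly ?A') \<mu> = 0" by (subst (asm) eigenvalue_root_char_poly[of _ m]) auto
  moreover have nz: "char_poly ?A' \<noteq> 0" using degree_monic_char_poly[of ?A' m] by auto
  ultimately have "\<mu> \<in># proots (char_poly ?A')" by simp
  moreover have "proots (char_poly (mat n n (\<lambda>(i, j). a i j))) = {#d#} + proots (char_poly ?A')"
  proof -
    have "char_poly (mat n n (\<lambda>(i, j). a i j)) = [:- d, 1:] * char_poly ?A'"
      unfolding n by (rule char_poly_constant_row_sum) (use row n in blast)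
    moreover have "proots ([:- d, 1:] * char_poly ?A') = proots [:- d, 1:] + proots (char_poly ?A')"
      by (rule proots_mult) (use nz in auto)
    ultimately show ?thesis using proots_linear_factor[of "- d"] by (simp only: minus_minus)
  qed
  ultimately show ?thesis by (simp add: mset_subset_eq_single)
qed


text \<open>Otherwise only the last entry of the ascending list could reach \<open>min x y\<close>,
  although \<open>M\<close> contains two such values with multiplicity.\<close>

lemma second_largest_ge:
  fixes x y :: real
  assumes "{#x, y#} \<subseteq># M"
  shows "min x y \<le> rev (sorted_list_of_multiset M) ! 1"
proof (rule ccontr)
  let ?l = "sorted_list_of_multiset M"
  assume neg: "\<not> ?thesis"
  have len: "length ?l \<ge> 2"
    using size_mset_mono[OF assms] by (metis mset_sorted_list_of_multiset size_mset size_add_mset size_empty numeral_2_eq_2)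
  define k where "k = length ?l - 2"
  have k: "length ?l = Suc (Suc k)" using len by (simp add: k_def)
  have "rev ?l ! 1 = ?l ! k" using k by (simp add: rev_nth)
  then have lt: "?l ! k < min x y" using neg by linarith
  have "z < min x y" if z: "z \<in> set (butlast ?l)" for z
  proof -
    obtain i where i: "i < length (butlast ?l)" "butlast ?l ! i = z" using z by (meson in_set_conv_nth)
    then have "?l ! i \<le> ?l ! k" using k by (intro sorted_nth_mono) auto
    then show ?thesis using lt i by (simp add: nth_butlast)
  qed
  then have "filter (\<lambda>z. min x y \<le> z) (butlast ?l) = []" by (auto simp: filter_empty_conv not_le)
  then have "filter (\<lambda>z. min x y \<le> z) ?l = filter (\<lambda>z. min x y \<le> z) [last ?l]"
    using k by (metis append_butlast_last_id append_self_conv2 filter_append length_0_conv nat.distinct(1))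
  then have "length (filter (\<lambda>z. min x y \<le> z) ?l) \<le> 1" by (simp del: filter.simps add: filter.simps(2) split: if_splits)
  moreover have "size (filter_mset (\<lambda>z. min x y \<le> z) {#x, y#}) \<le> size (filter_mset (\<lambda>z. min x y \<le> z) M)"
    using assms by (intro size_mset_mono multiset_filter_mono)
  moreover have "size (filter_mset (\<lambda>z. min x y \<le> z) M) = length (filter (\<lambda>z. min x y \<le> z) ?l)"
    by (metis mset_filter mset_sorted_list_of_multiset size_mset)
  ultimately show False by simp
qed

lemma last_rev_sorted_le:
  fixes x :: real
  assumes "x \<in># M"
  shows "last (rev (sorted_list_of_multiset M)) \<le> x"
proof -
  let ?l = "sorted_list_of_multiset M"
  have "x \<in> set ?l" using assms by simp
  then obtain i where i: "i < length ?l" "?l ! i = x" by (meson in_set_conv_nth)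
  then have "?l ! 0 \<le> ?l ! i" by (intro sorted_nth_mono) auto
  moreover have "last (rev ?l) = ?l ! 0" using i by (metis hd_conv_nth last_rev length_greater_0_conv less_nat_zero_code list.size(3))
  ultimately show ?thesis using i by simp
qed

section \<open>From the spectrum of the graph to its edge counts\<close>

lemma adj_row_sum:
  assumes "simple_graph n E" "regular n E d" "i < n"
  shows "(\<Sum>j<n. if {i + 1, j + 1} \<in> E then 1 else 0 :: real) = real d"
proof -
  have "bij_betw (\<lambda>j. j + 1) {j. j < n \<and> {i + 1, j + 1} \<in> E} {u. {u, i + 1} \<in> E}"
  proof (rule bij_betw_byWitness[where f' = "\<lambda>u. u - 1"])
    have "u \<in> {1..n}" if "{u, i + 1} \<in> E" for u using simple_graph_edge(1)[OF assms(1) that] by simp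
    then show "\<forall>u\<in>{u. {u, i + 1} \<in> E}. u - 1 + 1 = u"
      and "(\<lambda>u. u - 1) ` {u. {u, i + 1} \<in> E} \<subseteq> {j. j < n \<and> {i + 1, j + 1} \<in> E}"
      by (force simp: insert_commute)+
  qed (auto simp: insert_commute)
  from bij_betw_same_card[OF this] have "card {j. j < n \<and> {i + 1, j + 1} \<in> E} = d"
    using assms(2,3) degree_eq_card_neighbours[OF assms(1), of "i + 1"] by (simp add: regular_def)
  moreover have "(\<Sum>j<n. if {i + 1, j + 1} \<in> E then 1 else 0 :: real) = real (card ({..<n} \<inter> {j. {i + 1, j + 1} \<in> E}))"
    by (simp add: sum.If_cases)
  moreover have "{..<n} \<inter> {j. {i + 1, j + 1} \<in> E} = {j. j < n \<and> {i + 1, j + 1} \<in> E}" by auto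
  ultimately show ?thesis by simp
qed

text \<open>Arithmetic-geometric mean on each product \<open>x i * x j\<close>. For the adjacency
  matrix this shows that the largest eigenvalue on zero-sum vectors is at most \<open>d\<close>; so
  it is the smaller one of the two roots found and is bounded by the second entry of the
  spectrum.\<close>

lemma bilin_le_row_sum:
  assumes sym: "\<And>i j. i < n \<Longrightarrow> j < n \<Longrightarrow> a i j = a j i" and nonneg: "\<And>i j. a i j \<ge> 0"
    and row: "\<And>i. i < n \<Longrightarrow> (\<Sum>j<n. a i j) = d"
  shows "bilin n a x x \<le> d * (\<Sum>i<n. (x i)\<^sup>2)"
proof -
  have "bilin n a x x \<le> (\<Sum>i<n. \<Sum>j<n. a i j * ((x i)\<^sup>2 / 2) + a i j * ((x j)\<^sup>2 / 2))"
    unfolding bilin_def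
  proof (intro sum_mono)
    fix i j
    have "x i * x j \<le> (x i)\<^sup>2 / 2 + (x j)\<^sup>2 / 2"
      using sum_squares_bound[of "x i" "x j"] by simp
    then have "a i j * (x i * x j) \<le> a i j * ((x i)\<^sup>2 / 2 + (x j)\<^sup>2 / 2)" using nonneg by (rule mult_left_mono)
    then show "a i j * x i * x j \<le> a i j * ((x i)\<^sup>2 / 2) + a i j * ((x j)\<^sup>2 / 2)" by (simp add: algebra_simps)
  qed
  also have "\<dots> = (\<Sum>i<n. \<Sum>j<n. a i j * ((x i)\<^sup>2 / 2)) + (\<Sum>i<n. \<Sum>j<n. a i j * ((x j)\<^sup>2 / 2))"
    by (simp only: sum.distrib)
  also have "(\<Sum>i<n. \<Sum>j<n. a i j * ((x j)\<^sup>2 / 2)) = (\<Sum>i<n. \<Sum>j<n. a i j * ((x i)\<^sup>2 / 2))"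
    by (subst sum.swap, intro sum.cong refl) (simp add: sym)
  also have "(\<Sum>i<n. \<Sum>j<n. a i j * ((x i)\<^sup>2 / 2)) = (\<Sum>i<n. d * ((x i)\<^sup>2 / 2))"
    by (intro sum.cong refl, subst sum_distrib_right[symmetric]) (simp add: row)
  finally show ?thesis by (simp add: sum_distrib_left flip: sum.distrib)
qed

text \<open>The maximiser for \<open>a\<close> bounds the form from above through the second entry
  of the sorted spectrum, and the maximiser for the negated matrix bounds it from below through the
  last entry.\<close>

lemma bilin_le_second_eig:
  fixes x :: "nat \<Rightarrow> real"
  assumes G: "simple_graph n E" "regular n E d" and n: "n \<ge> 2" and x0: "(\<Sum>i<n. x i) = 0"
  defines "a \<equiv> \<lambda>i j. if {i + 1, j + 1} \<in> E then 1 else 0 :: real"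
  shows "\<bar>bilin n a x x\<bar> \<le> second_eig n E * (\<Sum>i<n. (x i)\<^sup>2)"
proof -
  define M where "M = proots (char_poly (adj_matrix n E))"
  have aA: "mat n n (\<lambda>(i, j). a i j) = adj_matrix n E" by (simp add: a_def adj_matrix_def)
  have sym: "a i j = a j i" for i j by (simp add: a_def insert_commute)
  have row: "(\<Sum>j<n. a i j) = real d" if "i < n" for i
    unfolding a_def by (rule adj_row_sum[OF G that])
  have ss: "(\<Sum>i<n. (x i)\<^sup>2) \<ge> 0" by (simp add: sum_nonneg)
  have second: "second_eig n E = max \<bar>rev (sorted_list_of_multiset M) ! 1\<bar> \<bar>last (rev (sorted_list_of_multiset M))\<bar>"
    by (simp only: second_eig_def eigenvalues_desc_def M_def Let_def)
  obtain \<mu> y where \<mu>: "\<And>x. (\<Sum>i<n. x i) = 0 \<Longrightarrow> bilin n a x x \<le> \<mu> * (\<Sum>i<n. (x i)\<^sup>2)"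
    and y: "(\<Sum>i<n. y i) = 0" "\<exists>i<n. y i \<noteq> 0" "\<And>i. i < n \<Longrightarrow> (\<Sum>j<n. a i j * y j) = \<mu> * y i"
    using rayleigh_maximizer[of n a "real d", OF n sym row] by blast
  have sub: "{#real d, \<mu>#} \<subseteq># M"
    using eigenvalues_constant_row_sum[of n a "real d" y \<mu>] row y unfolding M_def aA by blast
  have "bilin n a y y = \<mu> * (\<Sum>i<n. (y i)\<^sup>2)"
    using y(3) by (simp add: bilin_eq_row sum_distrib_left power2_eq_square algebra_simps)
  moreover have "bilin n a y y \<le> real d * (\<Sum>i<n. (y i)\<^sup>2)"
    by (rule bilin_le_row_sum) (auto simp: sym row, auto simp: a_def)
  moreover have "(\<Sum>i<n. (y i)\<^sup>2) > 0" using y(2) by (auto intro!: sum_pos2)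
  ultimately have "\<mu> \<le> real d" by simp
  then have "\<mu> \<le> second_eig n E" using second_largest_ge[OF sub] unfolding second by linarith
  then have upper: "bilin n a x x \<le> second_eig n E * (\<Sum>i<n. (x i)\<^sup>2)"
    using \<mu>[OF x0] mult_right_mono[OF _ ss] by (meson order_trans)
  obtain \<mu>' y' where \<mu>': "\<And>x. (\<Sum>i<n. x i) = 0 \<Longrightarrow> bilin n (\<lambda>i j. - a i j) x x \<le> \<mu>' * (\<Sum>i<n. (x i)\<^sup>2)"
    and y': "(\<Sum>i<n. y' i) = 0" "\<exists>i<n. y' i \<noteq> 0" "\<And>i. i < n \<Longrightarrow> (\<Sum>j<n. - a i j * y' j) = \<mu>' * y' i"
    using rayleigh_maximizer[of n "\<lambda>i j. - a i j" "- real d", OF n] sym row by (auto simp: sum_negf)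
  have "(\<Sum>j<n. a i j * y' j) = (- \<mu>') * y' i" if "i < n" for i
    using y'(3)[OF that] by (simp add: sum_negf)
  then have "{#real d, - \<mu>'#} \<subseteq># M"
    using eigenvalues_constant_row_sum[of n a "real d" y' "- \<mu>'"] row y' unfolding M_def aA by blast
  then have "- \<mu>' \<in># M" by (rule mset_subset_eqD) simp
  then have "\<mu>' \<le> second_eig n E" using last_rev_sorted_le[of "- \<mu>'" M] unfolding second by linarith
  then have "- bilin n a x x \<le> second_eig n E * (\<Sum>i<n. (x i)\<^sup>2)"
    using \<mu>'[OF x0] mult_right_mono[OF _ ss] unfolding bilin_uminus by (meson order_trans)
  then show ?thesis using upper by linarith
qed

text \<open>The expander mixing lemma with the arithmetic in place of the geometric mean of the
  sizes: polarisation expresses the form at two centred indicator vectors by quadratic forms at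
  their sum and difference. The sets may overlap, so ordered pairs are counted.\<close>

lemma edges_between_le:
  assumes G: "ndlambda_graph n d lam E" and n: "n \<ge> 2" and X: "X \<subseteq> {1..n}" and Z: "Z \<subseteq> {1..n}"
  shows "real (card {(x, z). x \<in> X \<and> z \<in> Z \<and> {x, z} \<in> E})
    \<le> real d / real n * real (card X) * real (card Z) + lam * (real (card X) + real (card Z)) / 2"
proof -
  define a where "a = (\<lambda>i j. if {i + 1, j + 1} \<in> E then 1 else 0 :: real)"
  have G1: "simple_graph n E" "regular n E d" and lam: "second_eig n E \<le> lam"
    using G by (auto simp: ndlambda_graph_def)
  have sym: "a i j = a j i" for i j by (simp add: a_def insert_commute)
  have row: "(\<Sum>j<n. a i j) = real d" if "i < n" for i unfolding a_def by (rule adj_row_sum[OF G1 that])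
  have le: "\<bar>bilin n a x x\<bar> \<le> lam * (\<Sum>i<n. (x i)\<^sup>2)" if "(\<Sum>i<n. x i) = 0" for x
    using bilin_le_second_eig[OF G1 n that] mult_right_mono[OF lam, of "\<Sum>i<n. (x i)\<^sup>2"]
    by (simp add: a_def sum_nonneg)
  define ind where "ind S i = (if i + 1 \<in> S then 1 else 0 :: real)" for S :: "nat set" and i
  have sum_ind: "(\<Sum>i<n. ind S i) = real (card S)" if "S \<subseteq> {1..n}" for S
  proof -
    have "(\<Sum>i<n. ind S i) = (\<Sum>i\<in>{1..n}. if i \<in> S then 1 else 0 :: real)"
      unfolding ind_def by (rule sum.reindex_bij_witness[of _ "\<lambda>i. i - 1" "\<lambda>i. i + 1"]) auto
    also have "\<dots> = real (card S)" using that by (simp add: sum.If_cases Int_absorb1)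
    finally show ?thesis .
  qed
  \<comment> \<open>The subtracted mean is written as a scaled constant vector so that the rules for
    sums and multiples apply literally.\<close>
  define ctr where "ctr S i = ind S i + (- (real (card S) / real n)) * 1" for S i
  have ctr0: "(\<Sum>i<n. ctr S i) = 0" if "S \<subseteq> {1..n}" for S
    using sum_ind[OF that] n by (simp add: ctr_def sum_subtractf)
  have ctr_sq: "(\<Sum>i<n. (ctr S i)\<^sup>2) \<le> real (card S)" if "S \<subseteq> {1..n}" for S
  proof -
    define s where "s = real (card S) / real n"
    have "(\<Sum>i<n. (ctr S i)\<^sup>2) = (\<Sum>i<n. ind S i - 2 * s * ind S i + s\<^sup>2)"
      by (intro sum.cong refl) (auto simp: ctr_def ind_def s_def power2_eq_square algebra_simps)
    also have "\<dots> = real (card S) - 2 * s * real (card S) + real n * s\<^sup>2"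
      using sum_ind[OF that] by (simp add: sum.distrib sum_subtractf flip: sum_distrib_left)
    also have "real n * s\<^sup>2 = s * real (card S)" using n by (simp add: s_def power2_eq_square)
    finally show ?thesis by (simp add: s_def)
  qed
  have bil1: "bilin n a (ind S) (\<lambda>_. 1) = real d * real (card S)" if "S \<subseteq> {1..n}" for S
    using sum_ind[OF that] row by (simp add: bilin_eq_row mult.commute flip: sum_distrib_left)
  have bil2: "bilin n a (\<lambda>_. 1) (ind S) = real d * real (card S)" if "S \<subseteq> {1..n}" for S
    using bil1[OF that] bilin_sym[of n a "\<lambda>_. 1" "ind S"] sym by simp
  have bil11: "bilin n a (\<lambda>_. 1) (\<lambda>_. 1) = real d * real n"
    using row by (simp add: bilin_eq_row)
  have "bilin n a (ctr X) (ctr Z) = bilin n a (ind X) (ind Z) - real d / real n * real (card X) * real (card Z)"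
    unfolding ctr_def bilin_add_left bilin_add_right bilin_scale_left bilin_scale_right
    using n by (simp add: bil1[OF X] bil2[OF Z] bil11 field_simps)
  moreover have "4 * bilin n a (ctr X) (ctr Z) = bilin n a (\<lambda>i. ctr X i + ctr Z i) (\<lambda>i. ctr X i + ctr Z i)
      - bilin n a (\<lambda>i. ctr X i + (- 1) * ctr Z i) (\<lambda>i. ctr X i + (- 1) * ctr Z i)"
    unfolding bilin_add_left bilin_add_right bilin_scale_left bilin_scale_right
    using bilin_sym[of n a "ctr X" "ctr Z"] sym by simp
  moreover have "\<bar>bilin n a (\<lambda>i. ctr X i + ctr Z i) (\<lambda>i. ctr X i + ctr Z i)\<bar>
      \<le> lam * (\<Sum>i<n. (ctr X i + ctr Z i)\<^sup>2)"
    using ctr0[OF X] ctr0[OF Z] by (intro le) (simp add: sum.distrib)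
  moreover have "\<bar>bilin n a (\<lambda>i. ctr X i + (- 1) * ctr Z i) (\<lambda>i. ctr X i + (- 1) * ctr Z i)\<bar>
      \<le> lam * (\<Sum>i<n. (ctr X i + (- 1) * ctr Z i)\<^sup>2)"
    using ctr0[OF X] ctr0[OF Z] by (intro le) (simp add: sum_subtractf)
  moreover have "(\<Sum>i<n. (ctr X i + ctr Z i)\<^sup>2) + (\<Sum>i<n. (ctr X i + (- 1) * ctr Z i)\<^sup>2)
      = 2 * (\<Sum>i<n. (ctr X i)\<^sup>2) + 2 * (\<Sum>i<n. (ctr Z i)\<^sup>2)"
    unfolding sum_distrib_left sum.distrib[symmetric] by (intro sum.cong refl) (simp add: power2_eq_square algebra_simps)
  ultimately have "4 * (bilin n a (ind X) (ind Z) - real d / real n * real (card X) * real (card Z))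
      \<le> lam * (2 * (\<Sum>i<n. (ctr X i)\<^sup>2) + 2 * (\<Sum>i<n. (ctr Z i)\<^sup>2))"
    by (smt (verit) distrib_left)
  also have "\<dots> \<le> lam * (2 * real (card X) + 2 * real (card Z))"
  proof (intro mult_left_mono)
    have "0 \<le> second_eig n E" by (simp add: second_eig_def Let_def le_max_iff_disj)
    then show "0 \<le> lam" using lam by linarith
  qed (use ctr_sq[OF X] ctr_sq[OF Z] in linarith)
  also have "\<dots> = 4 * (lam * (real (card X) + real (card Z)) / 2)" by (simp add: algebra_simps)
  finally have "bilin n a (ind X) (ind Z) - real d / real n * real (card X) * real (card Z)
      \<le> lam * (real (card X) + real (card Z)) / 2"
    by (rule mult_left_le_imp_le) simp
  then have "bilin n a (ind X) (ind Z) \<le> real d / real n * real (card X) * real (card Z) + lam * (real (card X) + real (card Z)) / 2"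
    by (simp only: diff_le_eq add.commute)
  moreover have "bilin n a (ind X) (ind Z) = real (card {(x, z). x \<in> X \<and> z \<in> Z \<and> {x, z} \<in> E})"
  proof -
    have "bilin n a (ind X) (ind Z) = (\<Sum>i<n. \<Sum>j<n. if (i + 1, j + 1) \<in> {(x, z). x \<in> X \<and> z \<in> Z \<and> {x, z} \<in> E} then 1 else 0)"
      unfolding bilin_def by (intro sum.cong refl) (auto simp: a_def ind_def)
    also have "\<dots> = (\<Sum>p\<in>{..<n} \<times> {..<n}. if (fst p + 1, snd p + 1) \<in> {(x, z). x \<in> X \<and> z \<in> Z \<and> {x, z} \<in> E} then 1 else 0)"
      by (simp add: sum.cartesian_product case_prod_beta)
    also have "\<dots> = (\<Sum>p\<in>{1..n} \<times> {1..n}. if p \<in> {(x, z). x \<in> X \<and> z \<in> Z \<and> {x, z} \<in> E} then 1 else 0)"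
      by (rule sum.reindex_bij_witness[of _ "\<lambda>p. (fst p - 1, snd p - 1)" "\<lambda>p. (fst p + 1, snd p + 1)"]) auto
    also have "\<dots> = real (card (({1..n} \<times> {1..n}) \<inter> {(x, z). x \<in> X \<and> z \<in> Z \<and> {x, z} \<in> E}))"
      by (simp add: sum.If_cases del: mem_Collect_eq)
    also have "({1..n} \<times> {1..n}) \<inter> {(x, z). x \<in> X \<and> z \<in> Z \<and> {x, z} \<in> E} = {(x, z). x \<in> X \<and> z \<in> Z \<and> {x, z} \<in> E}"
      using X Z by auto
    finally show ?thesis .
  qed
  ultimately show ?thesis by simp
qed

section \<open>Regularising bipartite pieces\<close>

lemma sum_degree_eq:
  assumes "finite P" "finite T"
  shows "(\<Sum>v\<in>T. degree P v) = (\<Sum>e\<in>P. card (e \<inter> T))"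
proof -
  have "(\<Sum>v\<in>T. degree P v) = (\<Sum>v\<in>T. \<Sum>e\<in>P. if v \<in> e then 1 else 0)"
    unfolding degree_def using assms by (intro sum.cong refl) (simp add: sum.If_cases Int_def)
  also have "\<dots> = (\<Sum>e\<in>P. \<Sum>v\<in>T. if v \<in> e then 1 else 0)" by (rule sum.swap)
  also have "\<dots> = (\<Sum>e\<in>P. card (e \<inter> T))"
    using assms by (intro sum.cong refl) (simp add: sum.If_cases Int_def conj_commute)
  finally show ?thesis .
qed

lemma degree_image_pairs:
  assumes "Fp \<subseteq> X \<times> Y" "X \<inter> Y = {}"
  shows "x \<in> X \<Longrightarrow> degree ((\<lambda>(x, y). {x, y}) ` Fp) x = card {y. (x, y) \<in> Fp}"
    and "y \<in> Y \<Longrightarrow> degree ((\<lambda>(x, y). {x, y}) ` Fp) y = card {x. (x, y) \<in> Fp}"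
proof -
  assume x: "x \<in> X"
  have "bij_betw (\<lambda>y. {x, y}) {y. (x, y) \<in> Fp} {e \<in> (\<lambda>(x, y). {x, y}) ` Fp. x \<in> e}"
    by (rule bij_betw_imageI) (use assms x in \<open>auto simp: inj_on_def doubleton_eq_iff image_iff\<close>)
  then show "degree ((\<lambda>(x, y). {x, y}) ` Fp) x = card {y. (x, y) \<in> Fp}"
    by (simp add: degree_def bij_betw_same_card)
next
  assume y: "y \<in> Y"
  have "bij_betw (\<lambda>x. {x, y}) {x. (x, y) \<in> Fp} {e \<in> (\<lambda>(x, y). {x, y}) ` Fp. y \<in> e}"
    by (rule bij_betw_imageI) (use assms y in \<open>auto simp: inj_on_def doubleton_eq_iff image_iff\<close>)
  then show "degree ((\<lambda>(x, y). {x, y}) ` Fp) y = card {x. (x, y) \<in> Fp}"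
    by (simp add: degree_def bij_betw_same_card)
qed

lemma card_pairs_eq_sum:
  assumes "finite X" "finite Y"
  shows "card {(x, y). x \<in> X \<and> y \<in> Y \<and> R x y} = (\<Sum>x\<in>X. card {y\<in>Y. R x y})"
proof -
  have "{(x, y). x \<in> X \<and> y \<in> Y \<and> R x y} = (SIGMA x:X. {y\<in>Y. R x y})" by auto
  then show ?thesis using assms by simp
qed

lemma card_pairs_swap: "card {(x, y). x \<in> X \<and> y \<in> Y \<and> R x y} = card {(y, x). y \<in> Y \<and> x \<in> X \<and> R x y}"
  by (rule bij_betw_same_card[of prod.swap]) (auto simp: bij_betw_def inj_on_def image_iff)

locale expander =
  fixes n d :: nat and lam :: real and E :: "nat set set"
  assumes graph: "ndlambda_graph n d lam E" and n_gt: "n \<ge> d + 1" and n_even: "even n"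
    and lam_le: "lam \<le> real d / 12" and d_pos: "d \<ge> 1"
begin

lemma simple: "simple_graph n E" and reg: "regular n E d"
  using graph by (auto simp: ndlambda_graph_def)

lemma finite_E: "finite E" using simple by (rule simple_graph_finite)

text \<open>By mixing, \<open>Z\<close> absorbs at most 229/1000 of \<open>d\<close> edges per
  vertex of \<open>X'\<close>, out of at least 240/1000. The remaining 11/1000 cover a demand of up
  to \<open>11 * w\<close> with \<open>w \<le> d / 1000\<close>.\<close>

lemma cut_edges_ge:
  assumes X0: "X0 \<subseteq> {1..n}" and Y0: "Y0 \<subseteq> {1..n}" and cardY0: "real (card Y0) \<le> 261 / 1000 * real n"
    and W: "W \<subseteq> E" and degX: "\<And>x. x \<in> X0 \<Longrightarrow> 24 / 100 * real d \<le> real (card {y\<in>Y0. {x, y} \<in> W})"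
    and X': "X' \<subseteq> X0" and Z: "Z \<subseteq> Y0" and ZX: "10 * card Z \<le> 11 * card X'" and sum_le: "card Z + card X' \<le> card Y0"
  shows "11 / 1000 * real d * real (card X') \<le> real (card {(x, y). x \<in> X' \<and> y \<in> Y0 - Z \<and> {x, y} \<in> W})"
proof -
  have fin: "finite X'" "finite Y0" "finite Z" using finite_subset[OF X0] finite_subset[OF Y0] finite_subset[OF X'] finite_subset[OF Z] by simp_all
  have n2: "n \<ge> 2" using n_gt d_pos by simp
  have "{(x, y). x \<in> X' \<and> y \<in> Y0 \<and> {x, y} \<in> W} =
      {(x, y). x \<in> X' \<and> y \<in> Y0 - Z \<and> {x, y} \<in> W} \<union> {(x, y). x \<in> X' \<and> y \<in> Z \<and> {x, y} \<in> W}" using Z by auto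
  then have "card {(x, y). x \<in> X' \<and> y \<in> Y0 \<and> {x, y} \<in> W} \<le>
      card {(x, y). x \<in> X' \<and> y \<in> Y0 - Z \<and> {x, y} \<in> W} + card {(x, y). x \<in> X' \<and> y \<in> Z \<and> {x, y} \<in> W}"
    by (simp add: card_Un_le)
  moreover have "card {(x, y). x \<in> X' \<and> y \<in> Z \<and> {x, y} \<in> W} \<le> card {(x, y). x \<in> X' \<and> y \<in> Z \<and> {x, y} \<in> E}"
    by (rule card_mono) (use W fin in \<open>auto intro: finite_subset[of _ "X' \<times> Z"]\<close>)
  moreover have "24 / 100 * real d * real (card X') \<le> real (card {(x, y). x \<in> X' \<and> y \<in> Y0 \<and> {x, y} \<in> W})"
  proof -
    have "24 / 100 * real d * real (card X') = (\<Sum>x\<in>X'. 24 / 100 * real d)" by simp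
    also have "\<dots> \<le> (\<Sum>x\<in>X'. real (card {y\<in>Y0. {x, y} \<in> W}))" using degX X' by (intro sum_mono) auto
    also have "\<dots> = real (card {(x, y). x \<in> X' \<and> y \<in> Y0 \<and> {x, y} \<in> W})"
      using fin by (simp add: card_pairs_eq_sum)
    finally show ?thesis .
  qed
  moreover have "real (card {(x, y). x \<in> X' \<and> y \<in> Z \<and> {x, y} \<in> E}) \<le> 229 / 1000 * real d * real (card X')"
  proof -
    have "real (card {(x, y). x \<in> X' \<and> y \<in> Z \<and> {x, y} \<in> E})
        \<le> real d / real n * real (card X') * real (card Z) + lam * (real (card X') + real (card Z)) / 2"
      using edges_between_le[OF graph n2, of X' Z] X0 Y0 X' Z by auto
    \<comment> \<open>\<open>ZX\<close> and \<open>sum_le\<close> give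
      \<open>21 * card Z \<le> 11 * card Y0\<close>, hence
      \<open>card Z \<le> 137 / 1000 * n\<close>. Per unit of \<open>d * card X'\<close>, the
      density term is then at most 0.137 and the spectral term at most
      \<open>(1 + 11 / 10) / 24 = 0.0875\<close>.\<close>
    also have "\<dots> \<le> real d * real (card X') * (137 / 1000) + real d / 12 * (real (card X') + 11 / 10 * real (card X')) / 2"
    proof (rule add_mono)
      have "21 * real (card Z) \<le> 11 * real (card Y0)" using ZX sum_le by linarith
      then have "real (card Z) \<le> 137 / 1000 * real n" using cardY0 by linarith
      then have "real d / real n * real (card X') * real (card Z) \<le> real d / real n * real (card X') * (137 / 1000 * real n)"
        by (intro mult_left_mono) auto
      then show "real d / real n * real (card X') * real (card Z) \<le> real d * real (card X') * (137 / 1000)"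
        using n2 by simp
      have "real (card Z) \<le> 11 / 10 * real (card X')" using ZX by linarith
      then show "lam * (real (card X') + real (card Z)) / 2 \<le> real d / 12 * (real (card X') + 11 / 10 * real (card X')) / 2"
        using lam_le by (intro divide_right_mono mult_mono) auto
    qed
    also have "\<dots> \<le> 229 / 1000 * real d * real (card X')" by (simp add: algebra_simps)
    finally show ?thesis .
  qed
  ultimately show ?thesis by (simp add: algebra_simps)
qed

text \<open>A violated cut forces \<open>Y0 - Y'\<close> to have at most 11/10 of the size of
  \<open>X'\<close> and, as the demands have equal totals, \<open>X0 - X'\<close> at most 11/10 of
  the size of \<open>Y'\<close>. Seen from the smaller of \<open>X'\<close> and \<open>Y'\<close>,
  the edges of the cut alone then cover the whole demand of that set.\<close>

lemma cross_factor:
  assumes X0: "X0 \<subseteq> {1..n}" and Y0: "Y0 \<subseteq> {1..n}" and disj: "X0 \<inter> Y0 = {}"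
    and card_eq: "card X0 = card Y0" and cardY0: "real (card Y0) \<le> 261 / 1000 * real n"
    and W: "W \<subseteq> E" and degX: "\<And>x. x \<in> X0 \<Longrightarrow> 24 / 100 * real d \<le> real (card {y\<in>Y0. {x, y} \<in> W})"
    and degY: "\<And>y. y \<in> Y0 \<Longrightarrow> 24 / 100 * real d \<le> real (card {x\<in>X0. {y, x} \<in> W})"
    and f: "\<And>v. v \<in> X0 \<union> Y0 \<Longrightarrow> 10 * w \<le> f v \<and> f v \<le> 11 * w" and w: "w > 0" "real w \<le> real d / 1000"
    and sum_eq: "sum f X0 = sum f Y0"
  shows "\<exists>F\<subseteq>W. (\<forall>e\<in>F. \<exists>x\<in>X0. \<exists>y\<in>Y0. e = {x, y}) \<and> (\<forall>v\<in>X0 \<union> Y0. degree F v = f v)"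
proof -
  define Wp where "Wp = {(x, y). x \<in> X0 \<and> y \<in> Y0 \<and> {x, y} \<in> W}"
  have fin: "finite X0" "finite Y0" using finite_subset[OF X0] finite_subset[OF Y0] by simp_all
  have Wp: "Wp \<subseteq> X0 \<times> Y0" by (auto simp: Wp_def)
  have sum_ge: "10 * w * card T \<le> sum f T" and sum_le: "sum f T \<le> 11 * w * card T" if "T \<subseteq> X0 \<union> Y0" for T
    using sum_bounded_below[of T "10 * w" f] sum_bounded_above[of T f "11 * w"] f that by (auto simp: algebra_simps)
  have cond: "sum f X' \<le> card (Wp \<inter> X' \<times> Y') + sum f (Y0 - Y')" if X': "X' \<subseteq> X0" and Y': "Y' \<subseteq> Y0" for X' Y'
  proof (rule ccontr)
    assume "\<not> ?thesis"
    then have gt: "sum f X' > card (Wp \<inter> X' \<times> Y') + sum f (Y0 - Y')" by simp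
    have eqe: "Wp \<inter> X' \<times> Y' = {(x, y). x \<in> X' \<and> y \<in> Y0 - (Y0 - Y') \<and> {x, y} \<in> W}"
      using X' Y' by (auto simp: Wp_def)
    have splitY: "sum f Y' + sum f (Y0 - Y') = sum f Y0" "card Y' + card (Y0 - Y') = card Y0"
      using Y' fin by (auto simp: sum.subset_diff card_Diff_subset finite_subset card_mono)
    have splitX: "sum f X' + sum f (X0 - X') = sum f X0" "card X' + card (X0 - X') = card X0"
      using X' fin by (auto simp: sum.subset_diff card_Diff_subset finite_subset card_mono)
    have gt': "sum f Y' > card (Wp \<inter> X' \<times> Y') + sum f (X0 - X')" using gt splitX splitY sum_eq by linarith
    have "10 * w * card (Y0 - Y') \<le> 11 * w * card X'"
      using gt sum_ge[of "Y0 - Y'", OF le_supI2[OF Diff_subset]] sum_le[of X', OF le_supI1[OF X']] by linarith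
    then have "w * (10 * card (Y0 - Y')) \<le> w * (11 * card X')" by (simp add: algebra_simps)
    then have ZX: "10 * card (Y0 - Y') \<le> 11 * card X'" using w by (simp only: mult_le_cancel1)
    have "10 * w * card (X0 - X') \<le> 11 * w * card Y'"
      using gt' sum_ge[of "X0 - X'", OF le_supI1[OF Diff_subset]] sum_le[of Y', OF le_supI2[OF Y']] by linarith
    then have "w * (10 * card (X0 - X')) \<le> w * (11 * card Y')" by (simp add: algebra_simps)
    then have VY: "10 * card (X0 - X') \<le> 11 * card Y'" using w by (simp only: mult_le_cancel1)
    have small: "real (sum f T) \<le> 11 / 1000 * real d * real (card T)" if "T \<subseteq> X0 \<union> Y0" for T
    proof -
      have "real (sum f T) \<le> real (11 * w * card T)" using sum_le[OF that] by (rule of_nat_mono)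
      also have "\<dots> = 11 * real w * real (card T)" by simp
      also have "\<dots> \<le> 11 * (real d / 1000) * real (card T)" using w by (intro mult_right_mono mult_left_mono) auto
      finally show ?thesis by simp
    qed
    show False
    \<comment> \<open>This comparison is the size condition
      \<open>card (Y0 - Y') + card X' \<le> card Y0\<close> of the edge bound; if it fails, the
      bound applies with the two sides exchanged.\<close>
    proof (cases "card X' \<le> card Y'")
      case True
      have "11 / 1000 * real d * real (card X') \<le> real (card (Wp \<inter> X' \<times> Y'))"
        unfolding eqe by (rule cut_edges_ge[OF X0 Y0 cardY0 W degX X' _ ZX]) (use True splitY in auto)
      then show False using small[of X', OF le_supI1[OF X']] gt by linarith
    next
      case False
      have "11 / 1000 * real d * real (card Y') \<le> real (card {(y, x). y \<in> Y' \<and> x \<in> X0 - (X0 - X') \<and> {y, x} \<in> W})"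
        by (rule cut_edges_ge[OF Y0 X0 _ W degY Y' _ VY]) (use False splitX cardY0 card_eq in auto)
      also have "{(y, x). y \<in> Y' \<and> x \<in> X0 - (X0 - X') \<and> {y, x} \<in> W} = {(y, x). y \<in> Y' \<and> x \<in> X' \<and> {x, y} \<in> W}"
        using X' by (auto simp: insert_commute)
      also have "card \<dots> = card {(x, y). x \<in> X' \<and> y \<in> Y' \<and> {x, y} \<in> W}" by (rule card_pairs_swap[symmetric])
      also have "{(x, y). x \<in> X' \<and> y \<in> Y' \<and> {x, y} \<in> W} = Wp \<inter> X' \<times> Y'" using X' Y' by (auto simp: Wp_def)
      finally show False using small[of Y', OF le_supI2[OF Y']] gt' by linarith
    qed
  qed
  have "\<exists>F\<subseteq>Wp. (\<forall>x\<in>X0. int (card {y. (x, y) \<in> F}) = int (f x)) \<and> (\<forall>y\<in>Y0. int (card {x. (x, y) \<in> F}) = int (f y))"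
  proof (rule bipartite_factor)
    show "finite Wp" using Wp fin finite_subset by blast
    show "(\<Sum>v\<in>X'. int (f v)) \<le> int (card (Wp \<inter> X' \<times> Y')) + (\<Sum>v\<in>Y0 - Y'. int (f v))" if "X' \<subseteq> X0" "Y' \<subseteq> Y0" for X' Y'
      using cond[OF that] by (simp flip: of_nat_sum of_nat_add)
    show "(\<Sum>v\<in>X0. int (f v)) = (\<Sum>v\<in>Y0. int (f v))" using sum_eq by (simp flip: of_nat_sum)
  qed (use fin Wp in auto)
  then obtain Fp where Fp: "Fp \<subseteq> Wp" "\<And>x. x \<in> X0 \<Longrightarrow> card {y. (x, y) \<in> Fp} = f x" "\<And>y. y \<in> Y0 \<Longrightarrow> card {x. (x, y) \<in> Fp} = f y"
    by auto
  have sub: "Fp \<subseteq> X0 \<times> Y0" using Fp(1) Wp by blast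
  show ?thesis
  proof (intro exI[of _ "(\<lambda>(x, y). {x, y}) ` Fp"] conjI)
    show "(\<lambda>(x, y). {x, y}) ` Fp \<subseteq> W" using Fp(1) by (auto simp: Wp_def)
    show "\<forall>e\<in>(\<lambda>(x, y). {x, y}) ` Fp. \<exists>x\<in>X0. \<exists>y\<in>Y0. e = {x, y}" using sub by auto
    show "\<forall>v\<in>X0 \<union> Y0. degree ((\<lambda>(x, y). {x, y}) ` Fp) v = f v"
      using degree_image_pairs[OF sub disj] Fp(2,3) by auto
  qed
qed

end

lemma card_edge_split:
  assumes "finite e" "card e = 2" "card (e \<inter> S) = 1"
  shows "card (e - S) = 1"
  using assms card_Diff_subset_Int[of e S] by simp

lemma degree_UN_disjoint:
  assumes "finite I" "\<And>i. i \<in> I \<Longrightarrow> finite (H i)" "\<And>i j. i \<in> I \<Longrightarrow> j \<in> I \<Longrightarrow> i \<noteq> j \<Longrightarrow> H i \<inter> H j = {}"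
  shows "degree (\<Union>i\<in>I. H i) v = (\<Sum>i\<in>I. degree (H i) v)"
proof -
  have "{e \<in> (\<Union>i\<in>I. H i). v \<in> e} = (\<Union>i\<in>I. {e \<in> H i. v \<in> e})" by auto
  moreover have "card (\<Union>i\<in>I. {e \<in> H i. v \<in> e}) = (\<Sum>i\<in>I. card {e \<in> H i. v \<in> e})"
    by (rule card_UN_disjoint) (use assms in \<open>auto simp: disjoint_iff\<close>)
  ultimately show ?thesis by (simp add: degree_def)
qed

section \<open>Balanced cuts and their regularisation\<close>

context expander
begin

definition cross :: "nat set \<Rightarrow> nat set set" where
  "cross A = {e \<in> E. e \<inter> A \<noteq> {} \<and> \<not> e \<subseteq> A}"

definition internal :: "nat set \<Rightarrow> nat set set" where
  "internal A = {e \<in> E. e \<subseteq> A \<or> e \<inter> A = {}}"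

definition cross_nbrs :: "nat set \<Rightarrow> nat \<Rightarrow> nat set" where
  "cross_nbrs A v = {u. {u, v} \<in> E \<and> (u \<in> A \<longleftrightarrow> v \<notin> A)}"

text \<open>Edges between the two sides that cross \<open>S\<close> form two bipartite graphs: one
  on \<open>A \<inter> S\<close> and the part of the other side outside \<open>S\<close>, one on the
  complementary parts. The equation makes the parts of the first equally large. Each vertex has
  about \<open>d / 4\<close> neighbours in its partner part, with margin
  \<open>d / 200\<close>.\<close>

definition good_cut :: "nat set \<Rightarrow> nat set \<Rightarrow> bool" where
  "good_cut A S \<longleftrightarrow> S \<subseteq> {1..n} \<and> card (A \<inter> S) = card ({1..n} - A - S) \<and>
    (\<forall>v\<in>{1..n}. 245 / 1000 * real d \<le> real (card (cross_nbrs A v \<inter> S)) \<and> real (card (cross_nbrs A v \<inter> S)) \<le> 255 / 1000 * real d \<and>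
      245 / 1000 * real d \<le> real (card (cross_nbrs A v - S)) \<and> real (card (cross_nbrs A v - S)) \<le> 255 / 1000 * real d)"

text \<open>A graph still to be made regular by edges between the sides that cross \<open>S\<close>.
  The equal edge counts make the demands on the two parts of each half agree; \<open>lo\<close> is
  the lower end of a degree window of width \<open>w\<close>.\<close>

definition piece :: "nat set \<Rightarrow> nat \<Rightarrow> nat set set \<Rightarrow> nat set \<Rightarrow> nat \<Rightarrow> bool" where
  "piece A w P S lo \<longleftrightarrow> P \<subseteq> internal A \<and> good_cut A S \<and> (\<forall>e\<in>P. card (e \<inter> S) = 1) \<and>
    card {e\<in>P. e \<subseteq> A} = card {e\<in>P. e \<inter> A = {}} \<and> (\<forall>v\<in>{1..n}. lo \<le> degree P v \<and> degree P v \<le> lo + w)"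

lemma edge_vertices: "{u, v} \<in> E \<Longrightarrow> u \<in> {1..n} \<and> v \<in> {1..n} \<and> u \<noteq> v"
  using simple unfolding simple_graph_def by (force simp: doubleton_eq_iff)

lemma cross_nbrs_subset: "cross_nbrs A v \<subseteq> {1..n}"
  using edge_vertices by (auto simp: cross_nbrs_def)

lemma finite_cross_nbrs: "finite (cross_nbrs A v)"
  using cross_nbrs_subset by (rule finite_subset) simp

lemma cross_cases:
  assumes "e \<in> cross A"
  obtains x y where "e = {x, y}" "x \<in> A" "y \<notin> A" "x \<in> {1..n}" "y \<in> {1..n}"
proof -
  obtain u v where "e = {u, v}" "u \<in> {1..n}" "v \<in> {1..n}"
    using assms simple unfolding cross_def simple_graph_def by blast
  then show ?thesis using assms that[of u v] that[of v u] by (auto simp: cross_def insert_commute)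
qed

lemma good_cut_complement:
  assumes A: "A \<subseteq> {1..n}" "2 * card A = n" and S: "good_cut A S"
  shows "good_cut A ({1..n} - S)"
proof -
  have fin: "finite A" using A finite_subset by blast
  have cB: "card ({1..n} - A) = card A" using A fin by (simp add: card_Diff_subset)
  have "A \<inter> ({1..n} - S) = A - S" "{1..n} - A - ({1..n} - S) = ({1..n} - A) \<inter> S" using A by auto
  moreover have "card A = card (A \<inter> S) + card (A - S)" using fin by (rule card_Int_Diff)
  moreover have "card ({1..n} - A) = card (({1..n} - A) \<inter> S) + card ({1..n} - A - S)" by (rule card_Int_Diff) simp
  ultimately have "card (A \<inter> ({1..n} - S)) = card ({1..n} - A - ({1..n} - S))"
    using S cB unfolding good_cut_def by simp
  moreover have "cross_nbrs A v \<inter> ({1..n} - S) = cross_nbrs A v - S" "cross_nbrs A v - ({1..n} - S) = cross_nbrs A v \<inter> S" for v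
    using cross_nbrs_subset[of A v] by auto
  ultimately show ?thesis using S by (simp add: good_cut_def)
qed

text \<open>Double counting of the edges between \<open>A\<close> and the part outside
  \<open>S\<close>: each vertex of that part sends at least 0.49 of \<open>d\<close>, each of the
  \<open>n / 2\<close> vertices of \<open>A\<close> receives at most 0.255 of \<open>d\<close>, and
  0.255 / 0.98 is below 0.261.\<close>

lemma good_cut_card_le:
  assumes A: "A \<subseteq> {1..n}" "2 * card A = n" and S: "good_cut A S"
  shows "real (card ({1..n} - A - S)) \<le> 261 / 1000 * real n"
proof -
  let ?Y = "{1..n} - A - S"
  have fin: "finite A" using A finite_subset by blast
  have "49 / 100 * real d * real (card ?Y) = (\<Sum>y\<in>?Y. 49 / 100 * real d)" by simp
  also have "\<dots> \<le> (\<Sum>y\<in>?Y. real (card {x\<in>A. {x, y} \<in> E}))"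
  proof (rule sum_mono)
    fix y assume y: "y \<in> ?Y"
    have "card (cross_nbrs A y) = card (cross_nbrs A y \<inter> S) + card (cross_nbrs A y - S)"
      using card_Int_Diff[OF finite_cross_nbrs] .
    moreover have "cross_nbrs A y = {x\<in>A. {x, y} \<in> E}" using y by (auto simp: cross_nbrs_def)
    moreover have "245 / 1000 * real d \<le> real (card (cross_nbrs A y \<inter> S))" "245 / 1000 * real d \<le> real (card (cross_nbrs A y - S))"
      using S y by (auto simp: good_cut_def)
    ultimately show "49 / 100 * real d \<le> real (card {x\<in>A. {x, y} \<in> E})" by simp
  qed
  also have "\<dots> = (\<Sum>x\<in>A. real (card {y\<in>?Y. {x, y} \<in> E}))"
  proof -
    have "(\<Sum>y\<in>?Y. card {x\<in>A. {x, y} \<in> E}) = card {(y, x). y \<in> ?Y \<and> x \<in> A \<and> {x, y} \<in> E}"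
      by (rule card_pairs_eq_sum[symmetric]) (use fin in auto)
    also have "\<dots> = card {(x, y). x \<in> A \<and> y \<in> ?Y \<and> {x, y} \<in> E}" by (rule card_pairs_swap[symmetric])
    also have "\<dots> = (\<Sum>x\<in>A. card {y\<in>?Y. {x, y} \<in> E})"
      by (rule card_pairs_eq_sum) (use fin in auto)
    finally show ?thesis by (simp only: flip: of_nat_sum)
  qed
  also have "\<dots> \<le> (\<Sum>x\<in>A. 255 / 1000 * real d)"
  proof (rule sum_mono)
    fix x assume x: "x \<in> A"
    have "{y\<in>?Y. {x, y} \<in> E} = cross_nbrs A x - S" using x edge_vertices by (auto simp: cross_nbrs_def insert_commute)
    then show "real (card {y\<in>?Y. {x, y} \<in> E}) \<le> 255 / 1000 * real d"
      using S x A by (auto simp: good_cut_def)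
  qed
  also have "\<dots> = real d * (255 / 2000 * real n)" using A(2) by (simp flip: A(2))
  finally have "real d * (49 / 100 * real (card ?Y)) \<le> real d * (255 / 2000 * real n)" by (simp add: algebra_simps)
  then have "49 / 100 * real (card ?Y) \<le> 255 / 2000 * real n" by (rule mult_left_le_imp_le) (use d_pos in simp)
  then show ?thesis by simp
qed

text \<open>The target lies so far above the window that the demands vary only between
  \<open>10 * w\<close> and \<open>11 * w\<close>. Their totals agree because each edge of
  \<open>P\<close> has exactly one end in \<open>S\<close> and one outside: an edge inside
  \<open>A\<close> meets the first part once, an edge on the other side meets the second part
  once.\<close>

lemma regularize_half:
  assumes A: "A \<subseteq> {1..n}" "2 * card A = n" and S: "good_cut A S"
    and U: "U \<subseteq> cross A" "\<And>v. v \<in> {1..n} \<Longrightarrow> real (degree U v) \<le> real d / 200"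
    and P: "P \<subseteq> internal A" "\<And>e. e \<in> P \<Longrightarrow> card (e \<inter> S) = 1" "card {e\<in>P. e \<subseteq> A} = card {e\<in>P. e \<inter> A = {}}"
    and deg: "\<And>v. v \<in> {1..n} \<Longrightarrow> lo \<le> degree P v \<and> degree P v \<le> lo + w"
    and w: "w > 0" "real w \<le> real d / 1000"
  shows "\<exists>F\<subseteq>cross A - U. (\<forall>e\<in>F. \<exists>x\<in>A \<inter> S. \<exists>y\<in>{1..n} - A - S. e = {x, y}) \<and>
    (\<forall>v\<in>A \<inter> S \<union> ({1..n} - A - S). degree F v + degree P v = lo + 11 * w)"
proof -
  define W where "W = cross A - U"
  define f where "f v = lo + 11 * w - degree P v" for v
  let ?X = "A \<inter> S" and ?Y = "{1..n} - A - S"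
  have PE: "P \<subseteq> E" using P(1) by (auto simp: internal_def)
  have UE: "U \<subseteq> E" using U(1) by (auto simp: cross_def)
  have finP: "finite P" using PE finite_E finite_subset by blast
  have finA: "finite A" using A finite_subset by blast
  have f_deg: "f v + degree P v = lo + 11 * w" if "v \<in> {1..n}" for v
    using deg[OF that] by (simp add: f_def)
  have degU: "card {u. {u, v} \<in> U} = degree U v" for v
    using degree_eq_card_neighbours[OF simple_graph_subset[OF simple UE]] by simp
  have finU: "finite {u. {u, v} \<in> U}" for v
    by (rule finite_subset[of _ "{1..n}"]) (use UE edge_vertices in auto)
  \<comment> \<open>The edges in \<open>U\<close> cost each vertex at most 5/1000 of
    \<open>d\<close>, which lowers 245/1000 to 240/1000.\<close>
  have remaining: "24 / 100 * real d \<le> real (card T)"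
    if v: "v \<in> {1..n}" and N: "245 / 1000 * real d \<le> real (card N)" and T: "N - {u. {u, v} \<in> U} \<subseteq> T" "finite T" for v N T
  proof -
    have "card N - card {u. {u, v} \<in> U} \<le> card (N - {u. {u, v} \<in> U})" by (rule diff_card_le_card_Diff[OF finU])
    also have "\<dots> \<le> card T" using T by (intro card_mono)
    finally show ?thesis using N U(2)[OF v] degU[of v] by linarith
  qed
  have sum_f: "sum f T + (\<Sum>e\<in>P. card (e \<inter> T)) = card T * (lo + 11 * w)" if "T \<subseteq> {1..n}" for T
  proof -
    have "(\<Sum>v\<in>T. f v + degree P v) = (\<Sum>v\<in>T. lo + 11 * w)" using f_deg that by (intro sum.cong) auto
    then show ?thesis using finite_subset[OF that] finP by (simp add: sum.distrib sum_degree_eq algebra_simps)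
  qed
  have "(\<Sum>e\<in>P. card (e \<inter> ?X)) = (\<Sum>e\<in>P. if e \<subseteq> A then 1 else 0)"
  proof (intro sum.cong refl)
    fix e assume e: "e \<in> P"
    show "card (e \<inter> ?X) = (if e \<subseteq> A then 1 else 0)"
    proof (cases "e \<subseteq> A")
      case True
      then have "e \<inter> ?X = e \<inter> S" by auto
      then show ?thesis using P(2)[OF e] True by simp
    next
      case False
      then have "e \<inter> ?X = {}" using e P(1) by (auto simp: internal_def)
      then show ?thesis using False by simp
    qed
  qed
  also have "\<dots> = card {e\<in>P. e \<subseteq> A}" using finP by (simp add: sum.If_cases Int_def)
  also have "\<dots> = card {e\<in>P. e \<inter> A = {}}" by (rule P(3))
  also have "\<dots> = (\<Sum>e\<in>P. if e \<inter> A = {} then 1 else 0)" using finP by (simp add: sum.If_cases Int_def)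
  also have "\<dots> = (\<Sum>e\<in>P. card (e \<inter> ?Y))"
  proof (intro sum.cong refl)
    fix e assume e: "e \<in> P"
    then have eE: "e \<in> E" using PE by auto
    note edge = simple_graph_edge[OF simple eE]
    show "(if e \<inter> A = {} then 1 else 0) = card (e \<inter> ?Y)"
    proof (cases "e \<inter> A = {}")
      case True
      then have "e \<inter> ?Y = e - S" using edge by auto
      then show ?thesis using card_edge_split[OF edge(3,2) P(2)[OF e]] True by simp
    next
      case False
      then have "e \<inter> ?Y = {}" using e P(1) by (auto simp: internal_def)
      then show ?thesis using False by simp
    qed
  qed
  finally have eqP: "(\<Sum>e\<in>P. card (e \<inter> ?X)) = (\<Sum>e\<in>P. card (e \<inter> ?Y))" .
  have cardXY: "card ?X = card ?Y" using S by (simp add: good_cut_def)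
  have "\<exists>F\<subseteq>W. (\<forall>e\<in>F. \<exists>x\<in>?X. \<exists>y\<in>?Y. e = {x, y}) \<and> (\<forall>v\<in>?X \<union> ?Y. degree F v = f v)"
  proof (rule cross_factor[where w = w])
    show "real (card ?Y) \<le> 261 / 1000 * real n" by (rule good_cut_card_le[OF A S])
    show "24 / 100 * real d \<le> real (card {y \<in> ?Y. {x, y} \<in> W})" if x: "x \<in> ?X" for x
    proof (rule remaining)
      show "245 / 1000 * real d \<le> real (card (cross_nbrs A x - S))" using S x A by (auto simp: good_cut_def)
      show "cross_nbrs A x - S - {u. {u, x} \<in> U} \<subseteq> {y \<in> ?Y. {x, y} \<in> W}"
        using x edge_vertices by (auto simp: cross_nbrs_def W_def cross_def insert_commute)
    qed (use x A in auto)
    show "24 / 100 * real d \<le> real (card {x \<in> ?X. {y, x} \<in> W})" if y: "y \<in> ?Y" for y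
    proof (rule remaining)
      show "245 / 1000 * real d \<le> real (card (cross_nbrs A y \<inter> S))" using S y A by (auto simp: good_cut_def)
      show "cross_nbrs A y \<inter> S - {u. {u, y} \<in> U} \<subseteq> {x \<in> ?X. {y, x} \<in> W}"
        using y edge_vertices by (auto simp: cross_nbrs_def W_def cross_def insert_commute)
    qed (use y finA in auto)
    show "10 * w \<le> f v \<and> f v \<le> 11 * w" if "v \<in> ?X \<union> ?Y" for v
    proof -
      have "v \<in> {1..n}" using that A by auto
      from deg[OF this] show ?thesis by (auto simp: f_def)
    qed
    have "?X \<subseteq> {1..n}" "?Y \<subseteq> {1..n}" using A by auto
    from sum_f[OF this(1)] sum_f[OF this(2)] show "sum f ?X = sum f ?Y" using eqP cardXY by simp
  qed (use A S w in \<open>auto simp: W_def cross_def good_cut_def\<close>)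
  then obtain F where F: "F \<subseteq> W" "\<forall>e\<in>F. \<exists>x\<in>?X. \<exists>y\<in>?Y. e = {x, y}" "\<forall>v\<in>?X \<union> ?Y. degree F v = f v" by blast
  have "degree F v + degree P v = lo + 11 * w" if "v \<in> ?X \<union> ?Y" for v
  proof -
    have "v \<in> {1..n}" using that A by auto
    then show ?thesis using f_deg F(3) that by simp
  qed
  then show ?thesis using F unfolding W_def by blast
qed

text \<open>The complement of \<open>S\<close> is a good cut as well. The two halves partition the
  vertices, so their factors add up without interfering.\<close>

lemma regularize_piece:
  assumes A: "A \<subseteq> {1..n}" "2 * card A = n" and P: "piece A w P S lo"
    and U: "U \<subseteq> cross A" "\<And>v. v \<in> {1..n} \<Longrightarrow> real (degree U v) \<le> real d / 200"
    and w: "w > 0" "real w \<le> real d / 1000"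
  shows "\<exists>F\<subseteq>cross A - U. (\<forall>e\<in>F. card (e \<inter> S) = 1) \<and> (\<forall>v\<in>{1..n}. degree F v + degree P v = lo + 11 * w)"
proof -
  let ?T = "{1..n} - S"
  have P': "P \<subseteq> internal A" "good_cut A S" "\<And>e. e \<in> P \<Longrightarrow> card (e \<inter> S) = 1" "card {e\<in>P. e \<subseteq> A} = card {e\<in>P. e \<inter> A = {}}"
    "\<And>v. v \<in> {1..n} \<Longrightarrow> lo \<le> degree P v \<and> degree P v \<le> lo + w" using P by (auto simp: piece_def)
  have T: "card (e \<inter> ?T) = 1" if e: "e \<in> P" for e
  proof -
    have "e \<in> E" using e P'(1) by (auto simp: internal_def)
    note edge = simple_graph_edge[OF simple this]
    have "e \<inter> ?T = e - S" using edge by auto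
    then show ?thesis using card_edge_split[OF edge(3,2) P'(3)[OF e]] by simp
  qed
  obtain F1 where F1: "F1 \<subseteq> cross A - U" "\<forall>e\<in>F1. \<exists>x\<in>A \<inter> S. \<exists>y\<in>{1..n} - A - S. e = {x, y}"
    "\<forall>v\<in>A \<inter> S \<union> ({1..n} - A - S). degree F1 v + degree P v = lo + 11 * w"
    using regularize_half[OF A P'(2) U P'(1,3,4,5) w] by blast
  obtain F2 where F2: "F2 \<subseteq> cross A - U" "\<forall>e\<in>F2. \<exists>x\<in>A \<inter> ?T. \<exists>y\<in>{1..n} - A - ?T. e = {x, y}"
    "\<forall>v\<in>A \<inter> ?T \<union> ({1..n} - A - ?T). degree F2 v + degree P v = lo + 11 * w"
    using regularize_half[OF A good_cut_complement[OF A P'(2)] U P'(1) T P'(4,5) w] by blast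
  have "F1 \<subseteq> E" "F2 \<subseteq> E" using F1(1) F2(1) by (auto simp: cross_def)
  then have fin: "finite F1" "finite F2" using finite_E finite_subset by blast+
  have disj: "F1 \<inter> F2 = {}" using F1(2) F2(2) by (force simp: doubleton_eq_iff)
  have "degree (F1 \<union> F2) v + degree P v = lo + 11 * w" if v: "v \<in> {1..n}" for v
  proof (cases "v \<in> A \<inter> S \<union> ({1..n} - A - S)")
    case True
    then have "{e\<in>F2. v \<in> e} = {}" using F2(2) by force
    then have "degree F2 v = 0" by (simp only: degree_def card.empty)
    then show ?thesis using F1(3) True degree_Un_disjoint[OF fin disj] by simp
  next
    case False
    then have "{e\<in>F1. v \<in> e} = {}" using F1(2) by force
    then have "degree F1 v = 0" by (simp only: degree_def card.empty)
    moreover have "v \<in> A \<inter> ?T \<union> ({1..n} - A - ?T)" using False v by auto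
    ultimately show ?thesis using F2(3) degree_Un_disjoint[OF fin disj] by simp
  qed
  moreover have "card (e \<inter> S) = 1" if e: "e \<in> F1 \<union> F2" for e
  proof -
    consider "e \<in> F1" | "e \<in> F2" using e by blast
    then show ?thesis
    proof cases
      case 1
      then obtain x y where "x \<in> A \<inter> S" "y \<in> {1..n} - A - S" "e = {x, y}" using F1(2) by blast
      then have "e \<inter> S = {x}" by auto
      then show ?thesis by simp
    next
      case 2
      then obtain x y where "x \<in> A \<inter> ?T" "y \<in> {1..n} - A - ?T" "e = {x, y}" using F2(2) by blast
      then have "e \<inter> S = {y}" by auto
      then show ?thesis by simp
    qed
  qed
  ultimately show ?thesis using F1(1) F2(1) by (intro exI[of _ "F1 \<union> F2"]) blast
qed

text \<open>Greedy choice: since the window starts at \<open>lo j\<close>, each factor uses at most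
  \<open>11 * w\<close> edges at a vertex, so the edges used before stay within the
  \<open>d / 200\<close> that the next factor tolerates.\<close>

lemma regularize_pieces:
  assumes A: "A \<subseteq> {1..n}" "2 * card A = n" and P: "\<And>j. j < k \<Longrightarrow> piece A w (P j) (S j) (lo j)"
    and w: "w > 0" "real (11 * k * w) \<le> real d / 200" "real w \<le> real d / 1000"
  shows "\<exists>F. \<forall>j<k. F j \<subseteq> cross A \<and> (\<forall>e\<in>F j. card (e \<inter> S j) = 1) \<and>
    (\<forall>v\<in>{1..n}. degree (F j) v + degree (P j) v = lo j + 11 * w) \<and> (\<forall>i<j. F i \<inter> F j = {})"
  using P w(2)
proof (induction k)
  case 0
  then show ?case by simp
next
  case (Suc k)
  have "real (11 * k * w) \<le> real d / 200" using Suc.prems(2) by (simp add: algebra_simps)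
  then obtain F where F: "\<And>j. j < k \<Longrightarrow> F j \<subseteq> cross A" "\<And>j e. j < k \<Longrightarrow> e \<in> F j \<Longrightarrow> card (e \<inter> S j) = 1"
    "\<And>j v. j < k \<Longrightarrow> v \<in> {1..n} \<Longrightarrow> degree (F j) v + degree (P j) v = lo j + 11 * w"
    "\<And>i j. i < j \<Longrightarrow> j < k \<Longrightarrow> F i \<inter> F j = {}"
    using Suc.IH Suc.prems(1) by (metis less_SucI)
  define U where "U = (\<Union>j<k. F j)"
  have U: "U \<subseteq> cross A" using F(1) by (auto simp: U_def)
  have "real (degree U v) \<le> real d / 200" if v: "v \<in> {1..n}" for v
  proof -
    have "finite (F j)" if "j < k" for j using F(1)[OF that] finite_E finite_subset[of _ E] by (auto simp: cross_def)
    moreover have "F i \<inter> F j = {}" if "i < k" "j < k" "i \<noteq> j" for i j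
      using F(4)[of i j] F(4)[of j i] that by (cases "i < j") auto
    ultimately have "degree U v = (\<Sum>j<k. degree (F j) v)"
      unfolding U_def by (intro degree_UN_disjoint) auto
    also have "\<dots> \<le> (\<Sum>j<k. 11 * w)"
    proof (rule sum_mono)
      fix j assume "j \<in> {..<k}"
      then have j: "j < k" by simp
      have "lo j \<le> degree (P j) v" using Suc.prems(1)[of j] j v by (auto simp: piece_def)
      then show "degree (F j) v \<le> 11 * w" using F(3)[OF j v] by linarith
    qed
    finally have "degree U v \<le> 11 * k * w" by (simp add: algebra_simps)
    then have "real (degree U v) \<le> real (11 * k * w)" by (rule of_nat_mono)
    then show ?thesis using \<open>real (11 * k * w) \<le> real d / 200\<close> by linarith
  qed
  then obtain F' where F': "F' \<subseteq> cross A - U" "\<forall>e\<in>F'. card (e \<inter> S k) = 1"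
    "\<forall>v\<in>{1..n}. degree F' v + degree (P k) v = lo k + 11 * w"
    using regularize_piece[OF A Suc.prems(1)[of k] U _ w(1,3)] by blast
  have "\<forall>j<Suc k. (F(k := F')) j \<subseteq> cross A \<and> (\<forall>e\<in>(F(k := F')) j. card (e \<inter> S j) = 1) \<and>
    (\<forall>v\<in>{1..n}. degree ((F(k := F')) j) v + degree (P j) v = lo j + 11 * w) \<and> (\<forall>i<j. (F(k := F')) i \<inter> (F(k := F')) j = {})"
  proof (intro allI impI)
    fix j assume "j < Suc k"
    then consider "j < k" | "j = k" by linarith
    then show "(F(k := F')) j \<subseteq> cross A \<and> (\<forall>e\<in>(F(k := F')) j. card (e \<inter> S j) = 1) \<and>
      (\<forall>v\<in>{1..n}. degree ((F(k := F')) j) v + degree (P j) v = lo j + 11 * w) \<and> (\<forall>i<j. (F(k := F')) i \<inter> (F(k := F')) j = {})"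
    proof cases
      case 1
      then show ?thesis using F by simp
    next
      case 2
      then show ?thesis using F' by (auto simp: U_def)
    qed
  qed
  then show ?case by blast
qed

lemma decomposition_from_pieces:
  assumes A: "A \<subseteq> {1..n}" "2 * card A = n" and P: "\<And>j. j < k \<Longrightarrow> piece A w (P j) (S j) (lo j)"
    and Pdisj: "\<And>i j. i < k \<Longrightarrow> j < k \<Longrightarrow> i \<noteq> j \<Longrightarrow> P i \<inter> P j = {}" and Pun: "(\<Union>j<k. P j) = internal A"
    and w: "w > 0" "real (11 * k * w) \<le> real d / 200" "real w \<le> real d / 1000"
  shows "\<exists>Hs. is_decomposition E Hs \<and> (\<forall>H\<in>set Hs. regular_bipartite_spanning n E H) \<and> length Hs = k + 1"
proof -
  have "\<exists>F. \<forall>j<k. F j \<subseteq> cross A \<and> (\<forall>e\<in>F j. card (e \<inter> S j) = 1) \<and>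
    (\<forall>v\<in>{1..n}. degree (F j) v + degree (P j) v = lo j + 11 * w) \<and> (\<forall>i<j. F i \<inter> F j = {})"
    by (rule regularize_pieces) (use A P w in auto)
  then obtain F where F0: "\<forall>j<k. F j \<subseteq> cross A \<and> (\<forall>e\<in>F j. card (e \<inter> S j) = 1) \<and>
    (\<forall>v\<in>{1..n}. degree (F j) v + degree (P j) v = lo j + 11 * w) \<and> (\<forall>i<j. F i \<inter> F j = {})" ..
  have F: "\<And>j. j < k \<Longrightarrow> F j \<subseteq> cross A" "\<And>j e. j < k \<Longrightarrow> e \<in> F j \<Longrightarrow> card (e \<inter> S j) = 1"
    "\<And>j v. j < k \<Longrightarrow> v \<in> {1..n} \<Longrightarrow> degree (F j) v + degree (P j) v = lo j + 11 * w"
    "\<And>i j. i < j \<Longrightarrow> j < k \<Longrightarrow> F i \<inter> F j = {}"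
    using F0 by auto
  have Fdisj: "F i \<inter> F j = {}" if "i < k" "j < k" "i \<noteq> j" for i j
    using F(4)[of i j] F(4)[of j i] that by (cases "i < j") auto
  have Pint: "P j \<subseteq> internal A" if "j < k" for j using P[OF that] by (simp add: piece_def)
  have int_cross: "internal A \<inter> cross A = {}" "internal A \<union> cross A = E"
    by (auto simp: internal_def cross_def)
  have finite: "finite X" if "X \<subseteq> E" for X using that finite_E finite_subset by blast
  define H where "H j = (if j < k then P j \<union> F j else cross A - (\<Union>j<k. F j))" for j
  have Hsub: "H j \<subseteq> E" for j
    unfolding H_def using Pint F(1) int_cross by (auto split: if_splits) blast+
  have Hdisj: "H i \<inter> H j = {}" if "i \<le> k" "j \<le> k" "i \<noteq> j" for i j
  proof -
    have *: "H i \<inter> H j = {}" if "i < k" "j < k" "i \<noteq> j" for i j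
      using that Pint[of i] Pint[of j] F(1)[of i] F(1)[of j] int_cross(1) Pdisj[OF that] Fdisj[OF that]
      unfolding H_def by auto
    have **: "H i \<inter> H k = {}" if "i < k" for i
      using that Pint[of i] F(1)[of i] int_cross(1) unfolding H_def by auto
    show ?thesis
    proof (cases "i < k \<and> j < k")
      case True then show ?thesis using * that by blast
    next
      case False
      then have "i = k \<and> j < k \<or> j = k \<and> i < k" using that by auto
      then show ?thesis using ** by (auto simp: Int_commute)
    qed
  qed
  have Hun: "(\<Union>j\<le>k. H j) = E"
  proof
    show "(\<Union>j\<le>k. H j) \<subseteq> E" using Hsub by blast
    show "E \<subseteq> (\<Union>j\<le>k. H j)"
    proof
      fix e assume "e \<in> E"
      then consider j where "j < k" "e \<in> P j" | j where "j < k" "e \<in> F j" | "e \<in> cross A - (\<Union>j<k. F j)"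
        using int_cross(2) Pun by blast
      then show "e \<in> (\<Union>j\<le>k. H j)"
      proof cases
        case (1 j) then show ?thesis by (intro UN_I[of j]) (auto simp: H_def)
      next
        case (2 j) then show ?thesis by (intro UN_I[of j]) (auto simp: H_def)
      next
        case 3 then show ?thesis by (intro UN_I[of k]) (auto simp: H_def)
      qed
    qed
  qed
  have Hdeg: "degree (H j) v = lo j + 11 * w" if j: "j < k" and v: "v \<in> {1..n}" for j v
  proof -
    have "P j \<inter> F j = {}" using Pint[OF j] F(1)[OF j] int_cross(1) by blast
    then have "degree (P j \<union> F j) v = degree (P j) v + degree (F j) v"
      using Hsub[of j] j by (intro degree_Un_disjoint finite) (auto simp: H_def)
    then show ?thesis using F(3)[OF j v] j by (simp add: H_def)
  qed
  have "degree (H k) v = d - (\<Sum>j<k. lo j + 11 * w)" if v: "v \<in> {1..n}" for v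
  proof -
    have "degree E v = (\<Sum>j\<le>k. degree (H j) v)"
      unfolding Hun[symmetric] using Hsub Hdisj by (intro degree_UN_disjoint finite) auto
    also have "\<dots> = (\<Sum>j<k. degree (H j) v) + degree (H k) v"
      by (simp add: lessThan_Suc_atMost[symmetric])
    also have "(\<Sum>j<k. degree (H j) v) = (\<Sum>j<k. lo j + 11 * w)" using Hdeg v by simp
    finally show ?thesis using reg v by (simp add: regular_def)
  qed
  then have Hreg: "\<exists>r. regular n (H j) r" if "j \<le> k" for j
    using Hdeg that unfolding regular_def by (cases "j = k") (auto simp: nat_less_le)
  have Hbip: "bipartite n (H j)" if "j \<le> k" for j
  proof -
    have edge: "finite e" "card e = 2" if "e \<in> H j" for e j
      using simple_graph_edge[OF simple] Hsub[of j] that by blast+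
    show ?thesis
    proof (cases "j < k")
      case True
      have "card (e \<inter> S j) = 1" if "e \<in> H j" for e
        using that True F(2)[OF True] P[OF True] by (auto simp: H_def piece_def)
      moreover have "S j \<subseteq> {1..n}" using P[OF True] by (simp add: piece_def good_cut_def)
      ultimately show ?thesis unfolding bipartite_def using card_edge_split[OF edge] by blast
    next
      case False
      have "card (e \<inter> A) = 1" if "e \<in> H j" for e
      proof -
        have "e \<in> cross A" using that False by (simp add: H_def)
        then obtain x y where "e = {x, y}" "x \<in> A" "y \<notin> A" by (rule cross_cases)
        then have "e \<inter> A = {x}" by auto
        then show ?thesis by simp
      qed
      then show ?thesis unfolding bipartite_def using card_edge_split[OF edge] A(1) by blast
    qed
  qed
  define Hs where "Hs = map H [0..<Suc k]"
  have nth: "Hs ! i = H i" if "i \<le> k" for i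
    using that unfolding Hs_def by (simp del: upt_Suc)
  have setHs: "set Hs = H ` {..k}" unfolding Hs_def by (auto simp del: upt_Suc)
  have len: "length Hs = k + 1" by (simp add: Hs_def)
  have "Hs ! i \<inter> Hs ! j = {}" if "i < length Hs" "j < length Hs" "i \<noteq> j" for i j
    using that Hdisj[of i j] len by (simp add: nth)
  moreover have "(\<Union>H\<in>set Hs. H) = E" unfolding setHs using Hun by simp
  ultimately have "is_decomposition E Hs" unfolding is_decomposition_def by blast
  moreover have "regular_bipartite_spanning n E H'" if H': "H' \<in> set Hs" for H'
  proof -
    obtain j where j: "j \<le> k" "H' = H j" using H' setHs by auto
    show ?thesis
      unfolding regular_bipartite_spanning_def j(2) using Hsub Hreg[OF j(1)] Hbip[OF j(1)] by blast
  qed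
  ultimately show ?thesis using len by (intro exI[of _ Hs] conjI ballI)
qed

end

section \<open>Colouring the vertex pairs\<close>

text \<open>
Vertices \<open>2i - 1\<close> and \<open>2i\<close> form a pair. \<open>A\<close> contains one vertex of each pair and the vertices of a pair get the
same colour; this makes every cut below automatically balanced.
\<close>

definition pair_index :: "nat \<Rightarrow> nat" where "pair_index v = (v + 1) div 2"

lemma pair_index_eq_iff: "pair_index v = x \<longleftrightarrow> (v = 2 * x - 1 \<and> x > 0) \<or> v = 2 * x"
  unfolding pair_index_def by presburger

lemma neighbours_swap: "{u. {v, u} \<in> F} = {u. {u, v} \<in> F}"
  by (simp add: insert_commute)

context expander
begin

lemma pair_index_mem: "v \<in> {1..n} \<Longrightarrow> pair_index v \<in> {1..n div 2}"
  using n_even unfolding pair_index_def by auto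

lemma card_neighbours: "v \<in> {1..n} \<Longrightarrow> card {u. {u, v} \<in> E} = d"
  using reg degree_eq_card_neighbours[OF simple] by (simp add: regular_def)

lemma card_neighbours_le: "card {u. {u, v} \<in> E} \<le> d"
proof (cases "v \<in> {1..n}")
  case True
  then show ?thesis using card_neighbours by simp
next
  case False
  then have "{u. {u, v} \<in> E} = {}" using edge_vertices by blast
  then show ?thesis by simp
qed

lemma finite_neighbours: "finite {u. {u, v} \<in> E}"
  by (rule finite_subset[of _ "{1..n}"]) (use edge_vertices in blast)+

lemma card_neighbours_pair_le: "card {v. \<exists>u. pair_index u = x \<and> {u, v} \<in> E} \<le> 2 * d"
proof -
  have "{v. \<exists>u. pair_index u = x \<and> {u, v} \<in> E} \<subseteq> {v. {2 * x - 1, v} \<in> E} \<union> {v. {2 * x, v} \<in> E}"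
    unfolding pair_index_eq_iff by blast
  then have "card {v. \<exists>u. pair_index u = x \<and> {u, v} \<in> E} \<le> card ({v. {2 * x - 1, v} \<in> E} \<union> {v. {2 * x, v} \<in> E})"
    using finite_neighbours by (intro card_mono) (auto simp: neighbours_swap)
  also have "\<dots> \<le> card {v. {2 * x - 1, v} \<in> E} + card {v. {2 * x, v} \<in> E}" by (rule card_Un_le)
  also have "\<dots> \<le> d + d" unfolding neighbours_swap by (intro add_mono card_neighbours_le)
  finally show ?thesis by simp
qed

text \<open>A pair has two vertices with at most \<open>d\<close> neighbours each, and only
  constraints at these neighbours can involve it.\<close>

lemma card_constraints_le:
  assumes "finite T" and "\<And>v s. N v s \<subseteq> {u. {u, v} \<in> E}"
  shows "card {(v, s). v \<in> {1..n} \<and> s \<in> T \<and> x \<in> pair_index ` N v s} \<le> 2 * d * card T"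
proof -
  have "{(v, s). v \<in> {1..n} \<and> s \<in> T \<and> x \<in> pair_index ` N v s} \<subseteq> {v. \<exists>u. pair_index u = x \<and> {u, v} \<in> E} \<times> T"
    using assms(2) by blast
  moreover have fin: "finite {v. \<exists>u. pair_index u = x \<and> {u, v} \<in> E}"
    by (rule finite_subset[of _ "{1..n}"]) (use edge_vertices in blast)+
  ultimately have "card {(v, s). v \<in> {1..n} \<and> s \<in> T \<and> x \<in> pair_index ` N v s} \<le> card ({v. \<exists>u. pair_index u = x \<and> {u, v} \<in> E} \<times> T)"
    using assms(1) by (intro card_mono) auto
  also have "\<dots> \<le> 2 * d * card T" unfolding card_cartesian_product by (intro mult_right_mono card_neighbours_pair_le) simp
  finally show ?thesis .
qed

lemma exp_div_power_le:
  fixes \<delta> t p :: real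
  assumes "exp (- t\<^sup>2 / (4 * M)) / (1 - \<delta>) ^ D \<le> p" "0 \<le> \<delta>" "\<delta> < 1" "k \<le> D"
  shows "exp (- t\<^sup>2 / (4 * M)) / (1 - \<delta>) ^ k \<le> p"
proof -
  have "exp (- t\<^sup>2 / (4 * M)) / (1 - \<delta>) ^ k \<le> exp (- t\<^sup>2 / (4 * M)) / (1 - \<delta>) ^ D"
    using assms by (intro divide_left_mono power_decreasing) auto
  then show ?thesis using assms(1) by linarith
qed

text \<open>The colour of a pair decides which of its vertices enters \<open>A\<close>. Odd and even
  neighbours are treated separately, because \<open>pair_index\<close> is injective only within a
  parity; each parity contributes an error of at most \<open>t\<close>. Two parities and two colours
  put a pair into at most \<open>4 * (2 * d)\<close> constraints.\<close>

lemma exists_balanced_halving: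
  fixes t \<delta> :: real
  assumes \<delta>: "0 \<le> \<delta>" "\<delta> < 1" and t: "0 \<le> t" "t \<le> 2 * real d"
    and small: "8 * real d * (exp (- t\<^sup>2 / (4 * real d)) / (1 - \<delta>) ^ d) \<le> \<delta>"
  shows "\<exists>A\<subseteq>{1..n}. 2 * card A = n \<and> inj_on pair_index A \<and> inj_on pair_index ({1..n} - A) \<and>
    (\<forall>v\<in>{1..n}. \<bar>real (card {u\<in>A. {u, v} \<in> E}) - real d / 2\<bar> \<le> 2 * t)"
proof -
  define N where "N v s = {u. {u, v} \<in> E \<and> odd u = fst s}" for v and s :: "bool \<times> bool"
  define I where "I = {1..n} \<times> (UNIV :: (bool \<times> bool) set)"
  have inj_par: "inj_on pair_index {u. P u \<and> odd u = b}" for P b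
    by (auto simp: inj_on_def pair_index_def elim!: oddE evenE split: if_splits) presburger+
  have fin_N: "finite (N v s)" for v s by (rule finite_subset[OF _ finite_neighbours[of v]]) (auto simp: N_def)
  have card_N: "card (pair_index ` N v s) = card (N v s)" for v s
    unfolding N_def by (intro card_image inj_par)
  have card_N_le: "card (N v s) \<le> d" for v s
  proof -
    have "card (N v s) \<le> card {u. {u, v} \<in> E}"
      using finite_neighbours by (intro card_mono) (auto simp: N_def)
    then show ?thesis using card_neighbours_le[of v] by linarith
  qed
  have "\<exists>c\<in>PiE {1..n div 2} (\<lambda>_. UNIV :: bool set).
      (\<forall>i\<in>I. real (card {x\<in>(case i of (v, s) \<Rightarrow> pair_index ` N v s). c x \<in> {snd (snd i)}})
        \<le> real (card {snd (snd i)}) / real (card (UNIV :: bool set)) * real (card (case i of (v, s) \<Rightarrow> pair_index ` N v s)) + t) \<and>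
      (\<forall>x y. {x, y} \<in> {} \<longrightarrow> c x \<noteq> c y)"
  proof (rule exists_balanced_proper_coloring[where \<delta> = \<delta> and p = "exp (- t\<^sup>2 / (4 * real d)) / (1 - \<delta>) ^ d" and K = "8 * d" and L = 0
        and M = "\<lambda>_. real d"])
    show "(case i of (v, s) \<Rightarrow> pair_index ` N v s) \<subseteq> {1..n div 2} \<and> {snd (snd i)} \<subseteq> UNIV" if "i \<in> I" for i
      using edge_vertices pair_index_mem by (auto simp: N_def split: prod.splits)
    show "real (card (case i of (v, s) \<Rightarrow> pair_index ` N v s)) \<le> real d \<and> 0 < real d \<and> 0 \<le> t \<and> t \<le> 2 * real d" if "i \<in> I" for i
      using t d_pos card_N_le by (auto simp: card_N split: prod.splits)
    show "exp (- t\<^sup>2 / (4 * real d)) / (1 - \<delta>) ^ card (case i of (v, s) \<Rightarrow> pair_index ` N v s) \<le> exp (- t\<^sup>2 / (4 * real d)) / (1 - \<delta>) ^ d" if "i \<in> I" for i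
      by (rule exp_div_power_le[OF order_refl \<delta>]) (auto simp: card_N card_N_le split: prod.splits)
    show "card {i\<in>I. x \<in> (case i of (v, s) \<Rightarrow> pair_index ` N v s)} \<le> 8 * d" for x
    proof -
      have "{i\<in>I. x \<in> (case i of (v, s) \<Rightarrow> pair_index ` N v s)} = {(v, s). v \<in> {1..n} \<and> s \<in> UNIV \<and> x \<in> pair_index ` N v s}"
        by (auto simp: I_def)
      also have "card \<dots> \<le> 2 * d * card (UNIV :: (bool \<times> bool) set)"
        by (rule card_constraints_le) (auto simp: N_def)
      finally show ?thesis by (simp add: card_UNIV_bool flip: UNIV_Times_UNIV)
    qed
  qed (use \<delta> small in \<open>auto simp: I_def\<close>)
  then obtain c where c: "\<And>v s. v \<in> {1..n} \<Longrightarrow> real (card {x\<in>pair_index ` N v s. c x = snd s}) \<le> real (card (N v s)) / 2 + t"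
    by (fastforce simp: I_def card_N)
  define A where "A = {u\<in>{1..n}. odd u = c (pair_index u)}"
  have cnt: "card {x\<in>pair_index ` N v s. c x = snd s} = card {u\<in>N v s. c (pair_index u) = snd s}" for v s
  proof -
    have "{x\<in>pair_index ` N v s. c x = snd s} = pair_index ` {u\<in>N v s. c (pair_index u) = snd s}" by auto
    moreover have "inj_on pair_index {u\<in>N v s. c (pair_index u) = snd s}"
      using inj_par[of "\<lambda>u. {u, v} \<in> E" "fst s"] by (rule inj_on_subset) (auto simp: N_def)
    ultimately show ?thesis by (simp add: card_image)
  qed
  have inj: "inj_on pair_index A" "inj_on pair_index ({1..n} - A)"
  proof -
    have "u = v" if "pair_index u = pair_index v" "odd u = odd v" for u v
      using inj_par[of "\<lambda>_. True" "odd u"] that by (auto simp: inj_on_def)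
    then show "inj_on pair_index A" "inj_on pair_index ({1..n} - A)" by (auto simp: A_def inj_on_def)
  qed
  have "pair_index ` A = {1..n div 2}"
  proof
    show "pair_index ` A \<subseteq> {1..n div 2}" using pair_index_mem by (auto simp: A_def)
    show "{1..n div 2} \<subseteq> pair_index ` A"
    proof
      fix x assume x: "x \<in> {1..n div 2}"
      define u where "u = (if c x then 2 * x - 1 else 2 * x)"
      have "pair_index u = x" using x by (auto simp: pair_index_eq_iff u_def)
      moreover have "u \<in> {1..n}" "odd u = c x" using x n_even by (auto simp: u_def)
      ultimately show "x \<in> pair_index ` A" unfolding A_def by (intro image_eqI[of _ _ u]) auto
    qed
  qed
  then have "card A = n div 2" using card_image[OF inj(1)] by simp
  then have cardA: "2 * card A = n" using n_even by simp
  have "\<bar>real (card {u\<in>A. {u, v} \<in> E}) - real d / 2\<bar> \<le> 2 * t" if v: "v \<in> {1..n}" for v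
  proof -
    define a where "a b \<gamma> = card {u\<in>N v (b, \<gamma>). c (pair_index u) = \<gamma>}" for b \<gamma>
    have a_le: "real (a b \<gamma>) \<le> real (card (N v (b, \<gamma>))) / 2 + t" for b \<gamma>
      using c[OF v, of "(b, \<gamma>)"] cnt[of v "(b, \<gamma>)"] by (simp add: a_def)
    have N_eq: "N v (b, \<gamma>) = N v (b, True)" for b \<gamma> by (simp add: N_def)
    have a_sum: "a b True + a b False = card (N v (b, True))" for b
    proof -
      have "N v (b, True) = {u\<in>N v (b, True). c (pair_index u) = True} \<union> {u\<in>N v (b, False). c (pair_index u) = False}"
        by (auto simp: N_def)
      moreover have "card ({u\<in>N v (b, True). c (pair_index u) = True} \<union> {u\<in>N v (b, False). c (pair_index u) = False})
         = card {u\<in>N v (b, True). c (pair_index u) = True} + card {u\<in>N v (b, False). c (pair_index u) = False}"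
        using fin_N by (intro card_Un_disjoint) auto
      ultimately show ?thesis by (simp add: a_def)
    qed
    have "{u\<in>A. {u, v} \<in> E} = {u\<in>N v (True, True). c (pair_index u) = True} \<union> {u\<in>N v (False, False). c (pair_index u) = False}"
      using edge_vertices by (auto simp: A_def N_def)
    moreover have "card ({u\<in>N v (True, True). c (pair_index u) = True} \<union> {u\<in>N v (False, False). c (pair_index u) = False}) = a True True + a False False"
      unfolding a_def using fin_N by (intro card_Un_disjoint) (simp, simp, auto simp: N_def)
    ultimately have cA: "card {u\<in>A. {u, v} \<in> E} = a True True + a False False" by simp
    have "{u. {u, v} \<in> E} = N v (True, True) \<union> N v (False, True)" by (auto simp: N_def)
    moreover have "card (N v (True, True) \<union> N v (False, True)) = card (N v (True, True)) + card (N v (False, True))"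
      by (intro card_Un_disjoint fin_N) (auto simp: N_def)
    ultimately have "card (N v (True, True)) + card (N v (False, True)) = d" using card_neighbours[OF v] by simp
    then have "real (card (N v (True, True))) + real (card (N v (False, True))) = real d" by (metis of_nat_add)
    moreover have "real (a b True) + real (a b False) = real (card (N v (b, True)))" for b using a_sum[of b] by (metis of_nat_add)
    note this[of True] this[of False]
    ultimately show ?thesis
      using a_le[of True True] a_le[of True False] a_le[of False True] a_le[of False False]
        N_eq[of True False] N_eq[of False False] cA by simp
  qed
  then show ?thesis using inj cardA by (intro exI[of _ A]) (auto simp: A_def)
qed

text \<open>All these neighbours lie on one side, which contains at most one vertex of each pair; so
  counting them is the same as counting their pairs, on which the colours are chosen.\<close>

lemma pair_index_inj_on_sides:
  assumes A: "inj_on pair_index A" "inj_on pair_index ({1..n} - A)"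
  shows "inj_on pair_index (cross_nbrs A v)" "F \<subseteq> internal A \<Longrightarrow> inj_on pair_index {u. {u, v} \<in> F}"
proof -
  have "cross_nbrs A v \<subseteq> A \<or> cross_nbrs A v \<subseteq> {1..n} - A" using cross_nbrs_subset[of A v] by (auto simp: cross_nbrs_def)
  then show "inj_on pair_index (cross_nbrs A v)" using A inj_on_subset by blast
  assume F: "F \<subseteq> internal A"
  have "{u. {u, v} \<in> F} \<subseteq> {1..n}" using F edge_vertices by (auto simp: internal_def)
  then have "{u. {u, v} \<in> F} \<subseteq> A \<or> {u. {u, v} \<in> F} \<subseteq> {1..n} - A"
    using F by (cases "v \<in> A") (fastforce simp: internal_def)+
  then show "inj_on pair_index {u. {u, v} \<in> F}" using A inj_on_subset by blast
qed

text \<open>One colouring controls, for every vertex and every colour set in \<open>\<G>\<close>,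
  both the neighbours on the other side and those in \<open>F\<close>. The \<open>bool\<close> in
  the index selects between these two, whence 4 rather than 2 in
  \<open>4 * d * card \<G>\<close>.\<close>

lemma exists_pair_coloring:
  fixes C :: "'c set" and \<G> :: "'c set set" and t1 t2 \<delta> p :: real
  assumes A: "inj_on pair_index A" "inj_on pair_index ({1..n} - A)"
    and C: "finite C" "C \<noteq> {}" and \<G>: "\<G> \<subseteq> Pow C"
    and F: "F \<subseteq> internal A" "\<And>v. degree F v \<le> D" "D > 0" and R: "R \<subseteq> F" "\<And>v. degree R v \<le> D'"
    and \<delta>: "0 \<le> \<delta>" "\<delta> < 1" and t1: "0 \<le> t1" "t1 \<le> 2 * real d" and t2: "0 \<le> t2" "t2 \<le> 2 * real D"
    and p1: "exp (- t1\<^sup>2 / (4 * real d)) / (1 - \<delta>) ^ d \<le> p" and p2: "exp (- t2\<^sup>2 / (4 * real D)) / (1 - \<delta>) ^ D \<le> p"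
    and small: "real (4 * d * card \<G>) * p + real (2 * D') / (real (card C) * (1 - \<delta>)\<^sup>2) \<le> \<delta>"
  shows "\<exists>c. (\<forall>x\<in>{1..n div 2}. c x \<in> C) \<and>
    (\<forall>v\<in>{1..n}. \<forall>G\<in>\<G>. real (card {u\<in>cross_nbrs A v. c (pair_index u) \<in> G}) \<le> real (card G) / real (card C) * real (card (cross_nbrs A v)) + t1 \<and>
      real (card {u. {u, v} \<in> F \<and> c (pair_index u) \<in> G}) \<le> real (card G) / real (card C) * real (degree F v) + t2) \<and>
    (\<forall>u v. {u, v} \<in> R \<longrightarrow> c (pair_index u) \<noteq> c (pair_index v))"
proof -
  define N where "N v s = (if snd s then cross_nbrs A v else {u. {u, v} \<in> F})" for v and s :: "'c set \<times> bool"
  define I where "I = {1..n} \<times> (\<G> \<times> (UNIV :: bool set))"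
  have FE: "F \<subseteq> E" and RE: "R \<subseteq> E" using F(1) R(1) by (auto simp: internal_def)
  have fin\<G>: "finite \<G>" using \<G> C finite_subset by blast
  have N_sub: "N v s \<subseteq> {u. {u, v} \<in> E}" for v s using FE by (auto simp: N_def cross_nbrs_def)
  have N_V: "N v s \<subseteq> {1..n}" for v s using N_sub edge_vertices by blast
  have inj_N: "inj_on pair_index (N v s)" for v s
    using pair_index_inj_on_sides[OF A] F(1) by (simp add: N_def)
  have fin_N: "finite (N v s)" for v s using N_V by (rule finite_subset) simp
  have deg_F: "degree F v = card {u. {u, v} \<in> F}" for v
    by (rule degree_eq_card_neighbours[OF simple_graph_subset[OF simple FE]])
  have card_N: "card (pair_index ` N v s) = card (N v s)" for v s by (rule card_image[OF inj_N])
  have card_N_le: "card (N v s) \<le> (if snd s then d else D)" for v s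
  proof (cases "snd s")
    case True
    have "card (N v s) \<le> card {u. {u, v} \<in> E}"
      using finite_neighbours N_sub by (intro card_mono)
    then show ?thesis using card_neighbours_le[of v] True by simp
  next
    case False
    then show ?thesis using F(2)[of v] deg_F[of v] by (simp add: N_def)
  qed
  let ?N = "\<lambda>i. case i of (v, s) \<Rightarrow> pair_index ` N v s"
  \<comment> \<open>Contracting the pairs keeps each edge of \<open>R\<close> a two-element set,
    since its ends lie on one side, and at most doubles the degrees; hence
    \<open>2 * D'\<close>.\<close>
  let ?R = "(\<lambda>e. pair_index ` e) ` R"
  have "\<exists>c\<in>PiE {1..n div 2} (\<lambda>_. C).
      (\<forall>i\<in>I. real (card {x\<in>?N i. c x \<in> fst (snd i)})
        \<le> real (card (fst (snd i))) / real (card C) * real (card (?N i)) + (if snd (snd i) then t1 else t2)) \<and>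
      (\<forall>x y. {x, y} \<in> ?R \<longrightarrow> c x \<noteq> c y)"
  proof (rule exists_balanced_proper_coloring[where \<delta> = \<delta> and p = p and K = "4 * d * card \<G>" and L = "2 * D'"
        and M = "\<lambda>i. if snd (snd i) then real d else real D"])
    show "finite I" using fin\<G> by (simp add: I_def)
    show "?N i \<subseteq> {1..n div 2} \<and> fst (snd i) \<subseteq> C" if "i \<in> I" for i
      using that N_V pair_index_mem \<G> by (force simp: I_def split: prod.splits)
    show "real (card (?N i)) \<le> (if snd (snd i) then real d else real D) \<and> 0 < (if snd (snd i) then real d else real D) \<and>
      0 \<le> (if snd (snd i) then t1 else t2) \<and> (if snd (snd i) then t1 else t2) \<le> 2 * (if snd (snd i) then real d else real D)" if "i \<in> I" for i
      using t1 t2 d_pos F(3) card_N_le[of "fst i" "snd i"] by (auto simp: card_N split: prod.splits)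
    show "exp (- (if snd (snd i) then t1 else t2)\<^sup>2 / (4 * (if snd (snd i) then real d else real D))) / (1 - \<delta>) ^ card (?N i) \<le> p" if "i \<in> I" for i
    proof -
      obtain v s where i: "i = (v, s)" by (cases i)
      show ?thesis using exp_div_power_le[OF p1 \<delta>, of "card (N v s)"] exp_div_power_le[OF p2 \<delta>, of "card (N v s)"]
          card_N_le[of v s] by (cases "snd s") (simp_all add: i card_N)
    qed
    show "card {i\<in>I. x \<in> ?N i} \<le> 4 * d * card \<G>" for x
    proof -
      have "{i\<in>I. x \<in> ?N i} = {(v, s). v \<in> {1..n} \<and> s \<in> \<G> \<times> UNIV \<and> x \<in> pair_index ` N v s}"
        by (auto simp: I_def)
      also have "card \<dots> \<le> 2 * d * card (\<G> \<times> (UNIV :: bool set))"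
        by (rule card_constraints_le) (use fin\<G> N_sub in auto)
      finally show ?thesis by (simp add: card_cartesian_product card_UNIV_bool)
    qed
    have edge: "inj_on pair_index e \<and> e \<subseteq> {1..n} \<and> card e = 2" if "e \<in> R" for e
    proof -
      have "e \<in> internal A" "e \<in> E" using that R(1) F(1) RE by auto
      then have "e \<subseteq> A \<or> e \<subseteq> {1..n} - A" using simple_graph_edge(1)[OF simple, of e] by (auto simp: internal_def)
      then have "inj_on pair_index e" using A inj_on_subset by blast
      then show ?thesis using simple_graph_edge[OF simple \<open>e \<in> E\<close>] by auto
    qed
    show "e' \<subseteq> {1..n div 2} \<and> card e' = 2" if e': "e' \<in> ?R" for e'
    proof -
      obtain e where e: "e \<in> R" "e' = pair_index ` e" using e' by auto
      show ?thesis using edge[OF e(1)] pair_index_mem e(2) by (auto simp: card_image)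
    qed
    show "card {e'\<in>?R. x \<in> e'} \<le> 2 * D'" for x
    proof -
      have "{e'\<in>?R. x \<in> e'} \<subseteq> (\<lambda>e. pair_index ` e) ` ({e\<in>R. 2 * x - 1 \<in> e} \<union> {e\<in>R. 2 * x \<in> e})"
      proof
        fix e' assume "e' \<in> {e'\<in>?R. x \<in> e'}"
        then obtain e u where "e \<in> R" "e' = pair_index ` e" "u \<in> e" "pair_index u = x" by auto
        then show "e' \<in> (\<lambda>e. pair_index ` e) ` ({e\<in>R. 2 * x - 1 \<in> e} \<union> {e\<in>R. 2 * x \<in> e})"
          unfolding pair_index_eq_iff by auto
      qed
      moreover have finR: "finite R" using RE finite_E finite_subset by blast
      ultimately have "card {e'\<in>?R. x \<in> e'} \<le> card ((\<lambda>e. pair_index ` e) ` ({e\<in>R. 2 * x - 1 \<in> e} \<union> {e\<in>R. 2 * x \<in> e}))"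
        by (intro card_mono) auto
      also have "\<dots> \<le> card ({e\<in>R. 2 * x - 1 \<in> e} \<union> {e\<in>R. 2 * x \<in> e})" using finR by (intro card_image_le) auto
      also have "\<dots> \<le> degree R (2 * x - 1) + degree R (2 * x)" unfolding degree_def by (rule card_Un_le)
      also have "\<dots> \<le> D' + D'" by (intro add_mono R(2))
      finally show ?thesis by simp
    qed
    show "0 \<le> p" using p1 \<delta> by (meson divide_nonneg_nonneg exp_ge_zero order_trans diff_ge_0_iff_ge less_imp_le zero_le_power)
  qed (use \<delta> small C in auto)
  then obtain c where c: "c \<in> PiE {1..n div 2} (\<lambda>_. C)"
    and c1: "\<forall>i\<in>I. real (card {x\<in>?N i. c x \<in> fst (snd i)})
        \<le> real (card (fst (snd i))) / real (card C) * real (card (?N i)) + (if snd (snd i) then t1 else t2)"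
    and c2: "\<forall>x y. {x, y} \<in> ?R \<longrightarrow> c x \<noteq> c y" by blast
  have cnt: "real (card {u\<in>N v (G, b). c (pair_index u) \<in> G}) \<le> real (card G) / real (card C) * real (card (N v (G, b))) + (if b then t1 else t2)"
    if "v \<in> {1..n}" "G \<in> \<G>" for v G b
  proof -
    have "{x\<in>pair_index ` N v (G, b). c x \<in> G} = pair_index ` {u\<in>N v (G, b). c (pair_index u) \<in> G}" by auto
    moreover have "inj_on pair_index {u\<in>N v (G, b). c (pair_index u) \<in> G}" using inj_N by (rule inj_on_subset) auto
    ultimately have "card {x\<in>pair_index ` N v (G, b). c x \<in> G} = card {u\<in>N v (G, b). c (pair_index u) \<in> G}" by (simp add: card_image)
    moreover have "(v, G, b) \<in> I" using that by (simp add: I_def)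
    ultimately show ?thesis using bspec[OF c1, of "(v, G, b)"] by (simp add: card_N)
  qed
  show ?thesis
  proof (intro exI[of _ c] conjI ballI allI impI)
    show "c x \<in> C" if "x \<in> {1..n div 2}" for x using c that by (auto simp: PiE_iff)
    fix v G assume vG: "v \<in> {1..n}" "G \<in> \<G>"
    show "real (card {u\<in>cross_nbrs A v. c (pair_index u) \<in> G}) \<le> real (card G) / real (card C) * real (card (cross_nbrs A v)) + t1"
      using cnt[OF vG, of True] by (simp add: N_def)
    show "real (card {u. {u, v} \<in> F \<and> c (pair_index u) \<in> G}) \<le> real (card G) / real (card C) * real (degree F v) + t2"
      using cnt[OF vG, of False] by (simp add: N_def deg_F)
  next
    fix u v assume "{u, v} \<in> R"
    then have "pair_index ` {u, v} \<in> ?R" by (rule imageI)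
    then show "c (pair_index u) \<noteq> c (pair_index v)" using c2 by simp
  qed
qed

end

section \<open>The sparse round\<close>

text \<open>If a largest admissible set \<open>F\<close> has fewer than \<open>x\<close> edges,
  every other edge has an end that already has degree \<open>s\<close> in \<open>F\<close>. There
  are at most \<open>2 * card F / s\<close> such vertices, each on at most \<open>\<Delta>\<close>
  edges, so \<open>C\<close> would be too small. It serves to delete surplus edges without harming
  any single degree.\<close>

lemma exists_spread_subset:
  assumes fin: "finite C" and two: "\<And>e. e \<in> C \<Longrightarrow> finite e \<and> card e = 2" and deg: "\<And>v. degree C v \<le> \<Delta>"
    and s: "s > 0" and big: "x * (s + 2 * \<Delta>) \<le> s * card C"
  shows "\<exists>F\<subseteq>C. card F = x \<and> (\<forall>v. degree F v \<le> s)"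
proof -
  define \<F> where "\<F> = {F. F \<subseteq> C \<and> card F \<le> x \<and> (\<forall>v. degree F v \<le> s)}"
  have "finite \<F>" using fin by (auto simp: \<F>_def)
  moreover have "{} \<in> \<F>" by (auto simp: \<F>_def degree_def)
  ultimately have fin\<F>: "finite (card ` \<F>)" "card ` \<F> \<noteq> {}" by auto
  obtain F where F: "F \<in> \<F>" "card F = Max (card ` \<F>)" using Max_in[OF fin\<F>] by auto
  have Fmax: "card F' \<le> card F" if "F' \<in> \<F>" for F'
    unfolding F(2) using fin\<F>(1) that by (intro Max_ge) auto
  have FC: "F \<subseteq> C" "card F \<le> x" "\<And>v. degree F v \<le> s" using F(1) by (auto simp: \<F>_def)
  have finF: "finite F" using FC(1) fin finite_subset by blast
  have "card F = x"
  proof (rule ccontr)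
    assume "card F \<noteq> x"
    then have lt: "card F < x" using FC by simp
    define T where "T = {v\<in>\<Union>C. degree F v = s}"
    have finT: "finite T" using fin two by (auto simp: T_def)
    have "C - F \<subseteq> (\<Union>v\<in>T. {e\<in>C. v \<in> e})"
    proof
      fix e assume e: "e \<in> C - F"
      have "card (insert e F) = card F + 1" using e finF by simp
      then have "insert e F \<notin> \<F>" using Fmax[of "insert e F"] by auto
      then obtain v where v: "degree (insert e F) v > s" using e lt FC(1) finF by (auto simp: \<F>_def not_le)
      have "v \<in> e"
      proof (rule ccontr)
        assume "v \<notin> e"
        then have "{e'\<in>insert e F. v \<in> e'} = {e'\<in>F. v \<in> e'}" by auto
        then show False using v FC(3)[of v] by (simp add: degree_def)
      qed
      then have "{e'\<in>insert e F. v \<in> e'} = insert e {e'\<in>F. v \<in> e'}" by auto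
      then have "degree (insert e F) v \<le> degree F v + 1" using finF by (simp add: degree_def card_insert_if)
      then have "degree F v = s" using v FC(3)[of v] by simp
      then show "e \<in> (\<Union>v\<in>T. {e\<in>C. v \<in> e})" using e \<open>v \<in> e\<close> by (auto simp: T_def)
    qed
    then have "card (C - F) \<le> card (\<Union>v\<in>T. {e\<in>C. v \<in> e})" using finT fin by (intro card_mono) auto
    also have "\<dots> \<le> (\<Sum>v\<in>T. card {e\<in>C. v \<in> e})" by (rule card_UN_le[OF finT])
    also have "\<dots> \<le> (\<Sum>v\<in>T. \<Delta>)" using deg by (intro sum_mono) (simp add: degree_def)
    finally have "card (C - F) \<le> card T * \<Delta>" by simp
    moreover have "card C = card F + card (C - F)" using FC(1) fin finF by (simp add: card_Diff_subset card_mono)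
    ultimately have "s * card C \<le> s * card F + s * card T * \<Delta>" by (simp add: distrib_left mult.assoc)
    moreover have "s * card T \<le> 2 * card F"
    proof -
      have "s * card T = (\<Sum>v\<in>T. degree F v)" by (simp add: T_def)
      also have "\<dots> = (\<Sum>e\<in>F. card (e \<inter> T))" by (rule sum_degree_eq[OF finF finT])
      also have "\<dots> \<le> (\<Sum>e\<in>F. 2)"
      proof (rule sum_mono)
        fix e assume "e \<in> F"
        then have "finite e \<and> card e = 2" using FC(1) two by auto
        then show "card (e \<inter> T) \<le> 2" by (metis card_mono inf_le1)
      qed
      finally show ?thesis by simp
    qed
    then have "s * card T * \<Delta> \<le> 2 * card F * \<Delta>" by (rule mult_right_mono) simp
    ultimately have "s * card C \<le> s * card F + 2 * card F * \<Delta>" by linarith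
    then have "s * card C \<le> card F * (s + 2 * \<Delta>)" by (simp add: algebra_simps)
    also have "\<dots> < x * (s + 2 * \<Delta>)" using lt s by (intro mult_strict_right_mono) auto
    finally show False using big by simp
  qed
  then show ?thesis using FC by blast
qed

section \<open>Labels of the pairs and the cuts they define\<close>

lemma card_half_by_involution:
  assumes "finite C" and \<tau>: "\<And>x. x \<in> C \<Longrightarrow> \<tau> x \<in> C \<and> \<tau> (\<tau> x) = x \<and> (P (\<tau> x) \<longleftrightarrow> \<not> P x)"
  shows "2 * card {x\<in>C. P x} = card C" "2 * card {x\<in>C. \<not> P x} = card C"
proof -
  have "bij_betw \<tau> {x\<in>C. P x} {x\<in>C. \<not> P x}"
    by (rule bij_betw_byWitness[where f' = \<tau>]) (use \<tau> in auto)
  then have "card {x\<in>C. P x} = card {x\<in>C. \<not> P x}" by (rule bij_betw_same_card)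
  moreover have "card C = card {x\<in>C. P x} + card {x\<in>C. \<not> P x}"
    using assms(1) by (subst card_Un_disjoint[symmetric]) (auto intro: arg_cong[of _ _ card])
  ultimately show "2 * card {x\<in>C. P x} = card C" "2 * card {x\<in>C. \<not> P x} = card C" by auto
qed

definition toggle :: "nat \<Rightarrow> nat set \<Rightarrow> nat set" where
  "toggle j a = (if j \<in> a then a - {j} else insert j a)"

lemma toggle_mem: "i \<in> toggle j a \<longleftrightarrow> (if i = j then j \<notin> a else i \<in> a)"
  by (auto simp: toggle_def)

lemma toggle_Pow: "j < k \<Longrightarrow> a \<in> Pow {..<k} \<Longrightarrow> toggle j a \<in> Pow {..<k} \<and> toggle j (toggle j a) = a"
  by (auto simp: toggle_def)

locale halved_expander = expander +
  fixes A :: "nat set" and t :: real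
  assumes A_sub: "A \<subseteq> {1..n}" and card_A: "2 * card A = n"
    and inj_A: "inj_on pair_index A" and inj_B: "inj_on pair_index ({1..n} - A)"
    and t_nonneg: "0 \<le> t" and t_le: "t \<le> real d / 400"
    and card_cross_nbrs: "\<And>v. v \<in> {1..n} \<Longrightarrow> \<bar>real (card (cross_nbrs A v)) - real d / 2\<bar> \<le> 2 * t"
begin

lemma finite_A: "finite A" using A_sub finite_subset by blast

lemma card_B: "card ({1..n} - A) = card A"
  using A_sub finite_A card_A by (simp add: card_Diff_subset)

lemma pair_index_image_side:
  assumes "Q = A \<or> Q = {1..n} - A"
  shows "pair_index ` Q = {1..n div 2}" "inj_on pair_index Q"
proof -
  show inj: "inj_on pair_index Q" using assms inj_A inj_B by auto
  have "card Q = n div 2" using assms card_A card_B by auto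
  then have "card (pair_index ` Q) = card {1..n div 2}" using inj by (simp add: card_image)
  moreover have "pair_index ` Q \<subseteq> {1..n div 2}" using assms A_sub pair_index_mem by auto
  ultimately show "pair_index ` Q = {1..n div 2}" by (intro card_subset_eq) auto
qed

text \<open>The label is read with opposite sign on the two sides. So the two vertices of a pair are
  separated by the cut, which makes it balanced, while an edge within one side crosses it exactly
  when the labels of its ends differ.\<close>

definition cut :: "(nat \<Rightarrow> bool) \<Rightarrow> nat set" where
  "cut l = {u\<in>{1..n}. (u \<in> A) = l (pair_index u)}"

text \<open>Upper deviations for both label values give lower ones as well, since the two classes
  partition the neighbours on the other side. The error \<open>t\<close> from the size of
  \<open>cross_nbrs\<close> and the error \<open>t1\<close> share the margin
  \<open>d / 200\<close>.\<close>

lemma good_cut_cut: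
  assumes t1: "t + t1 \<le> real d / 200"
    and l: "\<And>v b. v \<in> {1..n} \<Longrightarrow> real (card {u\<in>cross_nbrs A v. l (pair_index u) = b}) \<le> real (card (cross_nbrs A v)) / 2 + t1"
  shows "good_cut A (cut l)"
proof -
  have "card (A \<inter> cut l) = card ({1..n} - A - cut l)"
  proof -
    have side: "card {u\<in>Q. l (pair_index u)} = card {x\<in>{1..n div 2}. l x}" if "Q = A \<or> Q = {1..n} - A" for Q
    proof -
      have "{x\<in>{1..n div 2}. l x} = pair_index ` {u\<in>Q. l (pair_index u)}" using pair_index_image_side(1)[OF that] by auto
      moreover have "inj_on pair_index {u\<in>Q. l (pair_index u)}" using pair_index_image_side(2)[OF that] by (rule inj_on_subset) auto
      ultimately show ?thesis by (simp add: card_image)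
    qed
    have "A \<inter> cut l = {u\<in>A. l (pair_index u)}" using A_sub by (auto simp: cut_def)
    moreover have "{1..n} - A - cut l = {u\<in>{1..n} - A. l (pair_index u)}" by (auto simp: cut_def)
    ultimately show ?thesis using side[of A] side[of "{1..n} - A"] by simp
  qed
  moreover have "245 / 1000 * real d \<le> real (card (cross_nbrs A v \<inter> cut l)) \<and> real (card (cross_nbrs A v \<inter> cut l)) \<le> 255 / 1000 * real d \<and>
      245 / 1000 * real d \<le> real (card (cross_nbrs A v - cut l)) \<and> real (card (cross_nbrs A v - cut l)) \<le> 255 / 1000 * real d"
    if v: "v \<in> {1..n}" for v
  proof -
    define b where "b \<longleftrightarrow> v \<notin> A"
    have "cross_nbrs A v \<inter> cut l = {u\<in>cross_nbrs A v. l (pair_index u) = b}" using cross_nbrs_subset[of A v] by (auto simp: cut_def cross_nbrs_def b_def)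
    moreover have "cross_nbrs A v - cut l = {u\<in>cross_nbrs A v. l (pair_index u) = (\<not> b)}" using cross_nbrs_subset[of A v] by (auto simp: cut_def cross_nbrs_def b_def)
    ultimately have "real (card (cross_nbrs A v \<inter> cut l)) \<le> real (card (cross_nbrs A v)) / 2 + t1" "real (card (cross_nbrs A v - cut l)) \<le> real (card (cross_nbrs A v)) / 2 + t1"
      using l[OF v] by auto
    moreover have "real (card (cross_nbrs A v)) = real (card (cross_nbrs A v \<inter> cut l)) + real (card (cross_nbrs A v - cut l))"
      using card_Int_Diff[OF finite_cross_nbrs[of A v], of "cut l"] by simp
    moreover have "real (card (cross_nbrs A v)) \<le> real d / 2 + 2 * t" "real d / 2 - 2 * t \<le> real (card (cross_nbrs A v))"
      using card_cross_nbrs[OF v] by linarith+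
    ultimately show ?thesis using t1 by (intro conjI; linarith)
  qed
  ultimately show ?thesis by (auto simp: good_cut_def cut_def)
qed

lemma internal_same_side: "{u, v} \<in> internal A \<Longrightarrow> u \<in> {1..n} \<and> v \<in> {1..n} \<and> u \<noteq> v \<and> (u \<in> A \<longleftrightarrow> v \<in> A)"
  using edge_vertices by (auto simp: internal_def)

lemma internal_pair:
  assumes "e \<in> internal A"
  obtains u v where "e = {u, v}"
proof -
  have "e \<in> E" using assms by (auto simp: internal_def)
  then have "\<exists>u v. e = {u, v}" using simple unfolding simple_graph_def by blast
  then show ?thesis using that by blast
qed

lemma card_Int_cut:
  assumes "{u, v} \<in> internal A"
  shows "card ({u, v} \<inter> cut l) = 1 \<longleftrightarrow> l (pair_index u) \<noteq> l (pair_index v)"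
proof -
  note uv = internal_same_side[OF assms]
  have "u \<in> cut l \<longleftrightarrow> (u \<in> A) = l (pair_index u)" "v \<in> cut l \<longleftrightarrow> (v \<in> A) = l (pair_index v)" using uv by (auto simp: cut_def)
  moreover have "{u, v} \<inter> cut l = (if u \<in> cut l then {u} else {}) \<union> (if v \<in> cut l then {v} else {})" by auto
  ultimately show ?thesis using uv by auto
qed

lemma sum_degree_side:
  assumes F: "F \<subseteq> internal A" and Q: "Q = A \<or> Q = {1..n} - A"
  shows "(\<Sum>v\<in>Q. degree F v) = 2 * card {e\<in>F. e \<subseteq> Q}"
proof -
  have FE: "F \<subseteq> E" using F by (auto simp: internal_def)
  have fin: "finite F" "finite Q" using FE finite_E finite_subset Q finite_A by auto
  have "(\<Sum>v\<in>Q. degree F v) = (\<Sum>e\<in>F. card (e \<inter> Q))" by (rule sum_degree_eq[OF fin])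
  also have "\<dots> = (\<Sum>e\<in>F. if e \<subseteq> Q then 2 else 0)"
  proof (intro sum.cong refl)
    fix e assume e: "e \<in> F"
    then have edge: "e \<subseteq> {1..n}" "card e = 2" using simple_graph_edge[OF simple] FE by blast+
    have "e \<subseteq> Q \<or> e \<inter> Q = {}" using e F edge(1) Q by (auto simp: internal_def)
    moreover have "e \<noteq> {}" using edge(2) by auto
    ultimately show "card (e \<inter> Q) = (if e \<subseteq> Q then 2 else 0)" using edge(2) by (auto simp: Int_absorb2)
  qed
  also have "\<dots> = 2 * card {e\<in>F. e \<subseteq> Q}" using fin by (simp add: sum.If_cases Int_def)
  finally show ?thesis .
qed

lemma outside_iff: "e \<in> internal A \<Longrightarrow> e \<inter> A = {} \<longleftrightarrow> e \<subseteq> {1..n} - A"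
  using simple_graph_edge[OF simple, of e] by (auto simp: internal_def)

lemma outside_eq: "F \<subseteq> internal A \<Longrightarrow> {e\<in>F. e \<inter> A = {}} = {e\<in>F. e \<subseteq> {1..n} - A}"
  using outside_iff by blast

lemma finite_internal: "finite (internal A)"
  using finite_E by (auto simp: internal_def)

lemma sides_Un: "F \<subseteq> internal A \<Longrightarrow> F = {e\<in>F. e \<subseteq> A} \<union> {e\<in>F. e \<inter> A = {}}"
  by (auto simp: internal_def)

lemma sides_disjoint: "F \<subseteq> internal A \<Longrightarrow> {e\<in>F. e \<subseteq> A} \<inter> {e\<in>F. e \<inter> A = {}} = {}"
  using simple_graph_edge(4)[OF simple] by (fastforce simp: internal_def)

text \<open>An edge inside a side fails to cross exactly when its ends have equal labels, so the
  bound at each vertex can be summed over the side.\<close>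

lemma noncrossing_le:
  fixes l :: "nat \<Rightarrow> bool"
  assumes R: "R \<subseteq> internal A" and Q: "Q = A \<or> Q = {1..n} - A"
    and same: "\<And>v b. v \<in> {1..n} \<Longrightarrow> real (card {u. {u, v} \<in> R \<and> l (pair_index u) = b}) \<le> 11 / 20 * real (degree R v)"
  shows "real (card {e\<in>R. e \<subseteq> Q \<and> card (e \<inter> cut l) \<noteq> 1}) \<le> 11 / 20 * real (card {e\<in>R. e \<subseteq> Q})"
proof -
  define Y where "Y = {e\<in>R. card (e \<inter> cut l) \<noteq> 1}"
  have Y: "Y \<subseteq> internal A" using R by (auto simp: Y_def)
  have YE: "Y \<subseteq> E" using Y by (auto simp: internal_def)
  have "2 * real (card {e\<in>Y. e \<subseteq> Q}) = (\<Sum>v\<in>Q. real (degree Y v))"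
    using sum_degree_side[OF Y Q] by (simp flip: of_nat_sum)
  also have "\<dots> \<le> (\<Sum>v\<in>Q. 11 / 20 * real (degree R v))"
  proof (rule sum_mono)
    fix v assume "v \<in> Q"
    then have v: "v \<in> {1..n}" using Q A_sub by auto
    have "degree Y v = card {u. {u, v} \<in> Y}"
      by (rule degree_eq_card_neighbours[OF simple_graph_subset[OF simple YE]])
    also have "{u. {u, v} \<in> Y} = {u. {u, v} \<in> R \<and> l (pair_index u) = l (pair_index v)}"
    proof -
      have "{u, v} \<in> Y \<longleftrightarrow> {u, v} \<in> R \<and> l (pair_index u) = l (pair_index v)" for u
        using card_Int_cut[of u v l] R unfolding Y_def by blast
      then show ?thesis by simp
    qed
    finally show "real (degree Y v) \<le> 11 / 20 * real (degree R v)" using same[OF v] by simp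
  qed
  also have "\<dots> = 11 / 20 * real (\<Sum>v\<in>Q. degree R v)" by (simp only: of_nat_sum sum_distrib_left)
  also have "\<dots> = 11 / 20 * (2 * real (card {e\<in>R. e \<subseteq> Q}))" by (simp only: sum_degree_side[OF R Q] of_nat_mult of_nat_numeral)
  finally have "real (card {e\<in>Y. e \<subseteq> Q}) \<le> 11 / 20 * real (card {e\<in>R. e \<subseteq> Q})" by simp
  moreover have "{e\<in>Y. e \<subseteq> Q} = {e\<in>R. e \<subseteq> Q \<and> card (e \<inter> cut l) \<noteq> 1}" by (auto simp: Y_def)
  ultimately show ?thesis by simp
qed

text \<open>
Label \<open>k\<close> is the exclusive or of labels \<open>0\<close> and \<open>1\<close>, so an edge crossing one of these three crosses exactly two.
Any two of them therefore catch clearly more than half of the edges, although a single label may catch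
slightly less than half; this is what Hall's condition needs.
\<close>

lemma balanced_partition:
  fixes l :: "nat \<Rightarrow> nat \<Rightarrow> bool"
  assumes R: "R \<subseteq> internal A" and balanced: "card {e\<in>R. e \<subseteq> A} = card {e\<in>R. e \<inter> A = {}}"
    and proper: "\<And>u v. {u, v} \<in> R \<Longrightarrow> \<exists>j\<le>k. l j (pair_index u) \<noteq> l j (pair_index v)"
    and xor: "\<And>x. l k x = (l 0 x \<noteq> l 1 x)" and k: "k \<ge> 2"
    and same: "\<And>v b j. v \<in> {1..n} \<Longrightarrow> j \<le> k \<Longrightarrow> real (card {u. {u, v} \<in> R \<and> l j (pair_index u) = b}) \<le> 11 / 20 * real (degree R v)"
  shows "\<exists>P. (\<forall>j\<le>k. P j \<subseteq> R \<and> (\<forall>e\<in>P j. card (e \<inter> cut (l j)) = 1) \<and> card {e\<in>P j. e \<subseteq> A} = card {e\<in>P j. e \<inter> A = {}}) \<and>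
    (\<forall>i\<le>k. \<forall>j\<le>k. i \<noteq> j \<longrightarrow> P i \<inter> P j = {}) \<and> (\<Union>j\<le>k. P j) = R"
proof -
  have finR: "finite R" using R finite_internal finite_subset by blast
  define RA where "RA = {e\<in>R. e \<subseteq> A}"
  define RB where "RB = {e\<in>R. e \<inter> A = {}}"
  define m where "m = real (card RA)"
  have m: "real (card RA) = m" "real (card RB) = m" using balanced by (auto simp: m_def RA_def RB_def)
  have RAB: "RA \<union> RB = R" "RA \<inter> RB = {}" using sides_Un[OF R] sides_disjoint[OF R] by (auto simp: RA_def RB_def)
  have fin: "finite RA" "finite RB" using finR by (auto simp: RA_def RB_def)
  define X where "X j = {e\<in>R. card (e \<inter> cut (l j)) = 1}" for j
  have X_pair: "{u, v} \<in> X j \<longleftrightarrow> l j (pair_index u) \<noteq> l j (pair_index v)" if "{u, v} \<in> R" for u v j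
    using card_Int_cut[of u v "l j"] that R by (auto simp: X_def)
  have X_ex: "\<exists>j\<le>k. e \<in> X j" if e: "e \<in> R" for e
  proof -
    obtain u v where "e = {u, v}" using internal_pair e R by blast
    then show ?thesis using proper[of u v] X_pair[of u v] e by blast
  qed
  have X_xor: "e \<in> X k \<longleftrightarrow> (e \<in> X 0 \<longleftrightarrow> e \<notin> X 1)" if e: "e \<in> R" for e
  proof -
    obtain u v where uv: "e = {u, v}" using internal_pair e R by blast
    then have "{u, v} \<in> R" using e by simp
    then show ?thesis unfolding uv X_pair[OF \<open>{u, v} \<in> R\<close>] xor by blast
  qed
  have non: "real (card (Q - X j)) \<le> 11 / 20 * m" if "Q = RA \<or> Q = RB" "j \<le> k" for Q j
  proof -
    have "RA - X j = {e\<in>R. e \<subseteq> A \<and> card (e \<inter> cut (l j)) \<noteq> 1}" by (auto simp: RA_def X_def)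
    moreover have "RB - X j = {e\<in>R. e \<subseteq> {1..n} - A \<and> card (e \<inter> cut (l j)) \<noteq> 1}"
      using outside_eq[OF R] by (auto simp: RB_def X_def)
    moreover have "RB = {e\<in>R. e \<subseteq> {1..n} - A}" using outside_eq[OF R] by (simp add: RB_def)
    ultimately show ?thesis
      using noncrossing_le[OF R, of A "l j"] noncrossing_le[OF R, of "{1..n} - A" "l j"] same that m RA_def by auto
  qed
  have hit: "real (card (Q \<inter> X j)) \<ge> 9 / 20 * m" if "Q = RA \<or> Q = RB" "j \<le> k" for Q j
    using non[OF that] card_Int_Diff[of Q "X j"] fin m that by auto
  define T where "T = {0, 1, k}"
  have hit2: "real (card (Q \<inter> (X i \<union> X i'))) \<ge> 27 / 40 * m"
    if Q: "Q = RA \<or> Q = RB" and i: "i \<in> T" "i' \<in> T" "i \<noteq> i'" for Q i i'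
  proof -
    have QR: "Q \<subseteq> R" "finite Q" using Q fin by (auto simp: RA_def RB_def)
    \<comment> \<open>By the exclusive or, any two of the three classes have the same union, and
      each edge of it lies in exactly two classes:
      \<open>3 * (9 / 20) / 2 = 27 / 40\<close>.\<close>
    define U where "U = Q \<inter> (X 0 \<union> X 1)"
    have finU: "finite U" using QR by (simp add: U_def)
    have "Q \<inter> (X i \<union> X i') = U" using i X_xor QR(1) unfolding T_def U_def by blast
    moreover have "card (Q \<inter> X 0) + card (Q \<inter> X 1) + card (Q \<inter> X k) = 2 * card U"
    proof -
      have c: "card (Q \<inter> X j) = (\<Sum>e\<in>U. if e \<in> X j then 1 else 0)" if "j \<in> T" for j
      proof -
        have "Q \<inter> X j = {e\<in>U. e \<in> X j}" using that X_xor QR(1) unfolding T_def U_def by blast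
        then show ?thesis using finU by (simp add: sum.If_cases Int_def)
      qed
      have "card (Q \<inter> X 0) + card (Q \<inter> X 1) + card (Q \<inter> X k)
         = (\<Sum>e\<in>U. (if e \<in> X 0 then 1 else 0) + (if e \<in> X 1 then 1 else 0) + (if e \<in> X k then 1 else 0))"
        using c[of 0] c[of 1] c[of k] by (simp add: T_def sum.distrib)
      also have "\<dots> = (\<Sum>e\<in>U. 2)"
        using X_xor QR(1) by (intro sum.cong refl) (auto simp: U_def)
      finally show ?thesis by simp
    qed
    then have "real (card (Q \<inter> X 0)) + real (card (Q \<inter> X 1)) + real (card (Q \<inter> X k)) = 2 * real (card U)"
      by (metis of_nat_add of_nat_mult of_nat_numeral)
    ultimately show ?thesis using hit[OF Q, of 0] hit[OF Q, of 1] hit[OF Q, of k] k by simp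
  qed
  define r where "r e e' \<longleftrightarrow> (\<exists>j\<le>k. e \<in> X j \<and> e' \<in> X j)" for e e'
  have "\<exists>\<phi>. bij_betw \<phi> RA RB \<and> (\<forall>e\<in>RA. r e (\<phi> e))"
  proof (rule hall_bijection[OF fin])
    show "card RA = card RB" using balanced by (simp add: RA_def RB_def)
    fix X' assume X': "X' \<subseteq> RA"
    let ?N = "{e'\<in>RB. \<exists>e\<in>X'. r e e'}"
    have finN: "finite ?N" using fin by simp
    define J where "J = {j. j \<le> k \<and> (\<exists>e\<in>X'. e \<in> X j)}"
    have N_hit: "RB \<inter> X j \<subseteq> ?N" if "j \<in> J" for j using that by (auto simp: J_def r_def)
    have miss: "X' \<subseteq> RA - X j" if "j \<notin> J" "j \<le> k" for j using that X' by (auto simp: J_def)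
    have finX': "finite X'" using X' fin finite_subset by blast
    have X'_le: "card X' \<le> card S" if "X' \<subseteq> S" "S \<subseteq> RA" for S
      using that fin finite_subset by (intro card_mono) auto
    have N_ge: "card S \<le> card ?N" if "S \<subseteq> ?N" for S using that finN by (rule card_mono[rotated])
    show "card X' \<le> card ?N"
    proof (cases "X' = {}")
      case False
      then obtain e0 where e0: "e0 \<in> X'" by blast
      then obtain j0 where "j0 \<le> k" "e0 \<in> X j0" using X_ex[of e0] X' RAB(1) by blast
      then have j0: "j0 \<in> J" using e0 by (auto simp: J_def)
      have j0k: "j0 \<le> k" using j0 by (simp add: J_def)
      have m0: "m \<ge> 0" by (simp add: m_def)
      \<comment> \<open>Of the three labels, two lie in \<open>J\<close> or two lie outside. In the
        first case \<open>X'\<close> has at least \<open>27 / 40 * m\<close> neighbours, while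
        missing any label caps \<open>X'\<close> at \<open>22 / 40 * m\<close>. In the second,
        \<open>X'\<close> has at most \<open>13 / 40 * m\<close> elements, and the label
        \<open>j0\<close> alone yields \<open>18 / 40 * m\<close> neighbours.\<close>
      consider "\<exists>i\<in>T. \<exists>i'\<in>T. i \<noteq> i' \<and> i \<in> J \<and> i' \<in> J" | "\<exists>i\<in>T. \<exists>i'\<in>T. i \<noteq> i' \<and> i \<notin> J \<and> i' \<notin> J"
        using k unfolding T_def by auto
      then show ?thesis
      proof cases
        case 1
        then obtain i i' where i: "i \<in> T" "i' \<in> T" "i \<noteq> i'" "i \<in> J" "i' \<in> J" by blast
        show ?thesis
        proof (cases "\<forall>j\<le>k. j \<in> J")
          case True
          have "RB \<subseteq> ?N"
          proof
            fix e' assume e': "e' \<in> RB"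
            then obtain j where "j \<le> k" "e' \<in> X j" using X_ex[of e'] RAB(1) by blast
            then show "e' \<in> ?N" using N_hit[of j] True e' by blast
          qed
          then have "card RB \<le> card ?N" by (rule N_ge)
          then show ?thesis using X'_le[OF X' order_refl] balanced by (simp add: RA_def RB_def)
        next
          case False
          then obtain j where j: "j \<le> k" "j \<notin> J" by blast
          have "card X' \<le> card (RA - X j)" using miss[OF j(2,1)] by (intro X'_le) auto
          moreover have "card (RB \<inter> (X i \<union> X i')) \<le> card ?N" using N_hit[OF i(4)] N_hit[OF i(5)] by (intro N_ge) blast
          ultimately have "real (card X') \<le> real (card ?N)"
            using non[OF disjI1[OF refl] j(1)] hit2[OF disjI2[OF refl] i(1,2,3)] m0 by linarith
          then show ?thesis by simp
        qed
      next
        case 2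
        then obtain i i' where i: "i \<in> T" "i' \<in> T" "i \<noteq> i'" "i \<notin> J" "i' \<notin> J" by blast
        have ik: "i \<le> k" "i' \<le> k" using i k by (auto simp: T_def)
        have "card X' \<le> card (RA - (X i \<union> X i'))" using miss[OF i(4) ik(1)] miss[OF i(5) ik(2)] by (intro X'_le) auto
        moreover have "card RA = card (RA \<inter> (X i \<union> X i')) + card (RA - (X i \<union> X i'))" using fin(1) by (rule card_Int_Diff)
        moreover have "card (RB \<inter> X j0) \<le> card ?N" using N_hit[OF j0] by (rule N_ge)
        ultimately have "real (card X') \<le> real (card ?N)"
          using hit2[OF disjI1[OF refl] i(1,2,3)] hit[OF disjI2[OF refl] j0k] m(1) m0 by linarith
        then show ?thesis by simp
      qed
    qed simp
  qed
  then obtain \<phi> where \<phi>: "bij_betw \<phi> RA RB" "\<And>e. e \<in> RA \<Longrightarrow> r e (\<phi> e)" by blast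
  define g where "g e = (SOME j. j \<le> k \<and> e \<in> X j \<and> \<phi> e \<in> X j)" for e
  have g: "g e \<le> k \<and> e \<in> X (g e) \<and> \<phi> e \<in> X (g e)" if "e \<in> RA" for e
    unfolding g_def using \<phi>(2)[OF that] unfolding r_def by (rule someI_ex)
  have \<phi>_mem: "\<phi> e \<in> RB" if "e \<in> RA" for e using \<phi>(1) that by (auto simp: bij_betw_def)
  have \<phi>_inj: "inj_on \<phi> RA" using \<phi>(1) by (simp add: bij_betw_def)
  define P where "P j = {e\<in>RA. g e = j} \<union> \<phi> ` {e\<in>RA. g e = j}" for j
  have PR: "P j \<subseteq> R" for j using \<phi>_mem RAB(1) by (auto simp: P_def)
  have PA: "{e\<in>P j. e \<subseteq> A} = {e\<in>RA. g e = j}" for j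
  proof -
    have "\<not> e \<subseteq> A" if "e \<in> RB" for e using that RAB(2) by (auto simp: RA_def RB_def)
    then show ?thesis using \<phi>_mem by (auto simp: P_def RA_def)
  qed
  have PB: "{e\<in>P j. e \<inter> A = {}} = \<phi> ` {e\<in>RA. g e = j}" for j
  proof -
    have "e \<inter> A \<noteq> {}" if "e \<in> RA" for e using that RAB(2) by (auto simp: RA_def RB_def)
    then show ?thesis using \<phi>_mem by (auto simp: P_def RB_def)
  qed
  have "card {e\<in>P j. e \<subseteq> A} = card {e\<in>P j. e \<inter> A = {}}" for j
    unfolding PA PB by (rule card_image[symmetric]) (rule inj_on_subset[OF \<phi>_inj], auto)
  moreover have "card (e \<inter> cut (l j)) = 1" if "e \<in> P j" for e j
    using that g unfolding P_def by (auto simp: X_def)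
  moreover have "P i \<inter> P j = {}" if "i \<noteq> j" for i j
  proof -
    have "\<phi> e \<noteq> e'" if "e \<in> RA" "e' \<in> RA" for e e' using \<phi>_mem[OF that(1)] that(2) RAB(2) by blast
    moreover have "\<phi> e = \<phi> e' \<Longrightarrow> e = e'" if "e \<in> RA" "e' \<in> RA" for e e' using \<phi>_inj that by (auto simp: inj_on_def)
    ultimately show ?thesis using that unfolding P_def by (auto; metis)
  qed
  moreover have "(\<Union>j\<le>k. P j) = R"
  proof
    show "(\<Union>j\<le>k. P j) \<subseteq> R" using PR by blast
    show "R \<subseteq> (\<Union>j\<le>k. P j)"
    proof
      fix e assume "e \<in> R"
      then consider "e \<in> RA" | e' where "e' \<in> RA" "e = \<phi> e'" using RAB(1) \<phi>(1) by (auto simp: bij_betw_def)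
      then show "e \<in> (\<Union>j\<le>k. P j)"
      proof cases
        case 1 then show ?thesis using g[OF 1] by (auto simp: P_def)
      next
        case 2 then show ?thesis using g[OF 2(1)] by (auto simp: P_def)
      qed
    qed
  qed
  ultimately show ?thesis using PR by (intro exI[of _ P]) blast
qed

text \<open>With \<open>2 ^ 25 * D\<close> colours or more, properness contributes at most
  \<open>\<delta> / 2\<close> to the local sum. The deviation \<open>D / 40\<close> is at most a
  twentieth of each degree, which gives 11/20. As all degrees are at most \<open>D \<le> w\<close>,
  the window may start at 0. The extra label, the exclusive or of bits 0 and 1, makes
  \<open>k + 1\<close> pieces out of \<open>k\<close> bits.\<close>

lemma sparse_pieces:
  fixes p \<delta> :: real
  assumes R: "R \<subseteq> internal A" and balanced: "card {e\<in>R. e \<subseteq> A} = card {e\<in>R. e \<inter> A = {}}"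
    and deg_le: "\<And>v. degree R v \<le> D" and deg_ge: "\<And>v. v \<in> {1..n} \<Longrightarrow> D \<le> 2 * degree R v" and D: "D > 0" "D \<le> w"
    and k: "k \<ge> 2" "2 ^ 25 * D \<le> 2 ^ k" and \<delta>: "\<delta> = 1 / 2 ^ 22"
    and p1: "exp (- (real d / 400)\<^sup>2 / (4 * real d)) / (1 - \<delta>) ^ d \<le> p"
    and p2: "exp (- (real D / 40)\<^sup>2 / (4 * real D)) / (1 - \<delta>) ^ D \<le> p"
    and small: "real (4 * d * (2 * (k + 1))) * p \<le> \<delta> / 2"
  shows "\<exists>P S. (\<forall>j\<le>k. piece A w (P j) (S j) 0) \<and>
    (\<forall>i\<le>k. \<forall>j\<le>k. i \<noteq> j \<longrightarrow> P i \<inter> P j = {}) \<and> (\<Union>j\<le>k. P j) = R"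
proof -
  define C where "C = Pow {..<k}"
  define lab where "lab j a \<longleftrightarrow> (if j < k then j \<in> a else (0 \<in> a) \<noteq> (1 \<in> a))" for j and a :: "nat set"
  define \<G> where "\<G> = (\<lambda>(j, b). {a\<in>C. lab j a = b}) ` ({..k} \<times> (UNIV :: bool set))"
  have cardC: "card C = 2 ^ k" "finite C" by (simp_all add: C_def card_Pow)
  have half: "real (card {a\<in>C. lab j a = b}) / real (card C) = 1 / 2" if "j \<le> k" for j b
  proof -
    \<comment> \<open>Toggling bit 0 also flips the exclusive or of bits 0 and 1, so that label
      splits the colours evenly as well.\<close>
    define i where "i = (if j < k then j else 0)"
    have "toggle i a \<in> C \<and> toggle i (toggle i a) = a \<and> (lab j (toggle i a) \<longleftrightarrow> \<not> lab j a)" if "a \<in> C" for a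
      using that toggle_Pow[of i k a] k by (auto simp: C_def i_def lab_def toggle_mem)
    from card_half_by_involution[OF cardC(2) this]
    have "2 * card {a\<in>C. lab j a = b} = card C" by (cases b) simp_all
    then have "2 * real (card {a\<in>C. lab j a = b}) = real (card C)" by (metis of_nat_mult of_nat_numeral)
    then show ?thesis using cardC by (simp add: field_simps)
  qed
  have card\<G>: "card \<G> \<le> 2 * (k + 1)"
  proof -
    have "card \<G> \<le> card ({..k} \<times> (UNIV :: bool set))" unfolding \<G>_def by (rule card_image_le) simp
    then show ?thesis by (simp add: card_cartesian_product card_UNIV_bool)
  qed
  have p0: "p \<ge> 0"
  proof -
    have "0 \<le> exp (- (real d / 400)\<^sup>2 / (4 * real d)) / (1 - \<delta>) ^ d" by (simp add: \<delta>)
    then show ?thesis using p1 by linarith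
  qed
  have "\<exists>c. (\<forall>x\<in>{1..n div 2}. c x \<in> C) \<and>
    (\<forall>v\<in>{1..n}. \<forall>G\<in>\<G>. real (card {u\<in>cross_nbrs A v. c (pair_index u) \<in> G}) \<le> real (card G) / real (card C) * real (card (cross_nbrs A v)) + real d / 400 \<and>
      real (card {u. {u, v} \<in> R \<and> c (pair_index u) \<in> G}) \<le> real (card G) / real (card C) * real (degree R v) + real D / 40) \<and>
    (\<forall>u v. {u, v} \<in> R \<longrightarrow> c (pair_index u) \<noteq> c (pair_index v))"
  proof (rule exists_pair_coloring[OF inj_A inj_B cardC(2) _ _ R deg_le D(1) order_refl deg_le, where \<delta> = \<delta> and p = p])
    have "real (4 * d * card \<G>) * p \<le> real (4 * d * (2 * (k + 1))) * p"
      using card\<G> p0 by (intro mult_right_mono of_nat_mono mult_left_mono) auto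
    moreover have "real (2 * D) / (real (card C) * (1 - \<delta>)\<^sup>2) \<le> \<delta> / 2"
    proof -
      have "(1 - \<delta>)\<^sup>2 \<ge> 1 / 2" by (simp add: \<delta> power2_eq_square)
      have "real (2 ^ 25 * D) \<le> real (2 ^ k)" using k(2) by (rule of_nat_mono)
      then have "2 ^ 25 * real D * (1 / 2) \<le> real (card C) * (1 - \<delta>)\<^sup>2"
        unfolding cardC using \<open>(1 - \<delta>)\<^sup>2 \<ge> 1 / 2\<close> by (intro mult_mono) auto
      then have "real (2 * D) / (real (card C) * (1 - \<delta>)\<^sup>2) \<le> real (2 * D) / (2 ^ 25 * real D * (1 / 2))"
        using D by (intro divide_left_mono mult_pos_pos) (auto simp: cardC \<delta>)
      also have "\<dots> = \<delta> / 2" using D by (simp add: \<delta>)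
      finally show ?thesis .
    qed
    ultimately show "real (4 * d * card \<G>) * p + real (2 * D) / (real (card C) * (1 - \<delta>)\<^sup>2) \<le> \<delta>" using small by linarith
    show "exp (- (real d / 400)\<^sup>2 / (4 * real d)) / (1 - \<delta>) ^ d \<le> p" by (rule p1)
    show "exp (- (real D / 40)\<^sup>2 / (4 * real D)) / (1 - \<delta>) ^ D \<le> p" by (rule p2)
  qed (auto simp: C_def \<G>_def \<delta>)
  then obtain c where c: "\<And>x. x \<in> {1..n div 2} \<Longrightarrow> c x \<in> C"
    and c_cross: "\<And>v G. v \<in> {1..n} \<Longrightarrow> G \<in> \<G> \<Longrightarrow>
      real (card {u\<in>cross_nbrs A v. c (pair_index u) \<in> G}) \<le> real (card G) / real (card C) * real (card (cross_nbrs A v)) + real d / 400"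
    and c_R: "\<And>v G. v \<in> {1..n} \<Longrightarrow> G \<in> \<G> \<Longrightarrow>
      real (card {u. {u, v} \<in> R \<and> c (pair_index u) \<in> G}) \<le> real (card G) / real (card C) * real (degree R v) + real D / 40"
    and c_proper: "\<And>u v. {u, v} \<in> R \<Longrightarrow> c (pair_index u) \<noteq> c (pair_index v)" by blast
  define l where "l j x = lab j (c x)" for j x
  have cC: "c (pair_index u) \<in> C" if "u \<in> {1..n}" for u using c[OF pair_index_mem[OF that]] .
  have G_mem: "{a\<in>C. lab j a = b} \<in> \<G>" if "j \<le> k" for j b using that by (auto simp: \<G>_def)
  have good: "good_cut A (cut (l j))" if j: "j \<le> k" for j
  proof (rule good_cut_cut[where ?t1.0 = "real d / 400"])
    fix v b assume v: "v \<in> {1..n}"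
    have "{u\<in>cross_nbrs A v. l j (pair_index u) = b} = {u\<in>cross_nbrs A v. c (pair_index u) \<in> {a\<in>C. lab j a = b}}"
      using cC cross_nbrs_subset[of A v] by (auto simp: l_def)
    then show "real (card {u\<in>cross_nbrs A v. l j (pair_index u) = b}) \<le> real (card (cross_nbrs A v)) / 2 + real d / 400"
      using c_cross[OF v G_mem[OF j, of b]] half[OF j, of b] by simp
  qed (use t_le in simp)
  have "\<exists>P. (\<forall>j\<le>k. P j \<subseteq> R \<and> (\<forall>e\<in>P j. card (e \<inter> cut (l j)) = 1) \<and> card {e\<in>P j. e \<subseteq> A} = card {e\<in>P j. e \<inter> A = {}}) \<and>
    (\<forall>i\<le>k. \<forall>j\<le>k. i \<noteq> j \<longrightarrow> P i \<inter> P j = {}) \<and> (\<Union>j\<le>k. P j) = R"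
  proof (rule balanced_partition[OF R balanced _ _ k(1)])
    show "\<exists>j\<le>k. l j (pair_index u) \<noteq> l j (pair_index v)" if uv: "{u, v} \<in> R" for u v
    proof -
      have "u \<in> {1..n}" "v \<in> {1..n}" using internal_same_side[of u v] uv R by auto
      then have "c (pair_index u) \<subseteq> {..<k}" "c (pair_index v) \<subseteq> {..<k}" using cC by (auto simp: C_def)
      moreover obtain j where "(j \<in> c (pair_index u)) \<noteq> (j \<in> c (pair_index v))" using c_proper[OF uv] by blast
      ultimately show ?thesis by (intro exI[of _ j]) (auto simp: l_def lab_def)
    qed
    show "l k x = (l 0 x \<noteq> l 1 x)" for x using k by (simp add: l_def lab_def)
    show "real (card {u. {u, v} \<in> R \<and> l j (pair_index u) = b}) \<le> 11 / 20 * real (degree R v)" if v: "v \<in> {1..n}" and j: "j \<le> k" for v b j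
    proof -
      have "{u. {u, v} \<in> R \<and> l j (pair_index u) = b} = {u. {u, v} \<in> R \<and> c (pair_index u) \<in> {a\<in>C. lab j a = b}}"
        using cC internal_same_side R by (auto simp: l_def)
      then have "real (card {u. {u, v} \<in> R \<and> l j (pair_index u) = b}) \<le> 1 / 2 * real (degree R v) + real D / 40"
        using c_R[OF v G_mem[OF j, of b]] half[OF j, of b] by simp
      moreover have "real D \<le> real (2 * degree R v)" using deg_ge[OF v] by (rule of_nat_mono)
      ultimately show ?thesis by simp
    qed
  qed
  then obtain P where P: "\<And>j. j \<le> k \<Longrightarrow> P j \<subseteq> R \<and> (\<forall>e\<in>P j. card (e \<inter> cut (l j)) = 1) \<and> card {e\<in>P j. e \<subseteq> A} = card {e\<in>P j. e \<inter> A = {}}"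
    "\<forall>i\<le>k. \<forall>j\<le>k. i \<noteq> j \<longrightarrow> P i \<inter> P j = {}" "(\<Union>j\<le>k. P j) = R" by blast
  have "piece A w (P j) (cut (l j)) 0" if j: "j \<le> k" for j
  proof -
    have "degree (P j) v \<le> w" for v
    proof -
      have "degree (P j) v \<le> degree R v"
        using P(1)[OF j] finite_subset[OF R finite_internal] by (intro degree_mono) auto
      then show ?thesis using deg_le[of v] D by linarith
    qed
    then show ?thesis using P(1)[OF j] good[OF j] R unfolding piece_def by auto
  qed
  then show ?thesis using P(2,3) by (intro exI[of _ P] exI[of _ "\<lambda>j. cut (l j)"]) blast
qed

end

section \<open>The dense round\<close>

definition first_diff :: "nat \<Rightarrow> nat set \<Rightarrow> nat set \<Rightarrow> bool" where
  "first_diff j a b \<longleftrightarrow> (\<forall>i<j. i \<in> a \<longleftrightarrow> i \<in> b) \<and> (j \<in> a \<longleftrightarrow> j \<notin> b)"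

lemma first_diff_sym: "first_diff j a b \<longleftrightarrow> first_diff j b a"
  by (auto simp: first_diff_def)

lemma first_diff_unique: "first_diff i a b \<Longrightarrow> first_diff j a b \<Longrightarrow> i = j"
  unfolding first_diff_def by (metis linorder_neqE_nat)

lemma first_diff_exists:
  assumes "a \<noteq> b" "a \<subseteq> {..<k}" "b \<subseteq> {..<k}"
  shows "\<exists>j<k. first_diff j a b"
proof -
  define j where "j = (LEAST j. (j \<in> a) \<noteq> (j \<in> b))"
  have "\<exists>j. (j \<in> a) \<noteq> (j \<in> b)" using assms(1) by blast
  then have "(j \<in> a) \<noteq> (j \<in> b)" unfolding j_def by (rule LeastI_ex)
  moreover have "(i \<in> a) = (i \<in> b)" if "i < j" for i using not_less_Least[OF that[unfolded j_def]] by blast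
  ultimately show ?thesis using assms(2,3) by (intro exI[of _ j]) (auto simp: first_diff_def)
qed

lemma card_prefix:
  assumes "i \<le> k"
  shows "card {a \<in> Pow {..<k}. a \<inter> {..<i} = g \<inter> {..<i}} = 2 ^ (k - i)"
proof -
  have "bij_betw (\<lambda>b. b \<union> g \<inter> {..<i}) (Pow {i..<k}) {a \<in> Pow {..<k}. a \<inter> {..<i} = g \<inter> {..<i}}"
  proof (rule bij_betw_byWitness[where f' = "\<lambda>a. a \<inter> {i..<k}"])
    show "\<forall>a\<in>{a \<in> Pow {..<k}. a \<inter> {..<i} = g \<inter> {..<i}}. a \<inter> {i..<k} \<union> g \<inter> {..<i} = a"
    proof clarify
      fix a assume a: "a \<subseteq> {..<k}" "a \<inter> {..<i} = g \<inter> {..<i}"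
      have "a \<inter> {i..<k} \<union> a \<inter> {..<i} = a" using a(1) by auto
      then show "a \<inter> {i..<k} \<union> g \<inter> {..<i} = a" unfolding a(2) .
    qed
  qed (use assms in auto)
  then have "card (Pow {i..<k}) = card {a \<in> Pow {..<k}. a \<inter> {..<i} = g \<inter> {..<i}}" by (rule bij_betw_same_card)
  then show ?thesis by (simp add: card_Pow)
qed

text \<open>The colours counted share with \<open>toggle j g\<close> the prefix up to and including
  bit \<open>j\<close>. Their number does not depend on \<open>g\<close>, and this is what makes the
  graphs of the dense round almost regular.\<close>

lemma card_first_diff:
  assumes "j < k"
  shows "card {a \<in> Pow {..<k}. first_diff j a g} = 2 ^ (k - Suc j)"
proof -
  have "first_diff j a g \<longleftrightarrow> a \<inter> {..<Suc j} = toggle j g \<inter> {..<Suc j}" for a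
  proof -
    have "a \<inter> {..<Suc j} = toggle j g \<inter> {..<Suc j} \<longleftrightarrow> (\<forall>i<Suc j. i \<in> a \<longleftrightarrow> i \<in> toggle j g)" by auto
    also have "\<dots> \<longleftrightarrow> first_diff j a g" unfolding toggle_mem first_diff_def by (auto simp: less_Suc_eq)
    finally show ?thesis by simp
  qed
  then show ?thesis using card_prefix[of "Suc j" k "toggle j g"] assms by simp
qed

context halved_expander
begin

lemma degree_internal:
  assumes v: "v \<in> {1..n}"
  shows "degree (internal A) v + card (cross_nbrs A v) = d"
proof -
  have sub: "internal A \<subseteq> E" by (auto simp: internal_def)
  have "{u. {u, v} \<in> E} = {u. {u, v} \<in> internal A} \<union> cross_nbrs A v" by (auto simp: internal_def cross_nbrs_def)
  moreover have "card ({u. {u, v} \<in> internal A} \<union> cross_nbrs A v) = card {u. {u, v} \<in> internal A} + card (cross_nbrs A v)"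
    by (rule card_Un_disjoint) (auto simp: internal_def cross_nbrs_def intro: finite_subset[OF _ finite_neighbours[of v]])
  ultimately show ?thesis
    using card_neighbours[OF v] degree_eq_card_neighbours[OF simple_graph_subset[OF simple sub], of v] by simp
qed

lemma degree_outside: "F \<subseteq> E \<Longrightarrow> v \<notin> {1..n} \<Longrightarrow> degree F v = 0"
proof -
  assume F: "F \<subseteq> E" and v: "v \<notin> {1..n}"
  have "{e\<in>F. v \<in> e} = {}" using F v simple_graph_edge(1)[OF simple] by blast
  then show ?thesis by (simp only: degree_def card.empty)
qed

text \<open>Both sides have degree sum \<open>d * card A\<close>, and every edge between them takes
  one from each.\<close>

lemma internal_balanced: "card {e\<in>internal A. e \<subseteq> A} = card {e\<in>internal A. e \<inter> A = {}}"
proof -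
  have cross_sum: "(\<Sum>v\<in>Q. degree (cross A) v) = card (cross A)" if Q: "Q = A \<or> Q = {1..n} - A" for Q
  proof -
    have fin: "finite (cross A)" "finite Q" using finite_E Q finite_A by (auto simp: cross_def)
    have "(\<Sum>v\<in>Q. degree (cross A) v) = (\<Sum>e\<in>cross A. card (e \<inter> Q))" by (rule sum_degree_eq[OF fin])
    also have "\<dots> = (\<Sum>e\<in>cross A. 1)"
    proof (intro sum.cong refl)
      fix e assume "e \<in> cross A"
      then obtain x y where e: "e = {x, y}" "x \<in> A" "y \<notin> A" "x \<in> {1..n}" "y \<in> {1..n}" by (rule cross_cases)
      then have "e \<inter> Q = (if Q = A then {x} else {y})" using Q by auto
      then show "card (e \<inter> Q) = 1" by auto
    qed
    finally show ?thesis by simp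
  qed
  have total: "(\<Sum>v\<in>Q. degree (internal A) v) + card (cross A) = d * card Q" if Q: "Q = A \<or> Q = {1..n} - A" for Q
  proof -
    have "finite (internal A)" "finite (cross A)" "internal A \<inter> cross A = {}" "internal A \<union> cross A = E"
      using finite_E by (auto simp: internal_def cross_def)
    then have "degree E v = degree (internal A) v + degree (cross A) v" for v using degree_Un_disjoint by metis
    then have "(\<Sum>v\<in>Q. degree E v) = (\<Sum>v\<in>Q. degree (internal A) v) + card (cross A)"
      using cross_sum[OF Q] by (simp add: sum.distrib)
    moreover have "(\<Sum>v\<in>Q. degree E v) = (\<Sum>v\<in>Q. d)"
      using reg Q A_sub by (intro sum.cong refl) (auto simp: regular_def)
    ultimately show ?thesis by (simp add: mult.commute)
  qed
  have "2 * card {e\<in>internal A. e \<subseteq> A} = 2 * card {e\<in>internal A. e \<subseteq> {1..n} - A}"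
    using total[of A] total[of "{1..n} - A"] sum_degree_side[of "internal A" A] sum_degree_side[of "internal A" "{1..n} - A"] card_B
    by simp
  then show ?thesis unfolding outside_eq[OF order_refl] by simp
qed

text \<open>Each side carries between \<open>n / 4 * (x - 2 * t)\<close> and
  \<open>n / 4 * (x + 2 * t)\<close> edges of \<open>C\<close>, so the surplus of the richer side is
  at most \<open>n * t\<close>. It can be removed with small maximal degree because \<open>s\<close>
  is a constant factor larger than \<open>t\<close>.\<close>

lemma balance_piece:
  assumes C: "C \<subseteq> internal A" and deg: "\<And>v. v \<in> {1..n} \<Longrightarrow> \<bar>real (degree C v) - x\<bar> \<le> 2 * t"
    and x: "64 * t \<le> x" and s: "16 * t \<le> real s" "s > 0"
  shows "\<exists>P\<subseteq>C. card {e\<in>P. e \<subseteq> A} = card {e\<in>P. e \<inter> A = {}} \<and> (\<forall>v. degree (C - P) v \<le> 2 * s)"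
proof -
  have CE: "C \<subseteq> E" using C by (auto simp: internal_def)
  have finC: "finite C" using C finite_internal finite_subset by blast
  define CQ where "CQ Q = {e\<in>C. e \<subseteq> Q}" for Q
  define q where "q = min (card (CQ A)) (card (CQ ({1..n} - A)))"
  define \<Delta> where "\<Delta> = nat \<lfloor>x + 2 * t\<rfloor>"
  have x0: "x \<ge> 0" using x t_nonneg by linarith
  have \<Delta>: "real \<Delta> \<le> x + 2 * t" using x0 t_nonneg by (simp add: \<Delta>_def)
  have degC: "degree C v \<le> \<Delta>" for v
  proof (cases "v \<in> {1..n}")
    case True
    then have "real (degree C v) \<le> x + 2 * t" using deg[OF True] by linarith
    then show ?thesis by (simp add: \<Delta>_def le_nat_floor)
  qed (simp add: degree_outside[OF CE])
  have bounds: "real n / 4 * (x - 2 * t) \<le> real (card (CQ Q)) \<and> real (card (CQ Q)) \<le> real n / 4 * (x + 2 * t)"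
    if Q: "Q = A \<or> Q = {1..n} - A" for Q
  proof -
    have cQ: "real (card Q) = real n / 2" using Q card_A card_B by auto
    have Qsub: "Q \<subseteq> {1..n}" using Q A_sub by auto
    have "2 * real (card (CQ Q)) = (\<Sum>v\<in>Q. real (degree C v))"
      using sum_degree_side[OF C Q] by (simp add: CQ_def flip: of_nat_sum)
    moreover have "(\<Sum>v\<in>Q. x - 2 * t) \<le> (\<Sum>v\<in>Q. real (degree C v))"
    proof (rule sum_mono)
      fix v assume "v \<in> Q"
      then show "x - 2 * t \<le> real (degree C v)" using deg[of v] Qsub by (auto simp: abs_le_iff)
    qed
    moreover have "(\<Sum>v\<in>Q. real (degree C v)) \<le> (\<Sum>v\<in>Q. x + 2 * t)"
    proof (rule sum_mono)
      fix v assume "v \<in> Q"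
      then show "real (degree C v) \<le> x + 2 * t" using deg[of v] Qsub by (auto simp: abs_le_iff)
    qed
    ultimately show ?thesis by (simp add: cQ)
  qed
  have drop: "\<exists>F\<subseteq>CQ Q. card F = card (CQ Q) - q \<and> (\<forall>v. degree F v \<le> s)" if Q: "Q = A \<or> Q = {1..n} - A" for Q
  proof (rule exists_spread_subset[where \<Delta> = \<Delta>])
    show "finite (CQ Q)" using finC by (simp add: CQ_def)
    show "finite e \<and> card e = 2" if "e \<in> CQ Q" for e
      using that CE simple_graph_edge[OF simple] by (auto simp: CQ_def)
    show "degree (CQ Q) v \<le> \<Delta>" for v
      using degree_mono[OF finC, of "CQ Q" v] degC[of v] by (force simp: CQ_def)
    define X where "X = card (CQ Q) - q"
    have qle: "q \<le> card (CQ Q)" using Q by (auto simp: q_def)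
    have q_ge: "real n / 4 * (x - 2 * t) \<le> real q" using bounds[of A] bounds[of "{1..n} - A"] by (simp add: q_def min_def)
    have "real X = real (card (CQ Q)) - real q" using qle by (simp add: X_def)
    also have "\<dots> \<le> real n / 4 * (x + 2 * t) - real n / 4 * (x - 2 * t)" using q_ge bounds[OF Q] by linarith
    also have "\<dots> = real n * t" by (simp add: field_simps)
    finally have X: "real X \<le> real n * t" .
    \<comment> \<open>From \<open>t \<le> x / 64\<close> and \<open>t \<le> s / 16\<close>, the
      deletion needs 37/256 of \<open>s * n * x\<close>, while \<open>s * card (CQ Q)\<close> is at
      least 31/128 of it.\<close>
    have "real X * (real s + 2 * real \<Delta>) \<le> real n * t * (real s + 2 * (33 / 32 * x))"
      using X \<Delta> x x0 t_nonneg by (intro mult_mono add_mono mult_left_mono) auto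
    also have "\<dots> = real n * (t * real s + 33 / 16 * t * x)" by (simp add: algebra_simps)
    also have "\<dots> \<le> real n * (x / 64 * real s + 33 / 16 * (real s / 16) * x)"
      using x s x0 by (intro mult_left_mono add_mono mult_right_mono) auto
    also have "\<dots> = real s * (real n * x * (37 / 256))" by (simp add: algebra_simps)
    also have "\<dots> \<le> real s * real (card (CQ Q))"
    proof (rule mult_left_mono)
      have "real n * x * (37 / 256) \<le> real n / 4 * (31 / 32 * x)" using x0 by (simp add: algebra_simps)
      also have "\<dots> \<le> real n / 4 * (x - 2 * t)" using x by (intro mult_left_mono) auto
      also have "\<dots> \<le> real (card (CQ Q))" using bounds[OF Q] by simp
      finally show "real n * x * (37 / 256) \<le> real (card (CQ Q))" .
    qed simp
    finally have "real (X * (s + 2 * \<Delta>)) \<le> real (s * card (CQ Q))" by simp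
    then show "(card (CQ Q) - q) * (s + 2 * \<Delta>) \<le> s * card (CQ Q)" unfolding X_def by (simp only: of_nat_le_iff)
  qed (rule s(2))
  obtain FA where FA: "FA \<subseteq> CQ A" "card FA = card (CQ A) - q" "\<And>v. degree FA v \<le> s" using drop[of A] by blast
  obtain FB where FB: "FB \<subseteq> CQ ({1..n} - A)" "card FB = card (CQ ({1..n} - A)) - q" "\<And>v. degree FB v \<le> s"
    using drop[of "{1..n} - A"] by blast
  have ne: "e \<noteq> {}" if "e \<in> C" for e using simple_graph_edge(4)[OF simple] CE that by blast
  define P where "P = C - (FA \<union> FB)"
  have "{e\<in>P. e \<subseteq> A} = CQ A - FA" using FB(1) ne by (fastforce simp: P_def CQ_def)
  moreover have "{e\<in>P. e \<inter> A = {}} = CQ ({1..n} - A) - FB"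
    using FA(1) ne outside_eq[OF C] by (fastforce simp: P_def CQ_def)
  moreover have "card (CQ A - FA) = q"
    using FA(1,2) finite_subset[OF FA(1)] finC by (subst card_Diff_subset) (auto simp: CQ_def q_def)
  moreover have "card (CQ ({1..n} - A) - FB) = q"
    using FB(1,2) finite_subset[OF FB(1)] finC by (subst card_Diff_subset) (auto simp: CQ_def q_def)
  moreover have "degree (C - P) v \<le> 2 * s" for v
  proof -
    have "C - P = FA \<union> FB" using FA(1) FB(1) by (auto simp: P_def CQ_def)
    then show ?thesis using degree_Un_le[of FA FB v] FA(3)[of v] FB(3)[of v] by simp
  qed
  ultimately show ?thesis by (intro exI[of _ P]) (auto simp: P_def)
qed

text \<open>Which colour sets matter at a vertex depends on its own colour, so all of
  \<open>Pow C\<close> is controlled; this costs \<open>2 ^ (2 ^ k)\<close> sets and also yields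
  lower deviations through complements. The leftover \<open>R\<close> consists of the monochromatic
  edges and those dropped for balance; it is balanced because the inner edges and all pieces
  are.\<close>

lemma dense_pieces:
  fixes p \<delta> r :: real and s w k :: nat
  assumes k: "k \<ge> 1" and \<delta>: "0 \<le> \<delta>" "\<delta> < 1"
    and p: "exp (- t\<^sup>2 / (4 * real d)) / (1 - \<delta>) ^ d \<le> p" and small: "real (4 * d * 2 ^ (2 ^ k)) * p \<le> \<delta>"
    and r: "r = real d / 2 ^ (k + 1)" "64 * t \<le> r" and s: "16 * t \<le> real s" "s > 0"
    and w: "4 * t + 2 * real s + 1 \<le> real w" and leftover: "2 * t + 2 * real k * real s \<le> r / 4"
  shows "\<exists>P S lo R. (\<forall>j<k. piece A w (P j) (S j) (lo j)) \<and> (\<forall>i<k. \<forall>j<k. i \<noteq> j \<longrightarrow> P i \<inter> P j = {}) \<and>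
    R \<inter> (\<Union>j<k. P j) = {} \<and> R \<union> (\<Union>j<k. P j) = internal A \<and>
    card {e\<in>R. e \<subseteq> A} = card {e\<in>R. e \<inter> A = {}} \<and>
    (\<forall>v. real (degree R v) \<le> 5 / 4 * r) \<and> (\<forall>v\<in>{1..n}. 3 / 4 * r \<le> real (degree R v))"
proof -
  define C where "C = Pow {..<k}"
  have C: "finite C" "card C = 2 ^ k" "C \<noteq> {}" by (auto simp: C_def card_Pow)
  have cardG: "card (Pow C) = 2 ^ (2 ^ k)" using C by (simp add: card_Pow)
  have IE: "internal A \<subseteq> E" by (auto simp: internal_def)
  have deg_int_le: "degree (internal A) v \<le> d" for v
  proof (cases "v \<in> {1..n}")
    case True
    then show ?thesis using degree_internal[OF True] by linarith
  qed (simp add: degree_outside[OF IE])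
  have t2: "t \<le> 2 * real d" using t_le by simp
  have "\<exists>c. (\<forall>x\<in>{1..n div 2}. c x \<in> C) \<and>
    (\<forall>v\<in>{1..n}. \<forall>G\<in>Pow C. real (card {u\<in>cross_nbrs A v. c (pair_index u) \<in> G}) \<le> real (card G) / real (card C) * real (card (cross_nbrs A v)) + t \<and>
      real (card {u. {u, v} \<in> internal A \<and> c (pair_index u) \<in> G}) \<le> real (card G) / real (card C) * real (degree (internal A) v) + t) \<and>
    (\<forall>u v. {u, v} \<in> {} \<longrightarrow> c (pair_index u) \<noteq> c (pair_index v))"
  proof (rule exists_pair_coloring[OF inj_A inj_B C(1,3) order_refl order_refl deg_int_le _ _ _ \<delta> t_nonneg t2 t_nonneg t2 p p, where D' = 0])
    show "real (4 * d * card (Pow C)) * p + real (2 * 0) / (real (card C) * (1 - \<delta>)\<^sup>2) \<le> \<delta>"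
      using small unfolding cardG by simp
  qed (use d_pos in \<open>auto simp: degree_def\<close>)
  then obtain c where c: "\<And>x. x \<in> {1..n div 2} \<Longrightarrow> c x \<in> C"
    and c_cross: "\<And>v G. v \<in> {1..n} \<Longrightarrow> G \<in> Pow C \<Longrightarrow>
      real (card {u\<in>cross_nbrs A v. c (pair_index u) \<in> G}) \<le> real (card G) / real (card C) * real (card (cross_nbrs A v)) + t"
    and c_int: "\<And>v G. v \<in> {1..n} \<Longrightarrow> G \<in> Pow C \<Longrightarrow>
      real (card {u. {u, v} \<in> internal A \<and> c (pair_index u) \<in> G}) \<le> real (card G) / real (card C) * real (degree (internal A) v) + t"
    by blast
  have cC: "c (pair_index u) \<in> C" if "u \<in> {1..n}" for u using c[OF pair_index_mem[OF that]] .
  \<comment> \<open>The inner degree is \<open>d / 2\<close> up to \<open>2 * t\<close>.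
    Multiplication by \<open>1 / 2 ^ i\<close> with \<open>i \<ge> 1\<close> at least halves this
    error, so together with the deviation \<open>t\<close> it stays within
    \<open>2 * t\<close>.\<close>
  have concentrated: "\<bar>real (card {u. {u, v} \<in> internal A \<and> c (pair_index u) \<in> G}) - real d / 2 ^ (i + 1)\<bar> \<le> 2 * t"
    if v: "v \<in> {1..n}" and G: "G \<subseteq> C" and cG: "card G = 2 ^ (k - i)" and i: "1 \<le> i" "i \<le> k" for v G i
  proof -
    have "(2::real) ^ k = 2 ^ i * 2 ^ (k - i)" using i by (simp flip: power_add)
    then have ratio: "real (card G) / real (card C) = 1 / 2 ^ i"
      unfolding C cG of_nat_power of_nat_numeral by simp
    have ratio': "real (card (C - G)) / real (card C) = 1 - 1 / 2 ^ i"
    proof -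
      have "real (card (C - G)) = real (card C) - real (card G)"
        using card_Int_Diff[OF C(1), of G] Int_absorb1[OF G] by simp
      moreover have "real (card C) \<noteq> 0" using C by simp
      ultimately show ?thesis unfolding \<open>real (card (C - G)) = real (card C) - real (card G)\<close> diff_divide_distrib ratio
        by simp
    qed
    let ?X = "{u. {u, v} \<in> internal A \<and> c (pair_index u) \<in> G}" and ?Y = "{u. {u, v} \<in> internal A \<and> c (pair_index u) \<in> C - G}"
    have "degree (internal A) v = card {u. {u, v} \<in> internal A}"
      by (rule degree_eq_card_neighbours[OF simple_graph_subset[OF simple IE]])
    also have "{u. {u, v} \<in> internal A} = ?X \<union> ?Y" using cC internal_same_side by blast
    also have "card (?X \<union> ?Y) = card ?X + card ?Y"
      by (intro card_Un_disjoint) (use IE in \<open>auto intro: finite_subset[OF _ finite_neighbours[of v]]\<close>)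
    finally have split: "real (degree (internal A) v) = real (card ?X) + real (card ?Y)" by simp
    have "real (card {u. {u, v} \<in> internal A \<and> c (pair_index u) \<in> G}) \<le> 1 / 2 ^ i * real (degree (internal A) v) + t"
      using c_int[OF v, of G] G by (simp add: ratio)
    moreover have "real (card {u. {u, v} \<in> internal A \<and> c (pair_index u) \<in> C - G}) \<le> (1 - 1 / 2 ^ i) * real (degree (internal A) v) + t"
      using c_int[OF v, of "C - G"] by (simp only: ratio') auto
    ultimately have 1: "\<bar>real (card {u. {u, v} \<in> internal A \<and> c (pair_index u) \<in> G}) - 1 / 2 ^ i * real (degree (internal A) v)\<bar> \<le> t"
      using split unfolding left_diff_distrib by linarith
    have "real (degree (internal A) v) + real (card (cross_nbrs A v)) = real d"
      using degree_internal[OF v] by (simp flip: of_nat_add)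
    then have 2: "\<bar>real (degree (internal A) v) - real d / 2\<bar> \<le> 2 * t" using card_cross_nbrs[OF v] by linarith
    have i2: "1 / 2 ^ i \<le> (1 / 2 :: real)" using power_increasing[of 1 i "2 :: real"] i by (simp add: field_simps)
    have "\<bar>1 / 2 ^ i * real (degree (internal A) v) - real d / 2 ^ (i + 1)\<bar> = 1 / 2 ^ i * \<bar>real (degree (internal A) v) - real d / 2\<bar>"
    proof -
      have "1 / 2 ^ i * real (degree (internal A) v) - real d / 2 ^ (i + 1) = 1 / 2 ^ i * (real (degree (internal A) v) - real d / 2)"
        by (simp add: algebra_simps)
      then show ?thesis by (simp add: abs_mult)
    qed
    also have "\<dots> \<le> 1 / 2 * (2 * t)" using 2 i2 by (intro mult_mono) auto
    finally show ?thesis using 1 by linarith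
  qed
  define cls where "cls f = {e\<in>internal A. \<exists>u v. e = {u, v} \<and> f (c (pair_index u)) (c (pair_index v))}" for f
  have cls_iff: "{u, v} \<in> cls f \<longleftrightarrow> {u, v} \<in> internal A \<and> f (c (pair_index u)) (c (pair_index v))" if "\<And>a b. f a b \<longleftrightarrow> f b a" for f u v
    using that by (auto simp: cls_def doubleton_eq_iff)
  have cls_int: "cls f \<subseteq> internal A" for f by (auto simp: cls_def)
  have deg_cls: "\<bar>real (degree (cls f) v) - real d / 2 ^ (i + 1)\<bar> \<le> 2 * t"
    if v: "v \<in> {1..n}" and f: "\<And>a b. f a b \<longleftrightarrow> f b a" and i: "1 \<le> i" "i \<le> k"
      and cf: "\<And>g. card {a\<in>C. f a g} = 2 ^ (k - i)" for v f i
  proof -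
    have "degree (cls f) v = card {u. {u, v} \<in> cls f}"
      using cls_int IE by (intro degree_eq_card_neighbours[OF simple_graph_subset[OF simple]]) blast
    also have "{u. {u, v} \<in> cls f} = {u. {u, v} \<in> internal A \<and> c (pair_index u) \<in> {a\<in>C. f a (c (pair_index v))}}"
      using cC internal_same_side by (auto simp: cls_iff[OF f])
    finally show ?thesis using concentrated[OF v _ cf i] by simp
  qed
  define K where "K j = cls (first_diff j)" for j
  define R0 where "R0 = cls (=)"
  have K_iff: "{u, v} \<in> K j \<longleftrightarrow> {u, v} \<in> internal A \<and> first_diff j (c (pair_index u)) (c (pair_index v))" for u v j
    unfolding K_def by (rule cls_iff[where f = "first_diff j"]) (rule first_diff_sym)
  have R0_iff: "{u, v} \<in> R0 \<longleftrightarrow> {u, v} \<in> internal A \<and> c (pair_index u) = c (pair_index v)" for u v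
    unfolding R0_def by (rule cls_iff[where f = "(=)"]) (rule eq_commute)
  have K_int: "K j \<subseteq> internal A" and R0_int: "R0 \<subseteq> internal A" for j
    unfolding K_def R0_def by (rule cls_int)+
  have deg_K: "\<bar>real (degree (K j) v) - real d / 2 ^ (j + 2)\<bar> \<le> 2 * t" if "j < k" "v \<in> {1..n}" for j v
    using deg_cls[OF that(2), of "first_diff j" "Suc j"] first_diff_sym card_first_diff[OF that(1)] that(1)
    by (simp add: K_def C_def)
  have deg_R0: "\<bar>real (degree R0 v) - r\<bar> \<le> 2 * t" if "v \<in> {1..n}" for v
  proof -
    have "card {a\<in>C. a = c (pair_index v)} = 1" 
    proof -
      have "{a\<in>C. a = c (pair_index v)} = {c (pair_index v)}" using cC[OF that] by auto
      then show ?thesis by simp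
    qed
    have "degree R0 v = card {u. {u, v} \<in> R0}"
      using R0_int IE by (intro degree_eq_card_neighbours[OF simple_graph_subset[OF simple]]) blast
    also have "{u. {u, v} \<in> R0} = {u. {u, v} \<in> internal A \<and> c (pair_index u) \<in> {c (pair_index v)}}"
      unfolding R0_iff by simp
    finally show ?thesis using concentrated[OF that, of "{c (pair_index v)}" k] cC[OF that] k by (simp add: r)
  qed
  have x_ge: "64 * t \<le> real d / 2 ^ (j + 2)" if "j < k" for j
  proof -
    have "(2::real) ^ (j + 2) \<le> 2 ^ (k + 1)" using that by (intro power_increasing) auto
    then have "r \<le> real d / 2 ^ (j + 2)" unfolding r(1) by (intro divide_left_mono) auto
    then show ?thesis using r(2) by linarith
  qed
  have "\<exists>P\<subseteq>K j. card {e\<in>P. e \<subseteq> A} = card {e\<in>P. e \<inter> A = {}} \<and> (\<forall>v. degree (K j - P) v \<le> 2 * s)" if j: "j < k" for j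
    by (rule balance_piece[OF K_int deg_K[OF j] x_ge[OF j] s])
  then have "\<forall>j. \<exists>P. j < k \<longrightarrow> P \<subseteq> K j \<and> card {e\<in>P. e \<subseteq> A} = card {e\<in>P. e \<inter> A = {}} \<and> (\<forall>v. degree (K j - P) v \<le> 2 * s)"
    by blast
  from choice[OF this] obtain P where P: "\<And>j. j < k \<Longrightarrow> P j \<subseteq> K j" "\<And>j. j < k \<Longrightarrow> card {e\<in>P j. e \<subseteq> A} = card {e\<in>P j. e \<inter> A = {}}"
    "\<And>j v. j < k \<Longrightarrow> degree (K j - P j) v \<le> 2 * s" by blast
  have K_disj: "K i \<inter> K j = {}" if "i \<noteq> j" for i j
  proof -
    have "\<not> (e \<in> K i \<and> e \<in> K j)" for e
    proof
      assume e: "e \<in> K i \<and> e \<in> K j"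
      then obtain u v where uv: "e = {u, v}" using K_int internal_pair by blast
      then have "first_diff i (c (pair_index u)) (c (pair_index v))" "first_diff j (c (pair_index u)) (c (pair_index v))"
        using e unfolding uv K_iff by blast+
      then show False using first_diff_unique that by blast
    qed
    then show ?thesis by blast
  qed
  have K_R0: "K j \<inter> R0 = {}" for j
  proof -
    have "\<not> (e \<in> K j \<and> e \<in> R0)" for e
    proof
      assume e: "e \<in> K j \<and> e \<in> R0"
      then obtain u v where uv: "e = {u, v}" using K_int internal_pair by blast
      then have "first_diff j (c (pair_index u)) (c (pair_index v))" using e unfolding uv K_iff by blast
      moreover have "c (pair_index u) = c (pair_index v)" using e unfolding uv R0_iff by blast
      ultimately show False by (simp add: first_diff_def)
    qed
    then show ?thesis by blast
  qed
  have cover: "internal A = R0 \<union> (\<Union>j<k. K j)"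
  proof
    show "R0 \<union> (\<Union>j<k. K j) \<subseteq> internal A" using K_int R0_int by blast
    show "internal A \<subseteq> R0 \<union> (\<Union>j<k. K j)"
    proof
      fix e assume e: "e \<in> internal A"
      then obtain u v where uv: "e = {u, v}" by (rule internal_pair)
      have mem: "u \<in> {1..n}" "v \<in> {1..n}" using internal_same_side e uv by blast+
      show "e \<in> R0 \<union> (\<Union>j<k. K j)"
      proof (cases "c (pair_index u) = c (pair_index v)")
        case True
        then have "e \<in> R0" using e unfolding uv R0_iff by blast
        then show ?thesis by blast
      next
        case False
        then obtain j where "j < k" "first_diff j (c (pair_index u)) (c (pair_index v))"
          using first_diff_exists[of "c (pair_index u)" "c (pair_index v)" k] cC[OF mem(1)] cC[OF mem(2)] by (auto simp: C_def)
        then have "e \<in> K j" using e unfolding uv K_iff by blast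
        then show ?thesis using \<open>j < k\<close> by blast
      qed
    qed
  qed
  define R where "R = R0 \<union> (\<Union>j<k. K j - P j)"
  have P_int: "P j \<subseteq> internal A" if "j < k" for j using P(1)[OF that] K_int by blast
  have P_disj: "P i \<inter> P j = {}" if "i < k" "j < k" "i \<noteq> j" for i j using P(1) K_disj[OF that(3)] that by blast
  have R_P: "R \<inter> (\<Union>j<k. P j) = {}"
  proof -
    have "e \<notin> P j" if eR: "e \<in> R" and j: "j < k" for e j
    proof
      assume e: "e \<in> P j"
      then have "e \<in> K j" using P(1)[OF j] by blast
      then have "e \<notin> R0" using K_R0 by blast
      then obtain i where "i < k" "e \<in> K i" "e \<notin> P i" using eR by (auto simp: R_def)
      then show False using K_disj[of i j] \<open>e \<in> K j\<close> e by blast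
    qed
    then show ?thesis by blast
  qed
  have R_Un: "R \<union> (\<Union>j<k. P j) = internal A" unfolding cover R_def using P(1) by blast
  have finI: "finite (internal A)" by (rule finite_internal)
  have R_int: "R \<subseteq> internal A" using R_Un by blast
  have R_bal: "card {e\<in>R. e \<subseteq> A} = card {e\<in>R. e \<inter> A = {}}"
  proof -
    have count: "card {e\<in>internal A. f e} = card {e\<in>R. f e} + (\<Sum>j<k. card {e\<in>P j. f e})" for f
    proof -
      have fin: "finite {e\<in>R. f e}" "\<And>j. j < k \<Longrightarrow> finite {e\<in>P j. f e}"
        using finite_subset[OF R_int finI] finite_subset[OF P_int finI] by auto
      have "{e\<in>internal A. f e} = {e\<in>R. f e} \<union> (\<Union>j<k. {e\<in>P j. f e})" unfolding R_Un[symmetric] by blast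
      moreover have "card ({e\<in>R. f e} \<union> (\<Union>j<k. {e\<in>P j. f e})) = card {e\<in>R. f e} + card (\<Union>j<k. {e\<in>P j. f e})"
        using fin R_P by (intro card_Un_disjoint) auto
      moreover have "card (\<Union>j<k. {e\<in>P j. f e}) = (\<Sum>j<k. card {e\<in>P j. f e})"
        using fin P_disj by (intro card_UN_disjoint) (auto simp: disjoint_iff)
      ultimately show ?thesis by simp
    qed
    have "(\<Sum>j<k. card {e\<in>P j. e \<subseteq> A}) = (\<Sum>j<k. card {e\<in>P j. e \<inter> A = {}})" using P(2) by (intro sum.cong) auto
    then show ?thesis using count[of "\<lambda>e. e \<subseteq> A"] count[of "\<lambda>e. e \<inter> A = {}"] internal_balanced by linarith
  qed
  have R_le: "real (degree R v) \<le> 5 / 4 * r" for v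
  proof (cases "v \<in> {1..n}")
    case True
    have "degree R v \<le> degree R0 v + degree (\<Union>j<k. K j - P j) v" unfolding R_def by (rule degree_Un_le)
    also have "degree (\<Union>j<k. K j - P j) v \<le> (\<Sum>j<k. degree (K j - P j) v)" by (rule degree_UN_le) simp
    also have "\<dots> \<le> (\<Sum>j<k. 2 * s)" using P(3) by (intro sum_mono) auto
    finally have "degree R v \<le> degree R0 v + k * (2 * s)" by simp
    then have "real (degree R v) \<le> real (degree R0 v + k * (2 * s))" by (rule of_nat_mono)
    then have "real (degree R v) \<le> real (degree R0 v) + 2 * real k * real s" by simp
    then show ?thesis using deg_R0[OF True] leftover by (simp add: abs_le_iff)
  next
    case False
    moreover have "r \<ge> 0" using r t_nonneg by linarith
    ultimately show ?thesis using degree_outside[of R v] R_int IE by auto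
  qed
  have R_ge: "3 / 4 * r \<le> real (degree R v)" if v: "v \<in> {1..n}" for v
  proof -
    have "degree R0 v \<le> degree R v"
      by (rule degree_mono[OF finite_subset[OF R_int finI]]) (auto simp: R_def)
    moreover have "2 * t \<le> r / 4" using r(2) t_nonneg by linarith
    ultimately show ?thesis using deg_R0[OF v] by (simp add: abs_le_iff)
  qed
  define S where "S j = cut (\<lambda>x. j \<in> c x)" for j
  \<comment> \<open>The degrees in \<open>K j\<close> spread over \<open>4 * t\<close>, dropping
    edges costs another \<open>2 * s\<close>, and the 1 in the assumption on \<open>w\<close> covers
    the floor.\<close>
  define lo where "lo j = nat \<lfloor>real d / 2 ^ (j + 2) - 2 * t - 2 * real s\<rfloor>" for j
  have "piece A w (P j) (S j) (lo j)" if j: "j < k" for j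
  proof -
    have "good_cut A (S j)" unfolding S_def
    proof (rule good_cut_cut[where ?t1.0 = t])
      show "t + t \<le> real d / 200" using t_le by simp
      fix v b assume v: "v \<in> {1..n}"
      have "toggle j a \<in> C \<and> toggle j (toggle j a) = a \<and> (j \<in> toggle j a \<longleftrightarrow> \<not> j \<in> a)" if "a \<in> C" for a
        using that toggle_Pow[OF j, of a] by (auto simp: C_def toggle_mem)
      from card_half_by_involution[OF C(1) this]
      have "2 * card {a\<in>C. (j \<in> a) = b} = card C" by (cases b) simp_all
      then have "real (2 * card {a\<in>C. (j \<in> a) = b}) = real (card C)" by (rule arg_cong)
      then have half: "real (card {a\<in>C. (j \<in> a) = b}) / real (card C) = 1 / 2" using C by (simp add: field_simps)
      have "{u\<in>cross_nbrs A v. (j \<in> c (pair_index u)) = b} = {u\<in>cross_nbrs A v. c (pair_index u) \<in> {a\<in>C. (j \<in> a) = b}}"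
        using cC cross_nbrs_subset[of A v] by auto
      moreover have "{a\<in>C. (j \<in> a) = b} \<in> Pow C" by auto
      ultimately show "real (card {u\<in>cross_nbrs A v. (j \<in> c (pair_index u)) = b}) \<le> real (card (cross_nbrs A v)) / 2 + t"
        using c_cross[OF v, of "{a\<in>C. (j \<in> a) = b}"] half by simp
    qed
    moreover have "card (e \<inter> S j) = 1" if e: "e \<in> P j" for e
    proof -
      have "e \<in> K j" using e P(1)[OF j] by blast
      then obtain u v where uv: "e = {u, v}" "{u, v} \<in> internal A" using K_int internal_pair by blast
      then have "first_diff j (c (pair_index u)) (c (pair_index v))" using \<open>e \<in> K j\<close> unfolding uv(1) K_iff by blast
      then show ?thesis unfolding S_def uv(1) card_Int_cut[OF uv(2)] by (simp add: first_diff_def)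
    qed
    moreover have "lo j \<le> degree (P j) v \<and> degree (P j) v \<le> lo j + w" if v: "v \<in> {1..n}" for v
    proof -
      have finK: "finite (K j)" using K_int finI finite_subset by blast
      have "P j \<union> (K j - P j) = K j" using P(1)[OF j] by blast
      then have "degree (K j) v \<le> degree (P j) v + degree (K j - P j) v" using degree_Un_le[of "P j" "K j - P j" v] by simp
      then have "degree (K j) v \<le> degree (P j) v + 2 * s" using P(3)[OF j, of v] by linarith
      then have "real (degree (K j) v) \<le> real (degree (P j) v) + 2 * real s" by linarith
      moreover have "real (degree (P j) v) \<le> real (degree (K j) v)" using degree_mono[OF finK P(1)[OF j]] by simp
      ultimately have 1: "real d / 2 ^ (j + 2) - 2 * t - 2 * real s \<le> real (degree (P j) v)"
        and 2: "real (degree (P j) v) \<le> real d / 2 ^ (j + 2) + 2 * t"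
        using deg_K[OF j v] by (simp_all add: abs_le_iff)
      have "lo j \<le> degree (P j) v" using 1 unfolding lo_def by linarith
      moreover have "real (degree (P j) v) \<le> real (lo j) + real w" using 2 w unfolding lo_def by linarith
      ultimately show ?thesis by linarith
    qed
    ultimately show ?thesis using P_int[OF j] P(2)[OF j] by (simp add: piece_def)
  qed
  then show ?thesis
    by (intro exI[of _ P] exI[of _ S] exI[of _ lo] exI[of _ R] conjI; use P_disj R_P R_Un R_bal R_le R_ge in blast)
qed

end

section \<open>Parameters\<close>

text \<open>This bounds the price of the local correction: the factors \<open>1 - \<delta>\<close>
  over a neighbourhood of size \<open>m\<close> cost at most
  \<open>exp (2 * \<delta> * m)\<close>.\<close>

lemma inverse_power_le_exp:
  fixes y :: real
  assumes "0 \<le> y" "y \<le> 1 / 2"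
  shows "1 / (1 - y) ^ m \<le> exp (2 * y * real m)"
proof -
  have "- y - 2 * y\<^sup>2 \<le> ln (1 - y)" using assms by (rule ln_one_minus_pos_lower_bound)
  moreover have "y * (2 * y) \<le> y * 1" using assms by (intro mult_left_mono) auto
  ultimately have "ln (1 - y) \<ge> - (2 * y)" by (simp add: power2_eq_square)
  then have "exp (- (2 * y)) \<le> 1 - y" using assms by (simp add: ln_ge_iff)
  then have "exp (- (2 * y)) ^ m \<le> (1 - y) ^ m" by (intro power_mono) auto
  then have "exp (- (2 * y * real m)) \<le> (1 - y) ^ m" by (simp add: mult.commute flip: exp_of_nat_mult)
  then have "1 / (1 - y) ^ m \<le> 1 / exp (- (2 * y * real m))" using assms by (intro divide_left_mono) auto
  then show ?thesis by (simp add: exp_minus divide_inverse)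
qed

lemma exp_div_power_le_exp:
  fixes y a b :: real
  assumes "0 \<le> y" "y \<le> 1 / 2" "a + 2 * y * real m \<le> b"
  shows "exp a / (1 - y) ^ m \<le> exp b"
proof -
  have "exp a / (1 - y) ^ m = exp a * (1 / (1 - y) ^ m)" by simp
  also have "\<dots> \<le> exp a * exp (2 * y * real m)" using assms by (intro mult_left_mono inverse_power_le_exp) auto
  also have "\<dots> \<le> exp b" using assms(3) by (simp flip: exp_add)
  finally show ?thesis .
qed

text \<open>
\<open>t\<close> is the deviation allowed in the dense round, \<open>z\<close> bounds the number of its colours, and
\<open>y\<close> is the order of magnitude of the degrees left for the sparse round.
\<close>

definition large_degree :: "nat \<Rightarrow> bool" where
  "large_degree d \<longleftrightarrow> (let x = real d; t = x powr (2/3); y = x powr (3/4); z = x powr (1/4) in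
    8 * x * exp (2 - x powr (1/3) / 4) \<le> 1 / x \<and> t \<le> x / 400 \<and> 1 \<le> t \<and>
    4 * x * 2 powr z * exp (2 - x powr (1/3) / 4) \<le> 1 / x \<and>
    64 * t \<le> y / 2 \<and> 2 * t + 2 * log 2 x * (17 * t) \<le> y / 8 \<and> 38 * t + 1 \<le> 2 * y \<and> 1 \<le> y / 8 \<and>
    8 * x * (log 2 x + 28) * exp (- y / 2000000) \<le> 1 / 2 ^ 23 \<and>
    11 * (log 2 x + 30) * (2 * y + 1) \<le> x / 200 \<and> 2 * y + 1 \<le> x / 1000 \<and> 2 \<le> z)"

text \<open>The exponents are compatible: 2/3 < 3/4 keeps \<open>t\<close> below \<open>y\<close>
  even after a logarithmic factor; \<open>t\<^sup>2 / x = x powr (1/3)\<close> dominates the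
  exponent \<open>z = x powr (1/4)\<close> of the number of colour sets; and \<open>y\<close> times
  a logarithm stays below \<open>x\<close>.\<close>

lemma eventually_large_degree: "\<forall>\<^sub>F d in sequentially. large_degree d"
  unfolding large_degree_def Let_def by (intro eventually_conj; real_asymp)

theorem theorem1p3:
  "\<exists>d0::nat. d0 > 0 \<and>
     (\<forall>d n (lam::real) E. d \<ge> d0 \<longrightarrow> n \<ge> d + 1 \<longrightarrow> even n \<longrightarrow>
        ndlambda_graph n d lam E \<longrightarrow> lam \<le> real d / 12 \<longrightarrow>
        (\<exists>Hs. is_decomposition E Hs \<and>
              (\<forall>H\<in>set Hs. regular_bipartite_spanning n E H) \<and>
              real (length Hs) \<le> log 2 (real d) + 36))"
proof -
  obtain d1 where d1: "\<And>d. d \<ge> d1 \<Longrightarrow> large_degree d"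
    using eventually_large_degree unfolding eventually_sequentially by blast
  have main: "\<exists>Hs. is_decomposition E Hs \<and> (\<forall>H\<in>set Hs. regular_bipartite_spanning n E H) \<and>
      real (length Hs) \<le> log 2 (real d) + 36"
    if d: "d \<ge> max d1 2" and n: "n \<ge> d + 1" "even n" and G: "ndlambda_graph n d lam E" "lam \<le> real d / 12" for d n lam E
  proof -
    interpret expander n d lam E by unfold_locales (use d n G in auto)
    define x where "x = real d"
    define t where "t = x powr (2/3)"
    define y where "y = x powr (3/4)"
    define z where "z = x powr (1/4)"
    have "d \<ge> d1" using d by simp
    note d1[OF this, unfolded large_degree_def Let_def, folded x_def, folded t_def y_def z_def]
    then have b1: "8 * x * exp (2 - x powr (1/3) / 4) \<le> 1 / x" and b2: "t \<le> x / 400" and b3: "1 \<le> t"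
      and b4: "4 * x * 2 powr z * exp (2 - x powr (1/3) / 4) \<le> 1 / x"
      and b5: "64 * t \<le> y / 2" and b6: "2 * t + 2 * log 2 x * (17 * t) \<le> y / 8" and b7: "38 * t + 1 \<le> 2 * y"
      and b8: "1 \<le> y / 8" and b9: "8 * x * (log 2 x + 28) * exp (- y / 2000000) \<le> 1 / 2 ^ 23"
      and b10: "11 * (log 2 x + 30) * (2 * y + 1) \<le> x / 200" and b11: "2 * y + 1 \<le> x / 1000" and b12: "2 \<le> z"
      by auto
    have x2: "x \<ge> 2" using d by (simp add: x_def)
    have xyz: "x = y * z" using x2 by (simp add: y_def z_def flip: powr_add)
    have exponent: "- t\<^sup>2 / (4 * x) = - (x powr (1/3) / 4)"
    proof -
      have "t\<^sup>2 = x powr (1/3 + 1)" by (simp add: t_def power2_eq_square flip: powr_add)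
      also have "\<dots> = x powr (1/3) * x" unfolding powr_add using x2 by simp
      finally show ?thesis using x2 by simp
    qed
    \<comment> \<open>With this choice \<open>1 / (1 - \<delta>) ^ d\<close> is at most
      \<open>exp 2\<close>, which accounts for the summand 2 in the exponent of
      \<open>p\<close>.\<close>
    define \<delta> where "\<delta> = 1 / x"
    define p where "p = exp (2 - x powr (1/3) / 4)"
    have \<delta>: "0 \<le> \<delta>" "\<delta> < 1" "\<delta> \<le> 1 / 2" using x2 by (auto simp: \<delta>_def field_simps)
    have p: "exp (- t\<^sup>2 / (4 * real d)) / (1 - \<delta>) ^ d \<le> p"
      unfolding p_def by (rule exp_div_power_le_exp) (use \<delta> x2 exponent in \<open>auto simp: x_def[symmetric] \<delta>_def\<close>)
    have "8 * real d * (exp (- t\<^sup>2 / (4 * real d)) / (1 - \<delta>) ^ d) \<le> 8 * real d * p"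
      using p by (intro mult_left_mono) auto
    then have small0: "8 * real d * (exp (- t\<^sup>2 / (4 * real d)) / (1 - \<delta>) ^ d) \<le> \<delta>"
      using b1 by (simp add: p_def \<delta>_def x_def)
    have t0: "0 \<le> t" "t \<le> 2 * real d" using b2 b3 x2 by (auto simp: x_def)
    obtain A where A: "A \<subseteq> {1..n}" "2 * card A = n" "inj_on pair_index A" "inj_on pair_index ({1..n} - A)"
      and A_deg: "\<And>v. v \<in> {1..n} \<Longrightarrow> \<bar>real (card {u\<in>A. {u, v} \<in> E}) - real d / 2\<bar> \<le> 2 * t"
      using exists_balanced_halving[OF \<delta>(1,2) t0 small0] by blast
    have cnb_card: "\<bar>real (card (cross_nbrs A v)) - real d / 2\<bar> \<le> 2 * t" if v: "v \<in> {1..n}" for v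
    proof (cases "v \<in> A")
      case True
      have "{u. {u, v} \<in> E} = {u\<in>A. {u, v} \<in> E} \<union> cross_nbrs A v" using True by (auto simp: cross_nbrs_def)
      moreover have "card ({u\<in>A. {u, v} \<in> E} \<union> cross_nbrs A v) = card {u\<in>A. {u, v} \<in> E} + card (cross_nbrs A v)"
        by (rule card_Un_disjoint)
          (use True finite_cross_nbrs in \<open>auto simp: cross_nbrs_def intro: finite_subset[OF _ finite_neighbours[of v]]\<close>)
      ultimately have "card {u\<in>A. {u, v} \<in> E} + card (cross_nbrs A v) = d" using card_neighbours[OF v] by simp
      then have "real (card {u\<in>A. {u, v} \<in> E}) + real (card (cross_nbrs A v)) = real d" by (simp flip: of_nat_add)
      then show ?thesis using A_deg[OF v] by linarith
    next
      case False
      then have "cross_nbrs A v = {u\<in>A. {u, v} \<in> E}" by (auto simp: cross_nbrs_def)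
      then show ?thesis using A_deg[OF v] by simp
    qed
    interpret halved_expander n d lam E A t
      by unfold_locales (use A cnb_card t0 b2 in \<open>auto simp: x_def\<close>)
    \<comment> \<open>As \<open>2 ^ k1 \<le> z < 2 ^ (k1 + 1)\<close> and \<open>x = y * z\<close>,
      the leftover degree \<open>r\<close> will lie between \<open>y / 2\<close> and
      \<open>y\<close>.\<close>
    define k1 where "k1 = nat \<lfloor>log 2 z\<rfloor>"
    have logz: "log 2 z \<ge> 1" using b12 by (simp add: le_log_iff)
    have k1: "k1 \<ge> 1" "real k1 \<le> log 2 z" "log 2 z < real k1 + 1" using logz unfolding k1_def by linarith+
    have pow_le: "2 ^ k1 \<le> z" using k1(2) b12 by (simp add: le_log_iff powr_realpow)
    have pow_gt: "z < 2 ^ (k1 + 1)"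
    proof -
      have "z < 2 powr (real (k1 + 1))" using k1(3) b12 by (simp add: log_less_iff add.commute)
      then show ?thesis by (simp only: powr_realpow)
    qed
    define r where "r = real d / 2 ^ (k1 + 1)"
    have y0: "y > 0" using b8 by linarith
    have r_ge: "y / 2 \<le> r"
    proof -
      have "y * 2 ^ (k1 + 1) \<le> y * (2 * z)" using pow_le y0 by (intro mult_left_mono) auto
      then have "y / 2 * 2 ^ (k1 + 1) \<le> real d" using xyz by (simp add: x_def)
      then show ?thesis unfolding r_def by (simp add: pos_le_divide_eq)
    qed
    have r_le: "r \<le> y"
    proof -
      have "real d \<le> y * 2 ^ (k1 + 1)"
        using mult_left_mono[OF less_imp_le[OF pow_gt], of y] y0 xyz by (simp add: x_def)
      then show ?thesis unfolding r_def by (simp add: pos_divide_le_eq)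
    qed
    have k1_le: "real k1 \<le> log 2 x"
    proof -
      have "z \<le> x powr 1" unfolding z_def using x2 by (intro powr_mono) auto
      then have "log 2 z \<le> log 2 x" using x2 b12 by simp
      then show ?thesis using k1(2) by linarith
    qed
    have logx: "log 2 x \<ge> 0" using x2 by simp
    define s where "s = nat \<lceil>16 * t\<rceil>"
    have s: "16 * t \<le> real s" "real s \<le> 17 * t" "s > 0" using b3 unfolding s_def by linarith+
    define w where "w = nat \<lceil>2 * y\<rceil>"
    have w: "2 * y \<le> real w" "real w \<le> 2 * y + 1" using y0 unfolding w_def by linarith+
    have "(2::real) ^ (2 ^ k1) = 2 powr (real (2 ^ k1))" by (simp only: powr_realpow zero_less_numeral)
    also have "\<dots> \<le> 2 powr z" using pow_le by (intro powr_mono) auto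
    finally have "real (4 * d * 2 ^ (2 ^ k1)) * p \<le> 4 * x * 2 powr z * p"
      by (simp add: x_def p_def mult_left_mono)
    also have "\<dots> \<le> \<delta>" using b4 by (simp add: p_def \<delta>_def)
    finally have small1: "real (4 * d * 2 ^ (2 ^ k1)) * p \<le> \<delta>" .
    have sep: "64 * t \<le> r" using b5 r_ge by linarith
    have w_ge: "4 * t + 2 * real s + 1 \<le> real w" using s(2) b7 w(1) by linarith
    have "real k1 * real s \<le> log 2 x * (17 * t)" using k1_le s(2) logx by (intro mult_mono) auto
    then have leftover: "2 * t + 2 * real k1 * real s \<le> r / 4" using b6 r_ge by simp
    from dense_pieces[OF k1(1) \<delta>(1,2) p small1 r_def sep s(1,3) w_ge leftover]
    obtain P S lo R where pieces: "\<forall>j<k1. piece A w (P j) (S j) (lo j)"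
      "\<forall>i<k1. \<forall>j<k1. i \<noteq> j \<longrightarrow> P i \<inter> P j = {}"
      and R: "R \<inter> (\<Union>j<k1. P j) = {}" "R \<union> (\<Union>j<k1. P j) = internal A"
      and R_bal: "card {e\<in>R. e \<subseteq> A} = card {e\<in>R. e \<inter> A = {}}"
      and R_le: "\<forall>v. real (degree R v) \<le> 5 / 4 * r" and R_ge: "\<forall>v\<in>{1..n}. 3 / 4 * r \<le> real (degree R v)"
      by (elim exE conjE)
    \<comment> \<open>All degrees of the leftover lie between \<open>D / 2\<close> and
      \<open>D\<close>, since 5/8 < 3/4.\<close>
    define D where "D = nat \<lfloor>5 / 4 * r\<rfloor>"
    have D: "real D \<le> 5 / 4 * r" "5 / 4 * r - 1 \<le> real D" using r_ge y0 unfolding D_def by linarith+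
    have D_ge: "y / 2 \<le> real D" using D(2) r_ge b8 by linarith
    have D0: "D > 0" using D_ge y0 by (intro Nat.gr0I) auto
    have "\<exists>k2. 2 ^ 25 * D \<le> 2 ^ k2 \<and> 2 ^ k2 < 2 ^ 26 * D"
    proof -
      obtain m where "2 ^ m < 2 ^ 25 * D" "2 ^ 25 * D \<le> 2 ^ (m + 1)"
        using ex_power_ivl2[of 2 "2 ^ 25 * D"] D0 by auto
      then show ?thesis by (intro exI[of _ "m + 1"]) auto
    qed
    then obtain k2 where k2: "2 ^ 25 * D \<le> 2 ^ k2" "2 ^ k2 < 2 ^ 26 * D" by blast
    have k2_ge: "k2 \<ge> 2"
    proof -
      have "(2::nat) ^ 25 * 1 \<le> 2 ^ 25 * D" using D0 by (intro mult_left_mono) auto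
      then have "(2::nat) ^ 25 \<le> 2 ^ k2" using k2(1) by linarith
      then have "25 \<le> k2" by (rule power_le_imp_le_exp[rotated]) simp
      then show ?thesis by simp
    qed
    \<comment> \<open>\<open>2 ^ k1\<close> cancels against the denominator of \<open>r\<close>: the
      bits spent in the first round are regained through the smaller degree in the second.\<close>
    have k12: "real k1 + real k2 \<le> log 2 x + 26"
    proof -
      have "real (2 ^ k2) \<le> real (2 ^ 26 * D)" using k2(2) by (intro of_nat_mono) simp
      then have "(2::real) ^ k1 * 2 ^ k2 \<le> 2 ^ k1 * (2 ^ 26 * real D)" by (intro mult_left_mono) auto
      also have "\<dots> \<le> 2 ^ k1 * (2 ^ 26 * (5 / 4 * r))" using D(1) by (intro mult_left_mono) auto
      also have "\<dots> = 2 ^ 26 * (5 / 8 * x)" by (simp add: r_def x_def)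
      also have "\<dots> \<le> 2 ^ 26 * x" using x2 by simp
      finally have "2 powr real (k1 + k2) \<le> 2 ^ 26 * x" by (simp only: powr_realpow power_add zero_less_numeral)
      then have "real (k1 + k2) \<le> log 2 (2 ^ 26 * x)" using x2 by (subst le_log_iff) auto
      also have "\<dots> = 26 + log 2 x" using x2 log_pow_cancel[of "2::real" 26] by (subst log_mult) (simp_all del: log_pow_cancel)
      finally show ?thesis by simp
    qed
    have y_le: "y \<le> x" using b11 y0 by linarith
    have "\<exists>P S. (\<forall>j\<le>k2. piece A w (P j) (S j) 0) \<and>
      (\<forall>i\<le>k2. \<forall>j\<le>k2. i \<noteq> j \<longrightarrow> P i \<inter> P j = {}) \<and> (\<Union>j\<le>k2. P j) = R"
    proof (rule sparse_pieces[OF _ R_bal, where D = D and p = "exp (- y / 2000000)"])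
      show "R \<subseteq> internal A" using R(2) by blast
      show "degree R v \<le> D" for v using R_le unfolding D_def by (simp add: le_nat_floor)
      show "D \<le> 2 * degree R v" if "v \<in> {1..n}" for v
      proof -
        have "real D \<le> real (2 * degree R v)" using bspec[OF R_ge that] D(1) r_ge y0 by simp
        then show ?thesis by (simp only: of_nat_le_iff)
      qed
      show "D \<le> w"
      proof -
        have "real D \<le> real w" using D(1) r_le w(1) y0 by linarith
        then show ?thesis by simp
      qed
      \<comment> \<open>The value \<open>1 / 2 ^ 22\<close> of \<open>\<delta>\<close> is so small
        that \<open>2 * \<delta>\<close> stays below both Chernoff rates, 1/640000 for
        \<open>d\<close> and 1/6400 for \<open>D\<close>. The common exponent
        \<open>y / 2000000\<close> is reached through \<open>y \<le> x\<close> and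
        \<open>y / 2 \<le> D\<close>.\<close>
      show "exp (- (real d / 400)\<^sup>2 / (4 * real d)) / (1 - 1 / 2 ^ 22) ^ d \<le> exp (- y / 2000000)"
      proof (rule exp_div_power_le_exp)
        have "(real d / 400)\<^sup>2 / (4 * real d) = x / 640000" using x2 by (simp add: x_def power2_eq_square field_simps)
        then show "- (real d / 400)\<^sup>2 / (4 * real d) + 2 * (1 / 2 ^ 22) * real d \<le> - y / 2000000"
          using y_le y0 by (simp add: x_def[symmetric])
      qed auto
      show "exp (- (real D / 40)\<^sup>2 / (4 * real D)) / (1 - 1 / 2 ^ 22) ^ D \<le> exp (- y / 2000000)"
      proof (rule exp_div_power_le_exp)
        have "(real D / 40)\<^sup>2 / (4 * real D) = real D / 6400" using D0 by (simp add: power2_eq_square field_simps)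
        then show "- (real D / 40)\<^sup>2 / (4 * real D) + 2 * (1 / 2 ^ 22) * real D \<le> - y / 2000000"
          using D_ge y0 by simp
      qed auto
      have "real (4 * d * (2 * (k2 + 1))) * exp (- y / 2000000) = 8 * x * (real k2 + 1) * exp (- y / 2000000)"
        by (simp add: x_def algebra_simps)
      also have "\<dots> \<le> 8 * x * (log 2 x + 28) * exp (- y / 2000000)"
        using k12 x2 by (intro mult_right_mono mult_left_mono) auto
      also have "\<dots> \<le> 1 / 2 ^ 22 / 2" using b9 by simp
      finally show "real (4 * d * (2 * (k2 + 1))) * exp (- y / 2000000) \<le> 1 / 2 ^ 22 / 2" .
    qed (use k2 k2_ge D0 in auto)
    then obtain P' S' where P': "\<forall>j\<le>k2. piece A w (P' j) (S' j) 0"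
      "\<forall>i\<le>k2. \<forall>j\<le>k2. i \<noteq> j \<longrightarrow> P' i \<inter> P' j = {}" and P'_Un: "(\<Union>j\<le>k2. P' j) = R"
      by (elim exE conjE)
    \<comment> \<open>The sparse round gives \<open>k2 + 1\<close> pieces because of the extra
      label. The edges left between the sides form one more graph, which makes at most
      \<open>log 2 x + 28\<close> in all.\<close>
    define k where "k = k1 + (k2 + 1)"
    define Q where "Q j = (if j < k1 then P j else P' (j - k1))" for j
    have k_le: "real k \<le> log 2 x + 27" using k12 by (simp add: k_def)
    have "\<exists>Hs. is_decomposition E Hs \<and> (\<forall>H\<in>set Hs. regular_bipartite_spanning n E H) \<and> length Hs = k + 1"
    proof (rule decomposition_from_pieces[OF A(1,2), where P = Q and w = w
          and S = "\<lambda>j. if j < k1 then S j else S' (j - k1)" and lo = "\<lambda>j. if j < k1 then lo j else 0"])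
      show "piece A w (Q j) (if j < k1 then S j else S' (j - k1)) (if j < k1 then lo j else 0)" if "j < k" for j
        using pieces(1) P'(1) that by (auto simp: Q_def k_def)
      have cross_disj: "P i \<inter> P' j = {}" if "i < k1" "j \<le> k2" for i j using R(1) P'_Un that by blast
      show "Q i \<inter> Q j = {}" if "i < k" "j < k" "i \<noteq> j" for i j
      proof -
        have "i < k1 \<or> i - k1 \<le> k2" "j < k1 \<or> j - k1 \<le> k2" using that by (auto simp: k_def)
        then show ?thesis
          using pieces(2) P'(2) cross_disj[of i "j - k1"] cross_disj[of j "i - k1"] that(3)
          by (cases "i < k1"; cases "j < k1") (auto simp: Q_def)
      qed
      show "(\<Union>j<k. Q j) = internal A"
      proof -
        have "(\<Union>j<k. Q j) = (\<Union>j<k1. P j) \<union> (\<Union>j\<le>k2. P' j)"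
        proof
          show "(\<Union>j<k. Q j) \<subseteq> (\<Union>j<k1. P j) \<union> (\<Union>j\<le>k2. P' j)" by (fastforce simp: Q_def k_def split: if_splits)
          have "P j \<subseteq> (\<Union>j<k. Q j)" if "j < k1" for j using that by (intro subsetI UN_I[of j]) (auto simp: Q_def k_def)
          moreover have "P' j \<subseteq> (\<Union>j<k. Q j)" if "j \<le> k2" for j
            using that by (intro subsetI UN_I[of "k1 + j"]) (auto simp: Q_def k_def)
          ultimately show "(\<Union>j<k1. P j) \<union> (\<Union>j\<le>k2. P' j) \<subseteq> (\<Union>j<k. Q j)"
            by (intro Un_least UN_least) auto
        qed
        then show ?thesis unfolding P'_Un using R(2) by (simp add: Un_commute)
      qed
      show "0 < w" using w(1) y0 by (intro Nat.gr0I) auto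
      have "real (11 * k * w) = 11 * real k * real w" by simp
      also have "\<dots> \<le> 11 * (log 2 x + 30) * (2 * y + 1)"
        using k_le w(2) logx y0 by (intro mult_mono) auto
      finally show "real (11 * k * w) \<le> real d / 200" using b10 by (simp add: x_def)
      show "real w \<le> real d / 1000" using w(2) b11 by (simp add: x_def)
    qed
    then obtain Hs where Hs: "is_decomposition E Hs" "\<forall>H\<in>set Hs. regular_bipartite_spanning n E H" "length Hs = k + 1" by blast
    have "real (length Hs) \<le> log 2 (real d) + 36" using Hs(3) k_le by (simp add: x_def)
    then show ?thesis using Hs by blast
  qed
  show ?thesis by (intro exI[of _ "max d1 2"]) (use main in auto)
qed

end
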